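(* In the setting of the context, let $0\le p\le\varsigma-1$ and assume that $U_{\mathfrak{d}_p}\cap U_{\mathfrak{d}_{p+1}}=\emptyset$. Then there exist $K_3>0$ and $K_4\in\mathbb{R}$ such that $$|u^{\mathfrak{d}_{p+1}}(t,z,\epsilon)-u^{\mathfrak{d}_p}(t,z,\epsilon)|\le K_3\exp\Big(-\frac{k_1}{2\log(q)}\log^2|\epsilon|\Big)|\epsilon|^{K_4},$$ $$|f^{\mathfrak{d}_{p+1}}(t,z,\epsilon)-f^{\mathfrak{d}_p}(t,z,\epsilon)|\le K_3\exp\Big(-\frac{k_1}{2\log(q)}\log^2|\epsilon|\Big)|\epsilon|^{K_4},$$ for every $t\in\mathcal{T}$, $z\in H_{\beta'}$ and $\epsilon\in\mathcal{E}_p\cap\mathcal{E}_{p+1}$.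
   Context: Notation. $q>1$ is real. For $\gamma\in\mathbb{R}$, $\sigma_q^\gamma g(t)=g(q^\gamma t)$ whenever the right-hand side makes sense (acting on $t$, resp. $T$, $\tau$), $\sigma_q=\sigma_q^1$; equations are understood wherever all terms are defined. $D(0,r)$ is the open disc, $\overline D(0,r)$ its closure, $\mathbb{C}^\star=\mathbb{C}\setminus\{0\}$, and $c_k(n):=(q^{1/k})^{n(n-1)/2}$. $E_{(\beta,\mu)}$ is the Banach space of continuous $h:\mathbb{R}\to\mathbb{C}$ with $\|h\|_{(\beta,\mu)}=\sup_m(1+|m|)^\mu e^{\beta|m|}|h(m)|<\infty$. For $R\in\mathbb{C}[X]$, $(h_1\ast^Rh_2)(m)=\int_{-\infty}^\infty h_1(m-m_1)R(im_1)h_2(m_1)dm_1$ (acting in $m$ when other variables are present). $\mathcal{F}^{-1}(h)(z)=(2\pi)^{-1/2}\int_{-\infty}^\infty h(m)e^{izm}dm$, $H_\beta=\{z\in\mathbb{C}:|\Im z|<\beta\}$. For $k>0$: $\Theta_{q^{1/k}}(x)=\sum_{n\in\mathbb{Z}}q^{-n(n-1)/(2k)}x^n$, $\pi_{q^{1/k}}=\frac{\log q}{k}\prod_{n\ge0}(1-q^{-(n+1)/k})^{-1}$, and $\mathcal{L}^\gamma_{q;1/k}(f)(T)=\frac1{\pi_{q^{1/k}}}\int_{L_\gamma}\frac{f(u)}{\Theta_{q^{1/k}}(u/T)}\frac{du}{u}$ with $L_\gamma=(0,\infty)e^{i\gamma}$; the value does not depend on the choice of $\gamma$ in the sector where $f$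 is defined with suitable growth. Function spaces. For an unbounded sector $U_d$ with vertex $0$ and bisecting direction $d$, $\rho>0$, and $\delta>0$ with $\mathrm{dist}(U_d\cup D(0,\rho),-\delta)>0$, $\mathrm{Exp}^d_{(k,\beta,\mu,\alpha,\rho)}$ is the Banach space of continuous $h$ on $(U_d\cup\overline D(0,\rho))\times\mathbb{R}$, holomorphic in $\tau\in U_d\cup D(0,\rho)$, with norm $\sup(1+|m|)^\mu e^{\beta|m|}\exp(-\frac{k\log^2|\tau+\delta|}{2\log q}-\alpha\log|\tau+\delta|)|h(\tau,m)|<\infty$. For an infinite sector $S_d$ and a bounded domain $\mathcal{R}_d^b$, $\mathrm{Exp}^d_{(k,\beta,\mu,\nu)}$ is the Banach space of continuous $h$ on $(S_d\cup\overline{\mathcal{R}_d^b})\times\mathbb{R}$ (closure in $\mathbb{C}^\star$), holomorphic in $\tau\in S_d\cup\mathcal{R}_d^b$, with norm $\sup(1+|m|)^\mu e^{\beta|m|}\exp(-\frac{k\log^2|\tau|}{2\log q}-\nu\log|\tau|)|h(\tau,m)|<\infty$. Data. $1\le k_1<k_2$, $D\ge3$, $d_D\ge1$ are integers, $\frac1\kappa=\frac1{k_1}-\frac1{k_2}$. For $1\le\ell\le D-1$: $I_\ell$ is a finite nonempty set of nonnegative integers, $\delta_\ell\ge1$ an integer, and for $\lambda\in I_\ell$, $d_{\lambda,\ell}\ge1$, $\Delta_{\lambda,\ell}\ge0$ are integers. Assume $\delta_1=1$, $\delta_\ell<\delta_{\ell+1}$ ($1\le\ell\le D-2$), and for all $1\le\ell\le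 D-1$, $\lambda\in I_\ell$: $\Delta_{\lambda,\ell}\ge d_{\lambda,\ell}$, $\frac{d_{\lambda,\ell}}{k_2}+1\ge\delta_\ell$, $\frac{d_D-1}{k_2}+1\ge\delta_\ell$. $Q,R_1,\dots,R_D\in\mathbb{C}[X]$ with $\deg Q\ge\deg R_D\ge\deg R_\ell$ ($1\le\ell\le D-1$), $Q(im)\ne0$, $R_D(im)\neq0$ for $m\in\mathbb{R}$, and $\frac{Q(im)}{R_D(im)}\in S_{Q,R_D}=\{z:|z|\ge r_{Q,R_D},|\arg z-d_{Q,R_D}|\le\eta_{Q,R_D}\}$ for all $m\in\mathbb{R}$, with some $r_{Q,R_D},\eta_{Q,R_D}>0$, $d_{Q,R_D}\in\mathbb{R}$. Let $\beta>0$, $\mu>\deg(R_D)+1$, $\epsilon_0>0$. The maps $m\mapsto C_{\lambda,\ell}(m,\epsilon)$, $m\mapsto F_n(m,\epsilon)$ ($n\ge0$) lie in $E_{(\beta,\mu)}$, depend holomorphically on $\epsilon\in D(0,\epsilon_0)$, and $\|C_{\lambda,\ell}(\cdot,\epsilon)\|_{(\beta,\mu)}\le\tilde C_{\lambda,\ell}$, $\|F_n(\cdot,\epsilon)\|_{(\beta,\mu)}\le C_F\rho^{-n}q^{n(n-1)/(2k_1)}$ for all $\epsilon\in D(0,\epsilon_0)$. Put $c_{\lambda,\ell}(z,\epsilon)=\mathcal{F}^{-1}(m\mapsto C_{\lambda,\ell}(m,\epsilon))(z)$. Fix $0<\beta'<\beta$. Good covering. For an integer $\varsigma\ge2$, $(\mathcal{E}_p)_{0\le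 p\le\varsigma-1}$ is a good covering in $\mathbb{C}^\star$: each $\mathcal{E}_p$ is an open sector with vertex $0$ and radius $\epsilon_0$, $\mathcal{E}_j\cap\mathcal{E}_k\ne\emptyset$ iff $|j-k|\le1$ (indices cyclic, $\mathcal{E}_\varsigma:=\mathcal{E}_0$), and $\bigcup_p\mathcal{E}_p=\mathcal{U}\setminus\{0\}$ for a neighborhood $\mathcal{U}$ of $0$. All indices $p$ are cyclic mod $\varsigma$. Associated family. For each $p$, $U_{\mathfrak{d}_p}$ and $S_{\mathfrak{d}_p}$ are unbounded sectors with vertex $0$ and bisecting direction $\mathfrak{d}_p$; $\delta>0$ has positive distance from $-\delta$ to each $U_{\mathfrak{d}_p}\cup D(0,\rho)$; $\tilde\delta>0$; $\mathcal{R}_{\mathfrak{d}_p,\tilde\delta}=\{T\in\mathbb{C}^\star:|1+e^{i\mathfrak{d}_p}r/T|>\tilde\delta\ \forall r\ge0\}$; $\mathcal{T}$ is an open bounded sector with vertex $0$ and radius $r_{\mathcal{T}}>0$; $\mathcal{R}^b_{\mathfrak{d}_p}=\mathcal{R}_{\mathfrak{d}_p,\tilde\delta}\cap D(0,\epsilon_0r_{\mathcal{T}})\subseteq\overline D(0,\rho)$; $S_{\mathfrak{d}_p}\subseteq\mathcal{R}_{\mathfrak{d}_p,\tilde\delta}$. Assume $0<\epsilon_0,r_{\mathcal{T}}<1$, $\nu+\frac{k_2}{\log q}\log r_{\mathcal{T}}<0$, $\alpha+\frac{\kappa}{\log q}\log(\epsilon_0r_{\mathcal{T}})<0$, $\epsilon_0r_{\mathcal{T}}\le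 q^{(\frac12-\nu)/k_2}/2$ ($\alpha,\nu$ introduced below). Let $q_l(m)$, $0\le l\le d_D-1$, be the roots of $P_m(\tau)=\frac{Q(im)}{c_{k_2}(k_2)}-\frac{R_D(im)}{c_{k_2}(d_D+k_2)}\tau^{d_D}$. Assume: (1) there is $M_1>0$ with $|\tau-q_l(m)|\ge M_1(1+|\tau|)$ for all $l$, $m\in\mathbb{R}$, $p$, $\tau\in S_{\mathfrak{d}_p}\cup\overline D(0,\rho)$; (2) there are $M_2>0$ and $l_0$ with $|\tau-q_{l_0}(m)|\ge M_2|q_{l_0}(m)|$ for all $m$, $p$, $\tau\in S_{\mathfrak{d}_p}\cup\overline D(0,\rho)$; (3) $\mathcal{R}^b_{\mathfrak{d}_p}\cap\mathcal{R}^b_{\mathfrak{d}_{p+1}}\ne\emptyset$ and $\epsilon t\in\mathcal{R}^b_{\mathfrak{d}_p}$ for all $t\in\mathcal{T}$, $\epsilon\in\mathcal{E}_p$, all $p$. Forcing term. $\psi_{k_1}(\tau,m,\epsilon)=\sum_{n\ge0}F_n(m,\epsilon)\tau^n/c_{k_1}(n)$ (convergent on $D(0,\rho)$) extends analytically in $\tau$ to $U_{\mathfrak{d}_p}$ as $\psi_{k_1}^{\mathfrak{d}_p}\in\mathrm{Exp}^{\mathfrak{d}_p}_{(k_1,\beta,\mu,\alpha,\rho)}$ for some $\alpha>0$, with norm bounded by a constant $\zeta_{\psi_{k_1}}$ independent of $\epsilon\in D(0,\epsilon_0)$. Then $\psi_{k_2}^{\mathfrak{d}_p}(\tau,m,\epsilon):=\mathcal{L}^{\mathfrak{d}_p}_{q;1/\kappa}(h\mapsto\psi_{k_1}^{\mathfrak{d}_p}(h,m,\epsilon))(\tau)$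 lies in $\mathrm{Exp}^{\mathfrak{d}_p}_{(k_2,\beta,\mu,\nu)}$, uniformly in $\epsilon$, for some $\nu\in\mathbb{R}$ (depending only on $q,k_1,k_2,\alpha$), which is fixed. Put $F^{\mathfrak{d}_p}(T,m,\epsilon)=\mathcal{L}^{\mathfrak{d}_p}_{q;1/k_2}(\tau\mapsto\psi_{k_2}^{\mathfrak{d}_p}(\tau,m,\epsilon))(T)$ and $f^{\mathfrak{d}_p}(t,z,\epsilon)=\mathcal{F}^{-1}(m\mapsto F^{\mathfrak{d}_p}(\epsilon t,m,\epsilon))(z)$, bounded holomorphic on $\mathcal{T}\times H_{\beta'}\times\mathcal{E}_p$. Problem $(E_p)$: $$Q(\partial_z)\sigma_qu^{\mathfrak{d}_p}=(\epsilon t)^{d_D}\sigma_q^{\frac{d_D}{k_2}+1}R_D(\partial_z)u^{\mathfrak{d}_p}+\sum_{\ell=1}^{D-1}\Big(\sum_{\lambda\in I_\ell}t^{d_{\lambda,\ell}}\epsilon^{\Delta_{\lambda,\ell}}\sigma_q^{\delta_\ell}c_{\lambda,\ell}(z,\epsilon)R_\ell(\partial_z)u^{\mathfrak{d}_p}\Big)+\sigma_qf^{\mathfrak{d}_p}(t,z,\epsilon).$$ Construction of the solutions. It is assumed that $r_{Q,R_D}$ is large enough, and that (depending on it) $\zeta_{\psi_{k_1}}$ and the $\tilde C_{\lambda,\ell}$ are small enough, so that for a fixed $\varpi>0$ and each $p$ and $\epsilon\in D(0,\epsilon_0)$: (i) the equation $Q(im)\frac{\tau^{k_1}}{c_{k_1}(k_1)}w=\frac{\tau^{d_D+k_1}}{c_{k_1}(d_D+k_1)}\sigma_q^{-d_D/\kappa}R_D(im)w+\sum_{\ell,\lambda}\frac{\epsilon^{\Delta_{\lambda,\ell}-d_{\lambda,\ell}}\tau^{d_{\lambda,\ell}+k_1}}{c_{k_1}(d_{\lambda,\ell}+k_1)}\sigma_q^{\delta_\ell-\frac{d_{\lambda,\ell}}{k_1}-1}\frac{1}{(2\pi)^{1/2}}(C_{\lambda,\ell}\ast^{R_\ell}w)+\frac{\tau^{k_1}}{c_{k_1}(k_1)}\psi_{k_1}^{\mathfrak{d}_p}$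 has a unique solution $w_{k_1}^{\mathfrak{d}_p}$ in the closed ball of radius $\varpi$ of $\mathrm{Exp}^{\mathfrak{d}_p}_{(\kappa,\beta,\mu,\alpha,\rho)}$; (ii) the equation $Q(im)\frac{\tau^{k_2}}{c_{k_2}(k_2)}w=R_D(im)\frac{\tau^{d_D+k_2}}{c_{k_2}(d_D+k_2)}w+\sum_{\ell,\lambda}\frac{\epsilon^{\Delta_{\lambda,\ell}-d_{\lambda,\ell}}\tau^{d_{\lambda,\ell}+k_2}}{c_{k_2}(d_{\lambda,\ell}+k_2)}\sigma_q^{\delta_\ell-\frac{d_{\lambda,\ell}}{k_2}-1}\frac{1}{(2\pi)^{1/2}}(C_{\lambda,\ell}\ast^{R_\ell}w)+\frac{\tau^{k_2}}{c_{k_2}(k_2)}\psi_{k_2}^{\mathfrak{d}_p}$ has a unique solution $w_{k_2}^{\mathfrak{d}_p}$ in $\mathrm{Exp}^{\mathfrak{d}_p}_{(k_2,\beta,\mu,\nu)}$, of norm $\le\varpi$; (iii) both are holomorphic in $\epsilon\in D(0,\epsilon_0)$, and $w_{k_2}^{\mathfrak{d}_p}$ is the analytic continuation in $\tau$ of $\mathcal{L}^{\mathfrak{d}_p}_{q;1/\kappa}(w_{k_1}^{\mathfrak{d}_p})(\tau,m,\epsilon)$. The solution of $(E_p)$ is $$u^{\mathfrak{d}_p}(t,z,\epsilon)=\frac1{(2\pi)^{1/2}}\frac1{\pi_{q^{1/k_2}}}\int_{-\infty}^\infty\int_{L_{\gamma_p}}\frac{w_{k_2}^{\mathfrak{d}_p}(u,m,\epsilon)}{\Theta_{q^{1/k_2}}(\frac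 u{\epsilon t})}\frac{du}ue^{izm}dm,$$ with a halfline $L_{\gamma_p}\subseteq S_{\mathfrak{d}_p}$ whose direction may depend on $\epsilon t$; it is bounded holomorphic on $\mathcal{T}\times H_{\beta'}\times\mathcal{E}_p$. *)

theory Defs
  imports "HOL-Analysis.Analysis"
begin

definition sigma :: "real \<Rightarrow> real \<Rightarrow> (complex \<Rightarrow> complex) \<Rightarrow> complex \<Rightarrow> complex" where
  "sigma q s g t = g (of_real (q powr s) * t)"

definition cq :: "real \<Rightarrow> real \<Rightarrow> nat \<Rightarrow> real" where
  "cq q k n = (q powr (1 / k)) powr (real n * (real n - 1) / 2)"

text \<open>\<open>Theta q k\<close> and \<open>pi_q q k\<close> are attached to the base \<open>q powr (1/k)\<close>.\<close>

definition Theta :: "real \<Rightarrow> real \<Rightarrow> complex \<Rightarrow> complex" where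
  "Theta q k x =
     (\<Sum>\<^sub>\<infinity>n\<in>(UNIV :: int set). of_real (q powr (- (real_of_int (n * (n - 1)) / (2 * k)))) * x powi n)"

definition pi_q :: "real \<Rightarrow> real \<Rightarrow> real" where
  "pi_q q k = ln q / k * (\<Prod>n. inverse (1 - q powr (- ((real n + 1) / k))))"

definition halfline :: "real \<Rightarrow> complex set" where
  "halfline \<gamma> = {of_real r * cis \<gamma> | r. 0 < r}"

definition halfline_integral :: "real \<Rightarrow> (complex \<Rightarrow> complex) \<Rightarrow> complex" where
  "halfline_integral \<gamma> g = (LINT r:{0<..}|lborel. g (of_real r * cis \<gamma>) * cis \<gamma>)"

definition q_laplace :: "real \<Rightarrow> real \<Rightarrow> real \<Rightarrow> (complex \<Rightarrow> complex) \<Rightarrow> complex \<Rightarrow> complex" where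
  "q_laplace q k \<gamma> f T =
     1 / of_real (pi_q q k) * halfline_integral \<gamma> (\<lambda>u. f u / Theta q k (u / T) / u)"

definition inv_fourier :: "(real \<Rightarrow> complex) \<Rightarrow> complex \<Rightarrow> complex" where
  "inv_fourier h z =
     1 / of_real (sqrt (2 * pi)) * (LINT m|lborel. h m * exp (\<i> * z * of_real m))"

definition conv :: "complex poly \<Rightarrow> (real \<Rightarrow> complex) \<Rightarrow> (real \<Rightarrow> complex) \<Rightarrow> real \<Rightarrow> complex" where
  "conv R h1 h2 m = (LINT m1|lborel. h1 (m - m1) * poly R (\<i> * of_real m1) * h2 m1)"

text \<open>The parameter \<open>\<eta>\<close> is half of the opening. Openings up to \<open>2 * pi\<close> are allowed.\<close>

definition sector :: "real \<Rightarrow> real \<Rightarrow> complex set" where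
  "sector d \<eta> = {of_real r * cis \<theta> | r \<theta>. 0 < r \<and> \<bar>\<theta> - d\<bar> < \<eta>}"

definition unbounded_sector :: "real \<Rightarrow> complex set \<Rightarrow> bool" where
  "unbounded_sector d S \<longleftrightarrow> (\<exists>\<eta>. 0 < \<eta> \<and> \<eta> \<le> pi \<and> S = sector d \<eta>)"

definition bounded_sector :: "real \<Rightarrow> complex set \<Rightarrow> bool" where
  "bounded_sector r S \<longleftrightarrow> (\<exists>d \<eta>. 0 < \<eta> \<and> \<eta> \<le> pi \<and> S = sector d \<eta> \<inter> ball 0 r)"

definition strip :: "real \<Rightarrow> complex set" where
  "strip b = {z. \<bar>Im z\<bar> < b}"

definition good_covering :: "nat \<Rightarrow> real \<Rightarrow> (nat \<Rightarrow> complex set) \<Rightarrow> bool" where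
  "good_covering N \<epsilon>0 E \<longleftrightarrow>
     (\<forall>p<N. bounded_sector \<epsilon>0 (E p)) \<and>
     (\<forall>j<N. \<forall>k<N. E j \<inter> E k \<noteq> {} \<longleftrightarrow> j = k \<or> k = Suc j mod N \<or> j = Suc k mod N) \<and>
     (\<exists>V. 0 \<in> interior V \<and> (\<Union>p<N. E p) = V - {0})"

definition calR :: "real \<Rightarrow> real \<Rightarrow> complex set" where
  "calR d \<delta> = {T. T \<noteq> 0 \<and> (\<forall>r\<ge>0. norm (1 + cis d * of_real r / T) > \<delta>)}"

definition closed_trunc_sector :: "real \<Rightarrow> real \<Rightarrow> real \<Rightarrow> complex set" where
  "closed_trunc_sector r d \<eta> =
     {z. r \<le> norm z \<and> (\<exists>\<theta>. z = of_real (norm z) * cis \<theta> \<and> \<bar>\<theta> - d\<bar> \<le> \<eta>)}"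

text \<open>Each Banach space is given by its set of elements together with its norm.\<close>

definition weight_E :: "real \<Rightarrow> real \<Rightarrow> real \<Rightarrow> real" where
  "weight_E \<beta> \<mu> m = (1 + \<bar>m\<bar>) powr \<mu> * exp (\<beta> * \<bar>m\<bar>)"

definition E_space :: "real \<Rightarrow> real \<Rightarrow> (real \<Rightarrow> complex) set" where
  "E_space \<beta> \<mu> = {h. continuous_on UNIV h \<and> bdd_above (range (\<lambda>m. weight_E \<beta> \<mu> m * norm (h m)))}"

definition E_norm :: "real \<Rightarrow> real \<Rightarrow> (real \<Rightarrow> complex) \<Rightarrow> real" where
  "E_norm \<beta> \<mu> h = (SUP m. weight_E \<beta> \<mu> m * norm (h m))"

definition weight_Exp :: "real \<Rightarrow> real \<Rightarrow> real \<Rightarrow> real \<Rightarrow> real \<Rightarrow> complex \<Rightarrow> real \<Rightarrow> real" where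
  "weight_Exp q k \<beta> \<mu> \<alpha> x m =
     weight_E \<beta> \<mu> m * exp (- (k * (ln (norm x))\<^sup>2 / (2 * ln q)) - \<alpha> * ln (norm x))"

text \<open>The spaces of functions on an unbounded sector \<open>U\<close> together with the closed disc of
  radius \<open>\<rho>\<close>; the weight is shifted by \<open>\<delta>\<close>.\<close>

definition ExpU_space ::
  "real \<Rightarrow> real \<Rightarrow> real \<Rightarrow> real \<Rightarrow> real \<Rightarrow> real \<Rightarrow> real \<Rightarrow> complex set \<Rightarrow> (complex \<Rightarrow> real \<Rightarrow> complex) set"
  where
  "ExpU_space q k \<beta> \<mu> \<alpha> \<rho> \<delta> U =
     {h. continuous_on ((U \<union> cball 0 \<rho>) \<times> UNIV) (\<lambda>(\<tau>, m). h \<tau> m) \<and>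
         (\<forall>m. (\<lambda>\<tau>. h \<tau> m) holomorphic_on (U \<union> ball 0 \<rho>)) \<and>
         bdd_above ((\<lambda>(\<tau>, m). weight_Exp q k \<beta> \<mu> \<alpha> (\<tau> + of_real \<delta>) m * norm (h \<tau> m)) `
                      ((U \<union> cball 0 \<rho>) \<times> UNIV))}"

definition ExpU_norm ::
  "real \<Rightarrow> real \<Rightarrow> real \<Rightarrow> real \<Rightarrow> real \<Rightarrow> real \<Rightarrow> real \<Rightarrow> complex set \<Rightarrow> (complex \<Rightarrow> real \<Rightarrow> complex) \<Rightarrow> real"
  where
  "ExpU_norm q k \<beta> \<mu> \<alpha> \<rho> \<delta> U h =
     (SUP (\<tau>, m)\<in>(U \<union> cball 0 \<rho>) \<times> UNIV. weight_Exp q k \<beta> \<mu> \<alpha> (\<tau> + of_real \<delta>) m * norm (h \<tau> m))"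

text \<open>The spaces of functions on an infinite sector \<open>S\<close> together with the closure, relative to
  the punctured plane, of a bounded domain \<open>B\<close>.\<close>

definition ExpS_dom :: "complex set \<Rightarrow> complex set \<Rightarrow> complex set" where
  "ExpS_dom S B = S \<union> (closure B - {0})"

definition ExpS_space ::
  "real \<Rightarrow> real \<Rightarrow> real \<Rightarrow> real \<Rightarrow> real \<Rightarrow> complex set \<Rightarrow> complex set \<Rightarrow> (complex \<Rightarrow> real \<Rightarrow> complex) set"
  where
  "ExpS_space q k \<beta> \<mu> \<nu> S B =
     {h. continuous_on (ExpS_dom S B \<times> UNIV) (\<lambda>(\<tau>, m). h \<tau> m) \<and>
         (\<forall>m. (\<lambda>\<tau>. h \<tau> m) holomorphic_on (S \<union> B)) \<and>
         bdd_above ((\<lambda>(\<tau>, m). weight_Exp q k \<beta> \<mu> \<nu> \<tau> m * norm (h \<tau> m)) ` (ExpS_dom S B \<times> UNIV))}"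

definition ExpS_norm ::
  "real \<Rightarrow> real \<Rightarrow> real \<Rightarrow> real \<Rightarrow> real \<Rightarrow> complex set \<Rightarrow> complex set \<Rightarrow> (complex \<Rightarrow> real \<Rightarrow> complex) \<Rightarrow> real"
  where
  "ExpS_norm q k \<beta> \<mu> \<nu> S B h =
     (SUP (\<tau>, m)\<in>ExpS_dom S B \<times> UNIV. weight_Exp q k \<beta> \<mu> \<nu> \<tau> m * norm (h \<tau> m))"

text \<open>Both auxiliary equations have the shape below: the first one with \<open>k = k1\<close> and
  \<open>s = - dD / \<kappa>\<close>, the second one with \<open>k = k2\<close> and \<open>s = 0\<close>. The argument \<open>w\<close> is a function of
  \<open>(\<tau>, m)\<close>, for one fixed value of \<open>\<epsilon>\<close>. In the setting of the theorem all the dilation factors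
  \<open>q powr _\<close> are at most 1, and the sets \<open>Dom\<close> used are stable under multiplication by such
  factors, so that every term is defined at every point of \<open>Dom\<close>.\<close>

definition borel_equation ::
  "real \<Rightarrow> nat \<Rightarrow> real \<Rightarrow> nat \<Rightarrow> nat \<Rightarrow> (nat \<Rightarrow> nat set) \<Rightarrow> (nat \<Rightarrow> nat \<Rightarrow> nat) \<Rightarrow> (nat \<Rightarrow> nat \<Rightarrow> nat) \<Rightarrow>
   (nat \<Rightarrow> nat) \<Rightarrow> complex poly \<Rightarrow> (nat \<Rightarrow> complex poly) \<Rightarrow>
   (nat \<Rightarrow> nat \<Rightarrow> real \<Rightarrow> complex \<Rightarrow> complex) \<Rightarrow> complex \<Rightarrow> (complex \<Rightarrow> real \<Rightarrow> complex) \<Rightarrow>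
   complex set \<Rightarrow> (complex \<Rightarrow> real \<Rightarrow> complex) \<Rightarrow> bool"
  where
  "borel_equation q k s D dD I d \<Delta> dl Q R C \<epsilon> \<psi> Dom w \<longleftrightarrow>
     (\<forall>\<tau>\<in>Dom. \<forall>m.
        poly Q (\<i> * of_real m) * (\<tau> ^ k / of_real (cq q k k)) * w \<tau> m =
          \<tau> ^ (dD + k) / of_real (cq q k (dD + k))
            * sigma q s (\<lambda>x. poly (R D) (\<i> * of_real m) * w x m) \<tau>
        + (\<Sum>l = 1..D - 1. \<Sum>j\<in>I l.
             \<epsilon> ^ (\<Delta> j l - d j l) * \<tau> ^ (d j l + k) / of_real (cq q k (d j l + k))
             * sigma q (real (dl l) - real (d j l) / real k - 1)
                 (\<lambda>x. 1 / of_real (sqrt (2 * pi)) * conv (R l) (\<lambda>m'. C j l m' \<epsilon>) (w x) m) \<tau>)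
        + \<tau> ^ k / of_real (cq q k k) * \<psi> \<tau> m)"

text \<open>Functions are total, hence uniqueness of a solution is uniqueness of its values on the
  domain of definition.\<close>

definition unique_solution_in ::
  "(complex \<Rightarrow> real \<Rightarrow> complex) set \<Rightarrow> complex set \<Rightarrow> ((complex \<Rightarrow> real \<Rightarrow> complex) \<Rightarrow> bool) \<Rightarrow>
   (complex \<Rightarrow> real \<Rightarrow> complex) \<Rightarrow> bool"
  where
  "unique_solution_in A Dom eqn w \<longleftrightarrow>
     w \<in> A \<and> eqn w \<and> (\<forall>w'\<in>A. eqn w' \<longrightarrow> (\<forall>\<tau>\<in>Dom. \<forall>m. w' \<tau> m = w \<tau> m))"

text \<open>A half-line in direction \<open>\<gamma>\<close> is admissible at \<open>T\<close> for the sector \<open>S\<close> with bisecting direction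
  \<open>d\<close> if the half-line of direction \<open>d\<close> can be rotated onto it inside \<open>S\<close> without meeting the
  half-line through \<open>- T\<close>, which carries the zeros of \<open>u \<mapsto> Theta q k (u / T)\<close>. This is the range
  of directions in which the value of the transform is independent of \<open>\<gamma>\<close>.\<close>

definition admissible_direction :: "real \<Rightarrow> complex set \<Rightarrow> complex \<Rightarrow> real \<Rightarrow> bool" where
  "admissible_direction d S T \<gamma> \<longleftrightarrow>
     (\<forall>\<theta>\<in>closed_segment d \<gamma>. halfline \<theta> \<subseteq> S \<and> - T \<notin> halfline \<theta>)"

end

theory Submission
  imports Defs "HOL-Complex_Analysis.Complex_Analysis"
    "HOL-Computational_Algebra.Fundamental_Theorem_Algebra"
begin

text \<open>Fix two neighbouring indices, put \<open>T = \<epsilon> t\<close> and \<open>L = log |T|\<close>. Both differences are treated in the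
  same way: each of the two functions is a Fourier integral in \<open>m\<close> of an outer q-Laplace
  transform (order \<open>k2\<close>) of a function \<open>w\<close>, and near the origin \<open>w\<close> is an inner q-Laplace transform
  (order \<open>\<kappa>\<close>) of a function \<open>v\<close>. For the solutions, \<open>v\<close> and \<open>w\<close> are \<open>w1\<close> and \<open>w2\<close>; for the forcing terms
  they are \<open>\<psi>1\<close> and \<open>\<psi>2\<close>.

  The functions \<open>v\<close> of the two directions agree on the disc of radius \<open>\<rho>\<close>. For \<open>\<psi>1\<close> both are the sum
  of one power series. For \<open>w1\<close> the difference solves the homogeneous equation, in which every
  term on the right carries an additional factor \<open>\<tau>\<close>; the equation is therefore a contraction on a
  small disc (\<open>borel_equation_unique_near_0\<close>), the difference vanishes there, and the identity
  theorem extends this to the whole disc.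

  Every estimate rests on one lower bound, \<open>Theta_lower_bound\<close>: away from its zeros
  \<open>|Theta q k x|\<close> is at least a constant times \<open>exp (k log\<^sup>2 |x| / (2 log q)) |x|\<^sup>1\<^sup>/\<^sup>2\<close>. The quotient of
  the two sides is invariant under dilation by \<open>q\<^sup>1\<^sup>/\<^sup>k\<close>, so that it is enough to know that \<open>Theta\<close> has
  no zero off the negative axis, and this follows from Jacobi's triple product.

  Now compare two q-Laplace transforms at a point \<open>\<tau>\<close> along two half-lines. The tails, where the
  variable of integration is at least a fixed radius, and the arc of that radius are of size
  \<open>exp (- \<kappa> log\<^sup>2 |\<tau>| / (2 log q)) |\<tau>|\<^sup>M\<close>. What remains near the origin cancels by Cauchy's theorem if
  the integrands agree there. The half-lines may be rotated into each other without meeting the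
  zeros of the kernel: these lie on the half-line through \<open>- \<tau>\<close>, and one of the two arcs between the
  directions misses it (\<open>rotation_between_directions\<close>). Hence the two functions \<open>w\<close> differ by a
  quantity of that size (\<open>inner_laplace_difference\<close>). In the outer transform the tails and arcs are of
  size \<open>exp (- k2 L\<^sup>2 / (2 log q)) |T|\<^sup>M\<close>, and both rays are rotated to the middle direction, where the
  two functions \<open>w\<close> can be compared. The product of the two Gaussians is largest for
  \<open>log r = k2 L / (\<kappa> + k2)\<close>, and since \<open>1 / k1 = 1 / \<kappa> + 1 / k2\<close> the maximum is
  \<open>exp (- k1 L\<^sup>2 / (2 log q))\<close> up to a power of \<open>|T|\<close> (\<open>kernel_gauss\<close>, \<open>outer_laplace_difference\<close>). This is the
  dominating contribution. All bounds are linear in the size of \<open>v\<close> and \<open>w\<close>, hence carry the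
  exponential decay in \<open>m\<close> that makes the Fourier integral converge on the strip
  (\<open>flat_difference\<close>), and \<open>|T| \<le> |\<epsilon>| < 1\<close> lets \<open>|T|\<close> be replaced by \<open>|\<epsilon>|\<close> (\<open>gauss_power_mono\<close>).\<close>

section \<open>The theta function as an infinite product\<close>

text \<open>The finite product \<open>(p; p)\<^sub>n\<close>.\<close>

definition qpoch :: "real \<Rightarrow> nat \<Rightarrow> real" where
  "qpoch p n = (\<Prod>i<n. 1 - p ^ Suc i)"

text \<open>The Gaussian binomial coefficient.\<close>

definition qbinom :: "real \<Rightarrow> nat \<Rightarrow> nat \<Rightarrow> real" where
  "qbinom p n k = (if k \<le> n then qpoch p n / (qpoch p k * qpoch p (n - k)) else 0)"

context
  fixes p :: real
  assumes p: "0 < p" "p < 1"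
begin

lemma power_Suc_less_1: "p ^ Suc i < 1"
  using p power_Suc_less_one[of p i] by simp

lemma qpoch_pos: "qpoch p n > 0"
  unfolding qpoch_def using power_Suc_less_1 by (intro prod_pos) (auto simp: algebra_simps)

lemma qpoch_Suc: "qpoch p (Suc n) = qpoch p n * (1 - p ^ Suc n)"
  by (simp add: qpoch_def)

lemma qbinom_0 [simp]: "qbinom p n 0 = 1"
  using qpoch_pos[of n] by (simp add: qbinom_def) (simp add: qpoch_def)

lemma qbinom_pascal:
  "qbinom p (Suc n) (Suc k) = qbinom p n (Suc k) + p ^ (n - k) * qbinom p n k"
proof (cases "k < n")
  case True
  then obtain j where j: "n = Suc (k + j)" by (metis less_imp_Suc_add)
  have pos: "qpoch p k > 0" "qpoch p j > 0" "qpoch p n > 0" by (simp_all add: qpoch_pos)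
  have lt: "1 - p * p ^ k > 0" "1 - p * p ^ j > 0" 
    using power_Suc_less_1[of k] power_Suc_less_1[of j] by simp_all
  show ?thesis using pos lt
    by (simp add: qbinom_def j qpoch_Suc divide_simps power_add power2_eq_square)
       (simp add: algebra_simps)
next
  case False
  show ?thesis
  proof (cases "k = n")
    case True
    moreover have "qpoch p 0 = 1" by (simp add: qpoch_def)
    ultimately show ?thesis using qpoch_pos[of n] qpoch_pos[of "Suc n"]
      by (simp add: qbinom_def)
  qed (use False in \<open>auto simp: qbinom_def\<close>)
qed

lemma choose_two_Suc: "Suc k choose 2 = (k choose 2) + k"
  by (simp add: numeral_2_eq_2)

text \<open>The \<open>p\<close>-analogue of the binomial theorem, by induction from the Pascal rule.\<close>

lemma qbinomial_theorem:
  fixes y :: complex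
  shows "(\<Prod>i<n. 1 + y * of_real p ^ i) = (\<Sum>k\<le>n. of_real (qbinom p n k * p ^ (k choose 2)) * y ^ k)"
proof (induction n)
  case 0
  then show ?case by (simp add: numeral_2_eq_2)
next
  case (Suc n)
  let ?a = "\<lambda>n k. complex_of_real (qbinom p n k * p ^ (k choose 2)) * y ^ k"
  have top: "?a n (Suc n) = 0" by (simp add: qbinom_def)
  have step: "?a (Suc n) (Suc k) = ?a n (Suc k) + y * of_real p ^ n * ?a n k" if "k \<le> n" for k
  proof -
    have e: "p ^ (Suc k choose 2) * p ^ (n - k) = p ^ (k choose 2) * p ^ n"
      using that by (simp add: choose_two_Suc flip: power_add)
    have "qbinom p (Suc n) (Suc k) * p ^ (Suc k choose 2)
        = qbinom p n (Suc k) * p ^ (Suc k choose 2) + p ^ n * (qbinom p n k * p ^ (k choose 2))"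
      unfolding qbinom_pascal using e by (simp add: algebra_simps)
    then have "complex_of_real (qbinom p (Suc n) (Suc k) * p ^ (Suc k choose 2)) =
      complex_of_real (qbinom p n (Suc k) * p ^ (Suc k choose 2)) + of_real p ^ n * complex_of_real (qbinom p n k * p ^ (k choose 2))"
      by (simp flip: of_real_power of_real_mult of_real_add)
    then show ?thesis
      by (simp only:) (simp add: algebra_simps)
  qed
  have "(\<Sum>k\<le>Suc n. ?a (Suc n) k) = ?a (Suc n) 0 + (\<Sum>k\<le>n. ?a (Suc n) (Suc k))"
    by (rule sum.atMost_Suc_shift)
  also have "(\<Sum>k\<le>n. ?a (Suc n) (Suc k)) = (\<Sum>k\<le>n. ?a n (Suc k)) + y * of_real p ^ n * (\<Sum>k\<le>n. ?a n k)"
    by (simp add: step sum.distrib sum_distrib_left del: of_real_mult power_Suc)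
  also have "?a (Suc n) 0 + ((\<Sum>k\<le>n. ?a n (Suc k)) + y * of_real p ^ n * (\<Sum>k\<le>n. ?a n k))
     = (\<Sum>k\<le>Suc n. ?a n k) + y * of_real p ^ n * (\<Sum>k\<le>n. ?a n k)"
    unfolding sum.atMost_Suc_shift[of "?a n"] by (simp add: algebra_simps)
  also have "\<dots> = (\<Sum>k\<le>n. ?a n k) * (1 + y * of_real p ^ n)"
    using top by (simp add: algebra_simps)
  finally show ?case using Suc by simp
qed

lemma choose_two_plus: "(N + n choose 2) + (Suc N choose 2) = N * (N + n) + (n choose 2)"
  by (induction N) (auto simp: choose_two_Suc numeral_2_eq_2)

lemma choose_two_minus:
  "(k choose 2) + (Suc (Suc (k + m)) choose 2) = Suc (k + m) * k + (Suc (Suc m) choose 2)"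
  by (induction k) (auto simp: choose_two_Suc)

text \<open>The finite form of Jacobi's triple product: it is the \<open>p\<close>-binomial theorem with \<open>2 N\<close> factors, at
  \<open>x / p\<^sup>N\<close>. The summands are split at the index \<open>N\<close> because the series for \<open>Theta\<close> is treated
  as two series over the natural numbers.\<close>

lemma finite_triple_product:
  fixes x :: complex
  assumes x: "x \<noteq> 0"
  shows "(\<Prod>i<N. (1 + x * of_real p ^ i) * (1 + of_real p ^ Suc i / x)) =
     (\<Sum>n\<le>N. of_real (qbinom p (2 * N) (N + n) * p ^ (n choose 2)) * x ^ n) +
     (\<Sum>m<N. of_real (qbinom p (2 * N) (N - Suc m) * p ^ (Suc (Suc m) choose 2)) * (1 / x) ^ Suc m)"
proof -
  let ?p = "complex_of_real p"
  have p0: "?p \<noteq> 0" using p by simp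
  have tri: "(\<Prod>i<N. ?p ^ Suc i) = ?p ^ (Suc N choose 2)"
    by (induction N) (simp_all add: choose_two_Suc power_add numeral_2_eq_2 mult_ac)
  define a where "a k = complex_of_real (qbinom p (2 * N) k) * ?p ^ (k choose 2) * (x / ?p ^ N) ^ k" for k
  \<comment> \<open>\<open>c\<close> is the monomial that turns the factors \<open>1 + x / p\<^sup>i\<^sup>+\<^sup>1\<close> into \<open>1 + p\<^sup>i\<^sup>+\<^sup>1 / x\<close>.\<close>
  define c where "c = ?p ^ (Suc N choose 2) / x ^ N"
  have "(\<Prod>i<2*N. 1 + (x / ?p ^ N) * ?p ^ i) =
        (\<Prod>i<N. 1 + (x / ?p ^ N) * ?p ^ i) * (\<Prod>i<N. 1 + (x / ?p ^ N) * ?p ^ (i + N))"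
  proof -
    have "(\<Prod>i\<in>{N..<2*N}. 1 + (x / ?p ^ N) * ?p ^ i) = (\<Prod>i<N. 1 + (x / ?p ^ N) * ?p ^ (i + N))"
      using prod.shift_bounds_nat_ivl[of "\<lambda>i. 1 + (x / ?p ^ N) * ?p ^ i" 0 N N]
      by (simp add: mult_2 atLeast0LessThan)
    then show ?thesis
      using prod.atLeastLessThan_concat[of 0 N "2*N" "\<lambda>i. 1 + (x / ?p ^ N) * ?p ^ i"]
      by (simp add: atLeast0LessThan)
  qed
  also have "(\<Prod>i<N. 1 + (x / ?p ^ N) * ?p ^ (i + N)) = (\<Prod>i<N. 1 + x * ?p ^ i)"
    using p0 by (simp add: power_add)
  also have "(\<Prod>i<N. 1 + (x / ?p ^ N) * ?p ^ i) = (\<Prod>i<N. 1 + (x / ?p ^ N) * ?p ^ (N - Suc i))"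
    by (rule prod.nat_diff_reindex[symmetric])
  also have "\<dots> = (\<Prod>i<N. (x / ?p ^ Suc i) * (1 + ?p ^ Suc i / x))"
  proof (rule prod.cong)
    fix i assume "i \<in> {..<N}"
    then have "?p ^ N = ?p ^ (N - Suc i) * ?p ^ Suc i" by (simp flip: power_add power_Suc)
    then show "1 + (x / ?p ^ N) * ?p ^ (N - Suc i) = (x / ?p ^ Suc i) * (1 + ?p ^ Suc i / x)"
      using p0 x by (simp add: field_simps)
  qed simp
  also have "\<dots> = (x ^ N / ?p ^ (Suc N choose 2)) * (\<Prod>i<N. 1 + ?p ^ Suc i / x)"
    unfolding prod.distrib prod_dividef tri by simp
  finally have "(\<Prod>i<N. (1 + x * ?p ^ i) * (1 + ?p ^ Suc i / x)) = c * (\<Prod>i<2*N. 1 + (x / ?p ^ N) * ?p ^ i)"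
    using p0 x by (simp add: prod.distrib c_def)
  also have "(\<Prod>i<2*N. 1 + (x / ?p ^ N) * ?p ^ i) = (\<Sum>k\<le>2*N. a k)"
    unfolding qbinomial_theorem a_def by simp
  also have "(\<Sum>k\<le>2*N. a k) = (\<Sum>k\<in>{N..2*N}. a k) + (\<Sum>k<N. a k)"
  proof -
    have "{..2*N} = {N..2*N} \<union> {..<N}" by auto
    then show ?thesis by (simp only:) (rule sum.union_disjoint, auto)
  qed
  also have "(\<Sum>k\<in>{N..2*N}. a k) = (\<Sum>n\<le>N. a (N + n))"
    using sum.shift_bounds_cl_nat_ivl[of a 0 N N] by (simp add: mult_2 atLeast0AtMost add.commute)
  also have "(\<Sum>k<N. a k) = (\<Sum>m<N. a (N - Suc m))"
    by (rule sum.nat_diff_reindex[symmetric])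
  also have "c * ((\<Sum>n\<le>N. a (N + n)) + (\<Sum>m<N. a (N - Suc m))) =
     (\<Sum>n\<le>N. c * a (N + n)) + (\<Sum>m<N. c * a (N - Suc m))"
    by (simp add: distrib_left sum_distrib_left)
  also have "(\<Sum>n\<le>N. c * a (N + n)) = (\<Sum>n\<le>N. of_real (qbinom p (2 * N) (N + n) * p ^ (n choose 2)) * x ^ n)"
  proof (rule sum.cong)
    fix n
    have "?p ^ (N + n choose 2) * ?p ^ (Suc N choose 2) = ?p ^ (N * (N + n)) * ?p ^ (n choose 2)"
      by (simp add: choose_two_plus flip: power_add)
    then have e: "?p ^ (N + n choose 2) * ?p ^ (Suc N choose 2) / (?p ^ N) ^ (N + n) = ?p ^ (n choose 2)"
      using p0 by (simp add: power_mult)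
    have "c * a (N + n) = complex_of_real (qbinom p (2 * N) (N + n)) *
        (?p ^ (N + n choose 2) * ?p ^ (Suc N choose 2) / (?p ^ N) ^ (N + n)) * (x ^ (N + n) / x ^ N)"
      by (simp add: a_def c_def power_divide mult_ac)
    also have "\<dots> = of_real (qbinom p (2 * N) (N + n) * p ^ (n choose 2)) * x ^ n"
      unfolding e using x by (simp add: power_add)
    finally show "c * a (N + n) = of_real (qbinom p (2 * N) (N + n) * p ^ (n choose 2)) * x ^ n" .
  qed simp
  also have "(\<Sum>m<N. c * a (N - Suc m)) =
     (\<Sum>m<N. of_real (qbinom p (2 * N) (N - Suc m) * p ^ (Suc (Suc m) choose 2)) * (1 / x) ^ Suc m)"
  proof (rule sum.cong)
    fix m assume "m \<in> {..<N}"
    then obtain k where N: "N = Suc (k + m)" by (metis lessThan_iff less_imp_Suc_add add.commute)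
    have "?p ^ (k choose 2) * ?p ^ (Suc N choose 2) = ?p ^ (N * k) * ?p ^ (Suc (Suc m) choose 2)"
      unfolding N by (simp only: choose_two_minus flip: power_add)
    then have e: "?p ^ (k choose 2) * ?p ^ (Suc N choose 2) / (?p ^ N) ^ k = ?p ^ (Suc (Suc m) choose 2)"
      using p0 by (simp add: power_mult)
    have k: "N - Suc m = k" using N by simp
    have "c * a k = complex_of_real (qbinom p (2 * N) k) *
        (?p ^ (k choose 2) * ?p ^ (Suc N choose 2) / (?p ^ N) ^ k) * (x ^ k / x ^ N)"
      by (simp add: a_def c_def power_divide mult_ac)
    also have "x ^ k / x ^ N = (1 / x) ^ Suc m"
      using x by (simp add: N power_add field_simps)
    finally show "c * a (N - Suc m) = of_real (qbinom p (2 * N) (N - Suc m) * p ^ (Suc (Suc m) choose 2)) * (1 / x) ^ Suc m"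
      unfolding e k by simp
  qed simp
  finally show ?thesis .
qed

end

text \<open>The part of the Laurent series of \<open>Theta\<close> with nonnegative exponents. The other part is the same
  series at \<open>p / x\<close> without its constant term, so that one entire function describes \<open>Theta\<close>.\<close>

definition half_theta :: "real \<Rightarrow> complex \<Rightarrow> complex" where
  "half_theta p y = (\<Sum>n. of_real (p ^ (n choose 2)) * y ^ n)"

context
  fixes p :: real
  assumes p: "0 < p" "p < 1"
begin

lemma half_theta_summable_norm: "summable (\<lambda>n. norm (complex_of_real (p ^ (n choose 2)) * y ^ n))"
proof -
  have "(\<lambda>n. p ^ n * norm y) \<longlonglongrightarrow> 0 * norm y"
    using p by (intro tendsto_intros LIMSEQ_power_zero) auto
  then have "eventually (\<lambda>n. p ^ n * norm y < 1/2) sequentially"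
    by (rule order_tendstoD) simp
  then obtain N where N: "\<And>n. n \<ge> N \<Longrightarrow> p ^ n * norm y < 1/2"
    by (auto simp: eventually_sequentially)
  show ?thesis
  proof (rule summable_ratio_test[where c = "1/2" and N = N])
    fix n assume n: "n \<ge> N"
    have "norm (complex_of_real (p ^ (Suc n choose 2)) * y ^ Suc n) =
      (p ^ n * norm y) * norm (complex_of_real (p ^ (n choose 2)) * y ^ n)"
      using p by (simp add: choose_two_Suc[OF p] power_add norm_mult norm_power)
    also have "\<dots> \<le> 1/2 * norm (complex_of_real (p ^ (n choose 2)) * y ^ n)"
      using N[OF n] by (intro mult_right_mono) auto
    finally show "norm (norm (complex_of_real (p ^ (Suc n choose 2)) * y ^ Suc n))
        \<le> 1/2 * norm (norm (complex_of_real (p ^ (n choose 2)) * y ^ n))" by simp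
  qed simp
qed

lemma half_theta_summable: "summable (\<lambda>n. complex_of_real (p ^ (n choose 2)) * y ^ n)"
  using summable_norm_cancel[OF half_theta_summable_norm] .

lemma half_theta_holomorphic: "half_theta p holomorphic_on A"
proof -
  have "(half_theta p has_field_derivative (\<Sum>n. diffs (\<lambda>n. complex_of_real (p ^ (n choose 2))) n * y ^ n)) (at y)" for y
    unfolding half_theta_def
    by (rule termdiffs_strong_converges_everywhere) (rule half_theta_summable)
  then show ?thesis
    using holomorphic_on_open[of UNIV "half_theta p"] holomorphic_on_subset by blast
qed

lemma half_theta_rec: "half_theta p y = 1 + y * half_theta p (of_real p * y)"
proof -
  have "half_theta p y = (\<Sum>n. of_real (p ^ (Suc n choose 2)) * y ^ Suc n) + of_real (p ^ (0 choose 2)) * y ^ 0"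
    unfolding half_theta_def by (subst suminf_split_head[OF half_theta_summable]) simp
  also have "(\<Sum>n. complex_of_real (p ^ (Suc n choose 2)) * y ^ Suc n) =
      (\<Sum>n. y * (complex_of_real (p ^ (n choose 2)) * (of_real p * y) ^ n))"
    by (rule suminf_cong) (simp add: choose_two_Suc[OF p] power_add power_mult_distrib)
  also have "\<dots> = y * half_theta p (of_real p * y)"
    unfolding half_theta_def by (rule suminf_mult[OF half_theta_summable])
  finally show ?thesis by (simp add: numeral_2_eq_2)
qed

lemma half_theta_tail_sums:
  "(\<lambda>m. complex_of_real (p ^ (Suc (Suc m) choose 2)) * y ^ Suc m) sums (half_theta p (of_real p * y) - 1)"
proof -
  have "(\<lambda>n. complex_of_real (p ^ (n choose 2)) * (of_real p * y) ^ n) sums half_theta p (of_real p * y)"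
    unfolding half_theta_def by (rule summable_sums[OF half_theta_summable])
  then have "(\<lambda>n. complex_of_real (p ^ (Suc n choose 2)) * (of_real p * y) ^ Suc n) sums
     (half_theta p (of_real p * y) - complex_of_real (p ^ (0 choose 2)) * (of_real p * y) ^ 0)"
    by (subst sums_Suc_iff) simp
  moreover have "complex_of_real (p ^ (Suc n choose 2)) * (of_real p * y) ^ Suc n =
      complex_of_real (p ^ (Suc (Suc n) choose 2)) * y ^ Suc n" for n
    unfolding choose_two_Suc[OF p, of "Suc n"] by (simp add: power_add power_mult_distrib)
  moreover have "complex_of_real (p ^ (0 choose 2)) * (of_real p * y) ^ 0 = 1" by (simp add: numeral_2_eq_2)
  ultimately show ?thesis by (simp only:)
qed

lemma half_theta_tail_summable_norm:
  "summable (\<lambda>m. norm (complex_of_real (p ^ (Suc (Suc m) choose 2)) * y ^ Suc m))"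
proof -
  have "summable (\<lambda>n. norm (complex_of_real (p ^ (Suc n choose 2)) * (of_real p * y) ^ Suc n))"
    using half_theta_summable_norm[of "of_real p * y"] by (subst summable_Suc_iff)
  moreover have "complex_of_real (p ^ (Suc n choose 2)) * (of_real p * y) ^ Suc n =
      complex_of_real (p ^ (Suc (Suc n) choose 2)) * y ^ Suc n" for n
    unfolding choose_two_Suc[OF p, of "Suc n"] by (simp add: power_add power_mult_distrib)
  ultimately show ?thesis by (simp only:)
qed

lemma qpoch_bounds: "\<exists>P>0. (\<forall>n. P \<le> qpoch p n) \<and> qpoch p \<longlonglongrightarrow> P"
proof -
  define f where "f i = 1 - p ^ Suc i" for i
  have fpos: "f i > 0" and fle: "f i \<le> 1" for i 
    using p power_Suc_less_one[of p i] by (auto simp: f_def simp del: power_Suc)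
  have "abs_convergent_prod f"
  proof (rule summable_imp_abs_convergent_prod)
    have "summable (\<lambda>i. p * p ^ i)" using p by (intro summable_mult summable_geometric) auto
    then show "summable (\<lambda>i. norm (f i - 1))" using p by (simp add: f_def)
  qed
  then have cp: "convergent_prod f" by (rule abs_convergent_prod_imp_convergent_prod)
  have q: "qpoch p n = (\<Prod>i<n. f i)" for n by (simp add: qpoch_def f_def)
  have P: "prodinf f > 0" by (rule less_0_prodinf[OF cp fpos])
  have lim: "qpoch p \<longlonglongrightarrow> prodinf f"
    using convergent_prod_LIMSEQ[OF cp] unfolding q[abs_def]
    by (subst (asm) LIMSEQ_lessThan_iff_atMost[symmetric])
  have "decseq (qpoch p)"
  proof (rule decseq_SucI)
    show "qpoch p (Suc n) \<le> qpoch p n" for n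
      using fle[of n] qpoch_pos[OF p, of n] by (simp add: qpoch_Suc[OF p] f_def mult_left_le)
  qed
  from P decseq_ge[OF this lim] lim show ?thesis by blast
qed

lemma qpoch_le_1: "qpoch p n \<le> 1"
  unfolding qpoch_def using power_Suc_less_1[OF p] p by (intro prod_le_1) (auto simp: less_imp_le simp del: power_Suc)

text \<open>The finite triple products converge to an infinite product without vanishing factor, and by
  Tannery's theorem to \<open>Theta / (p; p)\<^sub>\<infinity>\<close>.\<close>

lemma half_theta_pair_nonzero:
  assumes x: "x \<noteq> 0" and nz: "\<And>r::real. r > 0 \<Longrightarrow> 1 + of_real r * x \<noteq> 0"
  shows "half_theta p x + half_theta p (of_real p / x) - 1 \<noteq> 0"
proof -
  obtain P where P: "P > 0" "\<And>n. P \<le> qpoch p n" "qpoch p \<longlonglongrightarrow> P"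
    using qpoch_bounds by blast
  have qb: "\<bar>qbinom p n k\<bar> \<le> 1 / P\<^sup>2" for n k
  proof (cases "k \<le> n")
    case True
    have "qpoch p n / (qpoch p k * qpoch p (n - k)) \<le> 1 / (P * P)"
      using P qpoch_le_1 by (intro frac_le mult_mono) (auto intro: less_imp_le[OF qpoch_pos[OF p]])
    then show ?thesis using True P qpoch_pos[OF p]
      by (simp add: qbinom_def power2_eq_square less_imp_le)
  qed (auto simp: qbinom_def)
  have bnd: "norm (complex_of_real (qbinom p n k * c) * z) \<le> 1 / P\<^sup>2 * norm (complex_of_real c * z)" for n k c z
    using mult_right_mono[OF qb[of n k], of "norm (complex_of_real c * z)"]
    by (simp add: norm_mult abs_mult mult_ac)
  define F where "F N = (\<Prod>i<N. (1 + x * of_real p ^ i) * (1 + of_real p ^ Suc i / x))" for N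
  define a where "a n N = (if n \<le> N then of_real (qbinom p (2 * N) (N + n) * p ^ (n choose 2)) * x ^ n else 0)" for n N
  define b where "b m N = (if m < N then of_real (qbinom p (2 * N) (N - Suc m) * p ^ (Suc (Suc m) choose 2)) * (1 / x) ^ Suc m else 0)" for m N
  have F_eq: "F N = (\<Sum>n. a n N) + (\<Sum>m. b m N)" for N
  proof -
    have "(\<Sum>n. a n N) = (\<Sum>n\<le>N. a n N)" by (rule suminf_finite) (auto simp: a_def)
    moreover have "(\<Sum>m. b m N) = (\<Sum>m<N. b m N)" by (rule suminf_finite) (auto simp: b_def)
    ultimately show ?thesis unfolding F_def finite_triple_product[OF p x] by (simp add: a_def b_def)
  qed
  have lim1: "(\<lambda>N. qbinom p (2 * N) (N + n)) \<longlonglongrightarrow> 1 / P" for n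
  proof -
    have "(\<lambda>N. qpoch p (2 * N) / (qpoch p (N + n) * qpoch p (N - n))) \<longlonglongrightarrow> P / (P * P)"
      using P(1) by (intro tendsto_intros filterlim_compose[OF P(3)] filterlim_minus_const_nat_at_top 
          filterlim_subseq LIMSEQ_ignore_initial_segment[OF P(3)]) (auto simp: strict_mono_def)
    moreover have "eventually (\<lambda>N. qpoch p (2 * N) / (qpoch p (N + n) * qpoch p (N - n)) = qbinom p (2 * N) (N + n)) sequentially"
      using eventually_ge_at_top[of n] by eventually_elim (simp add: qbinom_def mult_2)
    ultimately have "(\<lambda>N. qbinom p (2 * N) (N + n)) \<longlonglongrightarrow> P / (P * P)" by (rule Lim_transform_eventually)
    then show ?thesis using P(1) by simp
  qed
  have lim2: "(\<lambda>N. qbinom p (2 * N) (N - Suc m)) \<longlonglongrightarrow> 1 / P" for m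
  proof (rule Lim_transform_eventually[OF lim1[of "Suc m"]])
    show "eventually (\<lambda>N. qbinom p (2 * N) (N + Suc m) = qbinom p (2 * N) (N - Suc m)) sequentially"
      using eventually_ge_at_top[of "Suc m"]
      by eventually_elim (simp add: qbinom_def mult_2 mult.commute)
  qed
  have A: "(\<lambda>N. \<Sum>n. a n N) \<longlonglongrightarrow> (\<Sum>n. of_real (1 / P * p ^ (n choose 2)) * x ^ n)"
  proof (rule tannerys_theorem[THEN conjunct2, THEN conjunct2])
    show "summable (\<lambda>n. 1 / P\<^sup>2 * norm (complex_of_real (p ^ (n choose 2)) * x ^ n))"
      by (intro summable_mult half_theta_summable_norm)
    have "norm (a n N) \<le> 1 / P\<^sup>2 * norm (complex_of_real (p ^ (n choose 2)) * x ^ n)" for n N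
      unfolding a_def by (cases "n \<le> N") (simp_all only: bnd if_True if_False, simp)
    then show "\<forall>\<^sub>F (n, N) in sequentially \<times>\<^sub>F sequentially. norm (a n N) \<le> 1 / P\<^sup>2 * norm (complex_of_real (p ^ (n choose 2)) * x ^ n)"
      by (intro always_eventually) (simp add: split_def)
    fix n
    show "(\<lambda>N. a n N) \<longlonglongrightarrow> of_real (1 / P * p ^ (n choose 2)) * x ^ n"
    proof (rule Lim_transform_eventually)
      show "(\<lambda>N. of_real (qbinom p (2 * N) (N + n) * p ^ (n choose 2)) * x ^ n) \<longlonglongrightarrow> of_real (1 / P * p ^ (n choose 2)) * x ^ n"
        by (intro tendsto_intros lim1)
      show "eventually (\<lambda>N. of_real (qbinom p (2 * N) (N + n) * p ^ (n choose 2)) * x ^ n = a n N) sequentially"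
        using eventually_ge_at_top[of n] by eventually_elim (simp add: a_def)
    qed
  qed simp
  have B: "(\<lambda>N. \<Sum>n. b n N) \<longlonglongrightarrow> (\<Sum>n. of_real (1 / P * p ^ (Suc (Suc n) choose 2)) * (1/x) ^ Suc n)"
  proof (rule tannerys_theorem[THEN conjunct2, THEN conjunct2])
    show "summable (\<lambda>n. 1 / P\<^sup>2 * norm (complex_of_real (p ^ (Suc (Suc n) choose 2)) * (1/x) ^ Suc n))"
      by (intro summable_mult half_theta_tail_summable_norm)
    have "norm (b n N) \<le> 1 / P\<^sup>2 * norm (complex_of_real (p ^ (Suc (Suc n) choose 2)) * (1/x) ^ Suc n)" for n N
      unfolding b_def by (cases "n < N") (simp_all only: bnd if_True if_False, simp)
    then show "\<forall>\<^sub>F (n, N) in sequentially \<times>\<^sub>F sequentially. norm (b n N) \<le> 1 / P\<^sup>2 * norm (complex_of_real (p ^ (Suc (Suc n) choose 2)) * (1/x) ^ Suc n)"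
      by (intro always_eventually) (simp add: split_def)
    fix n
    show "(\<lambda>N. b n N) \<longlonglongrightarrow> of_real (1 / P * p ^ (Suc (Suc n) choose 2)) * (1/x) ^ Suc n"
    proof (rule Lim_transform_eventually)
      show "(\<lambda>N. of_real (qbinom p (2 * N) (N - Suc n) * p ^ (Suc (Suc n) choose 2)) * (1/x) ^ Suc n) \<longlonglongrightarrow> of_real (1 / P * p ^ (Suc (Suc n) choose 2)) * (1/x) ^ Suc n"
        by (intro tendsto_intros lim2)
      show "eventually (\<lambda>N. of_real (qbinom p (2 * N) (N - Suc n) * p ^ (Suc (Suc n) choose 2)) * (1/x) ^ Suc n = b n N) sequentially"
        using eventually_gt_at_top[of n] by eventually_elim (simp add: b_def)
    qed
  qed simp
  have sA: "(\<Sum>n. complex_of_real (1 / P * p ^ (n choose 2)) * x ^ n) = half_theta p x / of_real P"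
    using suminf_mult[OF half_theta_summable[of x], of "1 / of_real P"]
    by (simp add: half_theta_def mult_ac)
  have sB: "(\<Sum>n. complex_of_real (1 / P * p ^ (Suc (Suc n) choose 2)) * (1/x) ^ Suc n) = (half_theta p (of_real p / x) - 1) / of_real P"
    using sums_unique[OF sums_mult[OF half_theta_tail_sums[of "1/x"], of "1 / of_real P"]]
    by (simp add: mult_ac)
  have lim: "F \<longlonglongrightarrow> (half_theta p x + half_theta p (of_real p / x) - 1) / of_real P"
    using tendsto_add[OF A B] unfolding sA sB F_eq[abs_def] by (simp add: diff_divide_distrib add_divide_distrib add_diff_eq)
  define g where "g i = (1 + x * of_real p ^ i) * (1 + of_real p ^ Suc i / x)" for i
  have nz1: "1 + x * of_real p ^ i \<noteq> 0" for i
    using nz[of "p ^ i"] p by (simp add: mult.commute)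
  have nz2: "1 + of_real p ^ Suc i / x \<noteq> 0" for i
  proof
    assume "1 + of_real p ^ Suc i / x = 0"
    then have "1 + of_real (1 / p ^ Suc i) * x = 0" using p x by (simp add: field_simps)
    with nz[of "1 / p ^ Suc i"] p show False by simp
  qed
  have "convergent_prod (\<lambda>i. 1 + x * of_real p ^ i)"
  proof (rule abs_convergent_prod_imp_convergent_prod, rule summable_imp_abs_convergent_prod)
    have "summable (\<lambda>i. norm x * p ^ i)" using p by (intro summable_mult summable_geometric) auto
    then show "summable (\<lambda>i. norm (1 + x * of_real p ^ i - 1))" using p by (simp add: norm_mult norm_power)
  qed
  moreover have "convergent_prod (\<lambda>i. 1 + of_real p ^ Suc i / x)"
  proof (rule abs_convergent_prod_imp_convergent_prod, rule summable_imp_abs_convergent_prod)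
    have "summable (\<lambda>i. p / norm x * p ^ i)" using p by (intro summable_mult summable_geometric) auto
    then show "summable (\<lambda>i. norm (1 + of_real p ^ Suc i / x - 1))" using p by (simp add: norm_mult norm_power norm_divide)
  qed
  ultimately have cg: "convergent_prod g" unfolding g_def by (rule convergent_prod_mult)
  have "F \<longlonglongrightarrow> prodinf g"
    using convergent_prod_LIMSEQ[OF cg] unfolding F_def[abs_def] g_def[symmetric]
    by (subst (asm) LIMSEQ_lessThan_iff_atMost[symmetric])
  with lim have "(half_theta p x + half_theta p (of_real p / x) - 1) / of_real P = prodinf g"
    by (rule LIMSEQ_unique)
  moreover have "prodinf g \<noteq> 0"
    by (rule prodinf_nonzero[OF cg]) (use nz1 nz2 in \<open>simp add: g_def\<close>)
  ultimately show ?thesis by auto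
qed

end

section \<open>A lower bound for the theta function\<close>

text \<open>The parameter \<open>p\<close> of the preceding section that belongs to \<open>Theta q k\<close>.\<close>

definition theta_base :: "real \<Rightarrow> real \<Rightarrow> real" where
  "theta_base q k = q powr (- (1 / k))"

text \<open>This function has two roles. For \<open>\<nu> = 1/2\<close> it is, up to constant factors, the size of \<open>Theta q k\<close> at
  distance \<open>r\<close> from the origin, away from the zeros; for general \<open>\<nu>\<close> it is the growth admitted by the norms of the
  weighted spaces.\<close>

definition q_growth :: "real \<Rightarrow> real \<Rightarrow> real \<Rightarrow> real \<Rightarrow> real" where
  "q_growth q k \<nu> r = exp (k * (ln r)\<^sup>2 / (2 * ln q) + \<nu> * ln r)"

lemma q_growth_pos [simp]: "q_growth q k \<nu> r > 0"
  by (simp add: q_growth_def)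

lemma q_growth_nonneg [simp]: "0 \<le> q_growth q k \<nu> r"
  by (rule less_imp_le[OF q_growth_pos])

lemma q_growth_mono: "q > 1 \<Longrightarrow> k \<le> k' \<Longrightarrow> q_growth q k \<nu> r \<le> q_growth q k' \<nu> r"
  by (auto simp: q_growth_def intro!: divide_right_mono mult_right_mono)

lemma q_growth_half: "q_growth q k (1/2) r = exp (k * (ln r)\<^sup>2 / (2 * ln q) + ln r / 2)"
  by (simp add: q_growth_def)

lemma real_choose_two: "real (n choose 2) = real n * (real n - 1) / 2"
  by (induction n) (auto simp: numeral_2_eq_2 field_simps)

context
  fixes q k :: real
  assumes q: "q > 1" and k: "k > 0"
begin

lemma theta_base_bounds: "0 < theta_base q k" "theta_base q k < 1"
  using q k by (auto simp: theta_base_def powr_less_one)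

lemma ln_theta_base: "ln (theta_base q k) = - (ln q / k)"
  using q by (simp add: theta_base_def ln_powr)

lemma theta_base_power: "theta_base q k ^ n = q powr (- (real n / k))"
  using q by (simp add: theta_base_def powr_powr flip: powr_realpow)

lemma Theta_eq_half_theta:
  assumes x: "x \<noteq> 0"
  shows "Theta q k x = half_theta (theta_base q k) x + half_theta (theta_base q k) (of_real (theta_base q k) / x) - 1"
proof -
  define p where "p = theta_base q k"
  have p: "0 < p" "p < 1" using theta_base_bounds by (auto simp: p_def)
  define g where "g n = of_real (q powr (- (real_of_int (n * (n - 1)) / (2 * k)))) * x powi n" for n :: int
  have gp: "g (int n) = of_real (p ^ (n choose 2)) * x ^ n" for n
    by (simp add: g_def p_def theta_base_power real_choose_two flip: of_real_power) 
  have gn: "g (- 1 - int m) = of_real (p ^ (Suc (Suc m) choose 2)) * (1 / x) ^ Suc m" for m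
  proof -
    have "x powi (- 1 - int m) = (1 / x) ^ Suc m"
    proof -
      have "- 1 - int m = - int (Suc m)" by simp
      then show ?thesis by (simp only: power_int_minus power_int_of_nat) (simp add: field_simps)
    qed
    then show ?thesis unfolding g_def p_def theta_base_power real_choose_two
      by (simp add: algebra_simps)
  qed
  have s1: "(g has_sum half_theta p x) (range int)"
  proof (subst has_sum_reindex)
    show "(g \<circ> int has_sum half_theta p x) UNIV"
      unfolding comp_def gp half_theta_def
      by (intro norm_summable_imp_has_sum half_theta_summable_norm summable_sums half_theta_summable p)
  qed simp
  have s2: "(g has_sum (half_theta p (of_real p * (1/x)) - 1)) (range (\<lambda>m. - 1 - int m))"
  proof (subst has_sum_reindex)
    show "(g \<circ> (\<lambda>m. - 1 - int m) has_sum (half_theta p (of_real p * (1/x)) - 1)) UNIV"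
      unfolding comp_def gn
      by (intro norm_summable_imp_has_sum half_theta_tail_summable_norm half_theta_tail_sums p)
  qed (simp add: inj_on_def)
  have "(g has_sum (half_theta p x + (half_theta p (of_real p * (1/x)) - 1))) (range int \<union> range (\<lambda>m. - 1 - int m))"
    by (rule has_sum_Un_disjoint[OF s1 s2]) auto
  moreover have "range int \<union> range (\<lambda>m. - 1 - int m) = UNIV"
  proof -
    have "n \<in> range int \<union> range (\<lambda>m. - 1 - int m)" for n
    proof (cases "n \<ge> 0")
      case True
      then have "n = int (nat n)" by simp
      then show ?thesis by blast
    next
      case False
      then have "n = - 1 - int (nat (- 1 - n))" by simp
      then show ?thesis by blast
    qed
    then show ?thesis by auto
  qed
  ultimately have "(g has_sum (half_theta p x + (half_theta p (of_real p * (1/x)) - 1))) UNIV" by simp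
  from infsumI[OF this] show ?thesis
    unfolding Theta_def g_def[symmetric] by (simp add: p_def)
qed

lemma Theta_holomorphic: "0 \<notin> A \<Longrightarrow> Theta q k holomorphic_on A"
proof -
  assume A: "0 \<notin> A"
  define p where "p = theta_base q k"
  have p: "0 < p" "p < 1" using theta_base_bounds by (auto simp: p_def)
  have "(\<lambda>x. half_theta p x + half_theta p (of_real p / x) - 1) holomorphic_on A"
    using A
    by (intro holomorphic_intros half_theta_holomorphic[OF p] 
        holomorphic_on_compose[OF _ half_theta_holomorphic[OF p], unfolded comp_def]) auto
  moreover have "Theta q k x = half_theta p x + half_theta p (of_real p / x) - 1" if "x \<in> A" for x
    using Theta_eq_half_theta[of x] that A by (auto simp: p_def)
  ultimately show ?thesis
    using holomorphic_cong[of A A "Theta q k"] by auto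
qed

lemma Theta_continuous: "0 \<notin> A \<Longrightarrow> continuous_on A (Theta q k)"
  by (rule holomorphic_on_imp_continuous_on[OF Theta_holomorphic])

lemma Theta_nonzero:
  assumes "x \<noteq> 0" "\<And>r::real. r > 0 \<Longrightarrow> 1 + of_real r * x \<noteq> 0"
  shows "Theta q k x \<noteq> 0"
  unfolding Theta_eq_half_theta[OF assms(1)]
  using half_theta_pair_nonzero[OF theta_base_bounds assms] by simp

text \<open>Both parts of the series satisfy the recurrence \<open>half_theta_rec\<close>; together they give the
  quasi-periodicity under the dilation by \<open>theta_base q k\<close>.\<close>

lemma Theta_functional:
  assumes x: "x \<noteq> 0"
  shows "Theta q k (of_real (theta_base q k) * x) * x = Theta q k x"
proof -
  define p where "p = theta_base q k"
  have p: "0 < p" "p < 1" using theta_base_bounds by (auto simp: p_def)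
  have e: "half_theta p x = 1 + x * half_theta p (of_real p * x)"
    "half_theta p (1 / x) = 1 + (1 / x) * half_theta p (of_real p * (1 / x))"
    by (rule half_theta_rec[OF p])+
  have px: "of_real p * x \<noteq> 0" using p x by simp
  have "Theta q k (of_real p * x) = half_theta p (of_real p * x) + half_theta p (1 / x) - 1"
    using Theta_eq_half_theta[OF px] p x by (simp add: p_def)
  then show ?thesis
    using Theta_eq_half_theta[OF x] e x unfolding p_def[symmetric] by (simp add: field_simps)
qed

lemma q_growth_functional:
  assumes "r > 0"
  shows "q_growth q k (1/2) (theta_base q k * r) * r = q_growth q k (1/2) r"
proof -
  have "ln q > 0" using q by simp
  then have "k * (ln r - ln q / k)\<^sup>2 / (2 * ln q) + (ln r - ln q / k) / 2 + ln r = k * (ln r)\<^sup>2 / (2 * ln q) + ln r / 2"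
    using k by (simp add: field_simps power2_eq_square)
  moreover have "ln (theta_base q k * r) = ln r - ln q / k"
    using assms theta_base_bounds by (simp add: ln_mult ln_theta_base)
  ultimately have "q_growth q k (1/2) r = exp (k * (ln (theta_base q k * r))\<^sup>2 / (2 * ln q) + ln (theta_base q k * r) / 2 + ln r)"
    unfolding q_growth_half by simp
  then show ?thesis using assms unfolding q_growth_half by (simp add: exp_add)
qed

text \<open>The quotient of \<open>|Theta q k x|\<close> and \<open>q_growth q k (1/2) |x|\<close> is invariant under dilation by
  \<open>theta_base q k\<close>. Its infimum is therefore attained on a compact part of an annulus, where \<open>Theta\<close>
  has no zeros. The hypothesis on \<open>x\<close> keeps the half-line through \<open>x\<close> at distance more than \<open>\<delta>\<close> from \<open>-1\<close>
  and is itself invariant under dilation, unlike a condition on \<open>x\<close> alone.\<close>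

lemma Theta_lower_bound:
  assumes \<delta>: "\<delta> > 0"
  shows "\<exists>c>0. \<forall>x. x \<noteq> 0 \<longrightarrow> (\<forall>r\<ge>0. \<delta> < norm (1 + of_real r * x)) \<longrightarrow>
           c * q_growth q k (1/2) (norm x) \<le> norm (Theta q k x)"
proof -
  define p where "p = theta_base q k"
  have p: "0 < p" "p < 1" using theta_base_bounds by (auto simp: p_def)
  define N where "N x = norm (Theta q k x) / q_growth q k (1/2) (norm x)" for x
  have N1: "N (of_real p * x) = N x" if "x \<noteq> 0" for x
  proof -
    have "norm (Theta q k x) = norm (Theta q k (of_real p * x)) * norm x"
      by (metis Theta_functional[OF that] norm_mult p_def)
    moreover have "q_growth q k (1/2) (norm x) = q_growth q k (1/2) (norm (of_real p * x)) * norm x"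
      using q_growth_functional[of "norm x"] that p by (simp add: p_def norm_mult)
    ultimately show ?thesis using that by (simp add: N_def)
  qed
  have N2: "N (of_real p ^ n * x) = N x" if "x \<noteq> 0" for x n
    using that by (induction n) (use N1 p in \<open>auto simp: mult.assoc\<close>)
  define K where "K = {x :: complex. 1 \<le> norm x \<and> norm x \<le> 1 / p \<and> (\<forall>r\<in>{0..}. \<delta> \<le> norm (1 + of_real r * x))}"
  have "K = {x. 1 \<le> norm x} \<inter> {x. norm x \<le> 1 / p} \<inter> (\<Inter>r\<in>{0..}. {x. \<delta> \<le> norm (1 + of_real r * x)})"
    by (auto simp: K_def)
  then have "closed K"
    by (simp only:) (intro closed_Int closed_INT ballI closed_Collect_le continuous_intros)
  moreover have "bounded K" by (rule boundedI[of _ "1/p"]) (auto simp: K_def)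
  ultimately have cK: "compact K" by (simp add: compact_eq_bounded_closed)
  have K0: "x \<noteq> 0" if "x \<in> K" for x using that by (auto simp: K_def)
  have contN: "continuous_on K N"
    unfolding N_def q_growth_half using q K0
    by (intro continuous_intros Theta_continuous) auto
  have Npos: "N x > 0" if "x \<in> K" for x
  proof -
    have "1 + of_real r * x \<noteq> 0" if "r > 0" for r
    proof -
      have "\<delta> \<le> norm (1 + of_real r * x)" using \<open>x \<in> K\<close> that by (auto simp: K_def)
      then show ?thesis using \<delta> by auto
    qed
    then show ?thesis using Theta_nonzero[of x] K0[OF that] by (simp add: N_def)
  qed
  obtain c where c: "c > 0" "\<And>x. x \<in> K \<Longrightarrow> c \<le> N x"
  proof (cases "K = {}")
    case True
    then show ?thesis using that[of 1] by auto
  next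
    case False
    from continuous_attains_inf[OF cK this contN] obtain x where "x \<in> K" "\<forall>y\<in>K. N x \<le> N y" by blast
    then show ?thesis using that[of "N x"] Npos by auto
  qed
  have "c \<le> N x" if x: "x \<noteq> 0" and cl: "\<forall>r\<ge>0. \<delta> < norm (1 + of_real r * x)" for x
  proof -
    define h where "h = - ln p"
    have h: "h > 0" using p by (simp add: h_def)
    \<comment> \<open>The dilation by the \<open>m\<close>-th power of \<open>p\<close> moves \<open>x\<close> into the annulus.\<close>
    define m where "m = \<lfloor>ln (norm x) / h\<rfloor>"
    define s where "s = p powr real_of_int m"
    have s: "s > 0" using p by (simp add: s_def)
    have ls: "ln s = - h * real_of_int m" using p by (simp add: s_def h_def)
    have "real_of_int m \<le> ln (norm x) / h" "ln (norm x) / h < real_of_int m + 1"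
      unfolding m_def by linarith+
    then have m: "real_of_int m * h \<le> ln (norm x)" "ln (norm x) \<le> real_of_int m * h + h"
      using h by (simp_all add: field_simps)
    have nx: "norm (of_real s * x) = exp (ln (norm x) - h * real_of_int m)"
    proof -
      have es: "exp (- (h * real_of_int m)) = s" using exp_ln[OF s] ls by simp
      have "exp (ln (norm x) - h * real_of_int m) = exp (- (h * real_of_int m)) * norm x"
        using x by (simp add: exp_diff exp_minus field_simps)
      then show ?thesis using s by (simp add: es norm_mult)
    qed
    have "1 \<le> norm (of_real s * x)" unfolding nx using m by (simp add: mult.commute)
    moreover have "norm (of_real s * x) \<le> 1 / p"
    proof -
      have "1 / p = exp h" using p by (simp add: h_def exp_minus field_simps)
      then show ?thesis unfolding nx using m by (simp add: mult.commute)
    qed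
    moreover have "\<delta> \<le> norm (1 + of_real r * (of_real s * x))" if "r \<ge> 0" for r
      using cl[rule_format, of "r * s"] that s by (simp add: mult.assoc)
    ultimately have "of_real s * x \<in> K" by (auto simp: K_def)
    then have "c \<le> N (of_real s * x)" by (rule c)
    also have "N (of_real s * x) = N x"
    proof (cases "m \<ge> 0")
      case True
      then have "s = p ^ nat m" using p by (simp add: s_def flip: powr_realpow)
      then show ?thesis using N2[OF x, of "nat m"] by simp
    next
      case False
      then have "s * p ^ nat (- m) = 1" using p by (simp add: s_def powr_minus field_simps flip: powr_realpow)
      then have e: "of_real p ^ nat (- m) * (of_real s * x) = x"
        by (metis (no_types, lifting) mult.assoc mult.commute mult_1 of_real_1 of_real_mult of_real_power)
      have "of_real s * x \<noteq> 0" using s x by simp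
      from N2[OF this, of "nat (- m)"] show ?thesis by (simp only: e)
    qed
    finally show ?thesis .
  qed
  then have "c * q_growth q k (1/2) (norm x) \<le> norm (Theta q k x)"
    if "x \<noteq> 0" "\<forall>r\<ge>0. \<delta> < norm (1 + of_real r * x)" for x
    using that by (simp add: N_def pos_le_divide_eq)
  with c(1) show ?thesis by blast
qed

end

section \<open>Rotating the path of integration\<close>

lemma norm_set_integral_le:
  fixes f :: "'a \<Rightarrow> complex"
  assumes "set_integrable M A f" "set_integrable M A g" "\<And>x. x \<in> A \<Longrightarrow> norm (f x) \<le> g x"
  shows "norm (LINT x:A|M. f x) \<le> (LINT x:A|M. g x)"
proof -
  have "norm (LINT x:A|M. f x) \<le> (LINT x:A|M. norm (f x))"
    by (rule set_integral_norm_bound[OF assms(1)])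
  also have "\<dots> \<le> (LINT x:A|M. g x)"
    by (rule set_integral_mono[OF set_integrable_norm[OF assms(1)] assms(2)]) (rule assms(3))
  finally show ?thesis .
qed

lemma set_integrable_bounded_continuous:
  fixes h :: "real \<Rightarrow> complex"
  assumes A: "A \<in> sets borel" and h: "continuous_on A h" and g: "set_integrable lborel A g"
    and b: "\<And>x. x \<in> A \<Longrightarrow> norm (h x) \<le> g x"
  shows "set_integrable lborel A h"
  unfolding set_integrable_def
proof (rule Bochner_Integration.integrable_bound)
  show "integrable lborel (\<lambda>x. indicat_real A x *\<^sub>R g x)" using g by (simp add: set_integrable_def)
  show "(\<lambda>x. indicat_real A x *\<^sub>R h x) \<in> borel_measurable lborel"
    using borel_measurable_continuous_on_indicator[OF A h] by simp
  show "AE x in lborel. norm (indicat_real A x *\<^sub>R h x) \<le> norm (indicat_real A x *\<^sub>R g x)"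
    using b by (intro AE_I2) (auto simp: indicator_def intro: order_trans[OF _ abs_ge_self])
qed

lemma powr_tail:
  fixes r :: real
  assumes r: "r > 0" and e: "e < -1"
  shows "set_integrable lborel {r<..} (\<lambda>x. x powr e)"
    and "(LINT x:{r<..}|lborel. x powr e) = - (r powr (e + 1)) / (e + 1)"
proof -
  have hi: "((\<lambda>x. x powr e) has_integral - (r powr (e + 1)) / (e + 1)) {r..}"
    by (rule has_integral_powr_to_inf[OF e r])
  have "(\<lambda>x. x powr e) absolutely_integrable_on {r..}"
    by (rule nonnegative_absolutely_integrable_1) (use hi in \<open>auto simp: integrable_on_def\<close>)
  then have "set_integrable lborel {r..} (\<lambda>x. x powr e)"
    unfolding set_integrable_def by (subst (asm) integrable_completion) auto
  then show 1: "set_integrable lborel {r<..} (\<lambda>x. x powr e)"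
    by (rule set_integrable_subset) auto
  have "(LINT x:{r<..}|lborel. x powr e) = integral {r<..} (\<lambda>x. x powr e)"
    by (rule set_borel_integral_eq_integral(2)[OF 1])
  also have "\<dots> = integral {r..} (\<lambda>x. x powr e)"
    by (rule integral_spike_set) (auto intro: negligible_subset[of "{r}"])
  also have "\<dots> = - (r powr (e + 1)) / (e + 1)" using hi by (rule integral_unique)
  finally show "(LINT x:{r<..}|lborel. x powr e) = - (r powr (e + 1)) / (e + 1)" .
qed

lemma const_integral_near:
  fixes r B :: real
  assumes r: "r > 0"
  shows "set_integrable lborel {0<..r} (\<lambda>x. B)" "(LINT x:{0<..r}|lborel. B) = B * r"
proof -
  show 1: "set_integrable lborel {0<..r} (\<lambda>x. B)"
    unfolding set_integrable_def by (intro integrable_scaleR_left integrable_real_indicator) (use r in auto)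
  show "(LINT x:{0<..r}|lborel. B) = B * r"
    using r by (simp add: set_lebesgue_integral_def)
qed

lemma norm_near_le:
  fixes h :: "real \<Rightarrow> complex"
  assumes r: "r > 0" and h: "continuous_on {0<..r} h" and b: "\<And>x. 0 < x \<Longrightarrow> x \<le> r \<Longrightarrow> norm (h x) \<le> B"
  shows "set_integrable lborel {0<..r} h" "norm (LINT x:{0<..r}|lborel. h x) \<le> B * r"
proof -
  show 1: "set_integrable lborel {0<..r} h"
    by (rule set_integrable_bounded_continuous[OF _ h const_integral_near(1)[OF r]]) (use b in auto)
  show "norm (LINT x:{0<..r}|lborel. h x) \<le> B * r"
    using norm_set_integral_le[OF 1 const_integral_near(1)[OF r], of B] b const_integral_near(2)[OF r, of B] by auto
qed

lemma norm_far_le: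
  fixes h :: "real \<Rightarrow> complex"
  assumes r: "r > 0" and h: "continuous_on {r<..} h"
    and b: "\<And>x. r < x \<Longrightarrow> norm (h x) \<le> B * x powr (- 3 / 2)"
  shows "set_integrable lborel {r<..} h" "norm (LINT x:{r<..}|lborel. h x) \<le> 2 * B * r powr (- 1 / 2)"
proof -
  have g: "set_integrable lborel {r<..} (\<lambda>x. B * x powr (- 3 / 2))"
    by (intro set_integrable_mult_right powr_tail r) simp
  show 1: "set_integrable lborel {r<..} h"
    by (rule set_integrable_bounded_continuous[OF _ h g]) (use b in auto)
  have "norm (LINT x:{r<..}|lborel. h x) \<le> (LINT x:{r<..}|lborel. B * x powr (- 3 / 2))"
    by (rule norm_set_integral_le[OF 1 g]) (use b in auto)
  also have "\<dots> = 2 * B * r powr (- 1 / 2)"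
    using powr_tail(2)[OF r, of "- 3 / 2"] by simp
  finally show "norm (LINT x:{r<..}|lborel. h x) \<le> 2 * B * r powr (- 1 / 2)" .
qed

lemma ray_integral_split:
  fixes h :: "real \<Rightarrow> complex"
  assumes "r > 0" "set_integrable lborel {0<..r} h" "set_integrable lborel {r<..} h"
  shows "set_integrable lborel {0<..} h"
    "(LINT x:{0<..}|lborel. h x) = (LINT x:{0<..r}|lborel. h x) + (LINT x:{r<..}|lborel. h x)"
proof -
  have U: "{0<..} = {0<..r} \<union> {r<..}" using assms(1) by auto
  show "set_integrable lborel {0<..} h" unfolding U by (rule set_integrable_Un) (use assms in auto)
  show "(LINT x:{0<..}|lborel. h x) = (LINT x:{0<..r}|lborel. h x) + (LINT x:{r<..}|lborel. h x)"
    unfolding U by (rule set_integral_Un) (use assms in auto)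
qed

text \<open>In the coordinate \<open>\<zeta> = log u\<close> the sector is a convex half-strip, on which the integrand has a
  primitive. The integrals over the two rays are differences of values of the primitive, so they
  differ by the contributions of two arcs. The arc of radius \<open>r0\<close> disappears as \<open>r0\<close> tends to \<open>0\<close>
  since the integrand is bounded, and the arc of radius \<open>r1\<close> is estimated by \<open>M\<close>.\<close>

lemma ray_integral_rotate_le:
  fixes g :: "complex \<Rightarrow> complex"
  assumes r1: "r1 > 0" and hol: "g holomorphic_on A"
    and sub: "\<And>r \<theta>. 0 < r \<Longrightarrow> r \<le> r1 \<Longrightarrow> \<theta> \<in> closed_segment a b \<Longrightarrow> of_real r * cis \<theta> \<in> A"
    and bnd: "\<And>r \<theta>. 0 < r \<Longrightarrow> r \<le> r1 \<Longrightarrow> \<theta> \<in> closed_segment a b \<Longrightarrow> norm (g (of_real r * cis \<theta>)) \<le> B"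
    and arc: "\<And>\<theta>. \<theta> \<in> closed_segment a b \<Longrightarrow> norm (g (of_real r1 * cis \<theta>)) * r1 \<le> M"
  shows "norm ((LINT r:{0<..r1}|lborel. g (of_real r * cis b) * cis b) -
               (LINT r:{0<..r1}|lborel. g (of_real r * cis a) * cis a)) \<le> \<bar>b - a\<bar> * M"
proof -
  define S where "S = {\<zeta>. Im \<zeta> \<in> closed_segment a b \<and> Re \<zeta> \<le> ln r1}"
  define G where "G \<zeta> = g (exp \<zeta>) * exp \<zeta>" for \<zeta>
  have expS: "exp \<zeta> \<in> A" if "\<zeta> \<in> S" for \<zeta>
  proof -
    have "exp (Re \<zeta>) \<le> r1" using that r1 by (metis S_def exp_le_cancel_iff exp_ln mem_Collect_eq)
    then show ?thesis using sub[of "exp (Re \<zeta>)" "Im \<zeta>"] that unfolding exp_eq_polar S_def by simp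
  qed
  have holG: "G holomorphic_on S"
    unfolding G_def
    by (intro holomorphic_intros holomorphic_on_compose_gen[OF _ hol, unfolded comp_def]) (use expS in auto)
  have "convex S"
  proof -
    have "S = Im -` closed_segment a b \<inter> Re -` {..ln r1}" by (auto simp: S_def)
    moreover have "convex (Im -` closed_segment a b)" "convex (Re -` {..ln r1})"
      by (auto intro!: convex_linear_vimage simp: bounded_linear.linear bounded_linear_Im bounded_linear_Re)
    ultimately show ?thesis by (simp add: convex_Int)
  qed
  then obtain \<Phi> where \<Phi>: "\<And>\<zeta>. \<zeta> \<in> S \<Longrightarrow> (\<Phi> has_field_derivative G \<zeta>) (at \<zeta> within S)"
  proof (rule holomorphic_convex_primitive[of S "{}" G])
    show "G field_differentiable at x" if "x \<in> interior S - {}" for x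
      using holG that interior_subset
      by (metis Diff_empty holomorphic_on_imp_differentiable_at holomorphic_on_subset open_interior)
  qed (use holG in \<open>auto intro: holomorphic_on_imp_continuous_on\<close>)
  define h where "h \<theta> r = g (of_real r * cis \<theta>) * cis \<theta>" for \<theta> r
  have B0: "B \<ge> 0" using bnd[OF r1, of a] by (metis ends_in_segment(1) norm_ge_zero order.refl order_trans)
  have conth: "continuous_on {0<..r1} (h \<theta>)" if "\<theta> \<in> closed_segment a b" for \<theta>
    unfolding h_def
    by (intro continuous_intros continuous_on_compose2[OF holomorphic_on_imp_continuous_on[OF hol]])
       (use sub that in auto)
  have nh: "norm (h \<theta> r) \<le> B" if "\<theta> \<in> closed_segment a b" "0 < r" "r \<le> r1" for \<theta> r
    using bnd that by (simp add: h_def norm_mult)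
  have ftc: "((h \<theta>) has_integral (\<Phi> (Complex (ln r1) \<theta>) - \<Phi> (Complex (ln r0) \<theta>))) {r0..r1}"
    if \<theta>: "\<theta> \<in> closed_segment a b" and r0: "0 < r0" "r0 \<le> r1" for \<theta> r0
  proof (rule fundamental_theorem_of_calculus[OF r0(2)])
    fix r assume r: "r \<in> {r0..r1}"
    then have rp: "r > 0" using r0 by auto
    let ?c = "\<lambda>r. complex_of_real (ln r) + \<i> * of_real \<theta>"
    have c: "?c r = Complex (ln r) \<theta>" for r by (simp add: complex_eq_iff)
    have in_S: "?c r \<in> S" if "r \<in> {r0..r1}" for r
      using that r0 \<theta> by (auto simp: S_def)
    have 1: "(?c has_vector_derivative of_real (1 / r)) (at r within {r0..r1})"
      using rp by (auto intro!: derivative_eq_intros has_vector_derivative_of_real 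
          simp: has_real_derivative_iff_has_vector_derivative[symmetric] divide_inverse)
    have 2: "(\<Phi> has_field_derivative G (?c r)) (at (?c r) within ?c ` {r0..r1})"
      by (rule DERIV_subset[OF \<Phi>[OF in_S[OF r]]]) (use in_S in auto)
    have "exp (?c r) = of_real r * cis \<theta>"
      using rp by (simp add: exp_add exp_of_real cis_conv_exp)
    then have "of_real (1 / r) * G (?c r) = h \<theta> r" using rp by (simp add: G_def h_def)
    with field_vector_diff_chain_within[OF 1 2]
    show "((\<lambda>r. \<Phi> (Complex (ln r) \<theta>)) has_vector_derivative h \<theta> r) (at r within {r0..r1})"
      by (simp add: comp_def c)
  qed
  have near: "norm ((LINT r:{0<..r1}|lborel. h \<theta> r) - (\<Phi> (Complex (ln r1) \<theta>) - \<Phi> (Complex (ln r0) \<theta>))) \<le> B * r0"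
    if \<theta>: "\<theta> \<in> closed_segment a b" and r0: "0 < r0" "r0 < r1" for \<theta> r0
  proof -
    have i: "set_integrable lborel {0<..r1} (h \<theta>)" 
      by (rule norm_near_le(1)[OF r1 conth[OF \<theta>] nh[OF \<theta>]])
    have i1: "set_integrable lborel {0<..r0} (h \<theta>)" by (rule set_integrable_subset[OF i]) (use r0 in auto)
    have i2: "set_integrable lborel {r0<..r1} (h \<theta>)" by (rule set_integrable_subset[OF i]) (use r0 in auto)
    have "{0<..r1} = {0<..r0} \<union> {r0<..r1}" using r0 by auto
    then have s: "(LINT r:{0<..r1}|lborel. h \<theta> r) = (LINT r:{0<..r0}|lborel. h \<theta> r) + (LINT r:{r0<..r1}|lborel. h \<theta> r)"
      using set_integral_Un[OF _ i1 i2] by auto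
    have "(LINT r:{r0<..r1}|lborel. h \<theta> r) = integral {r0<..r1} (h \<theta>)"
      by (rule set_borel_integral_eq_integral(2)[OF i2])
    also have "\<dots> = integral {r0..r1} (h \<theta>)"
      by (rule integral_spike_set) (auto intro: negligible_subset[of "{r0}"])
    also have "\<dots> = \<Phi> (Complex (ln r1) \<theta>) - \<Phi> (Complex (ln r0) \<theta>)"
      using ftc[OF \<theta>, of r0] r0 by (auto intro: integral_unique)
    finally have "(LINT r:{0<..r1}|lborel. h \<theta> r) - (\<Phi> (Complex (ln r1) \<theta>) - \<Phi> (Complex (ln r0) \<theta>)) = (LINT r:{0<..r0}|lborel. h \<theta> r)"
      using s by simp
    moreover have "norm (LINT r:{0<..r0}|lborel. h \<theta> r) \<le> B * r0"
      by (rule norm_near_le(2)[OF r0(1)]) (use conth[OF \<theta>] nh[OF \<theta>] r0 in \<open>auto intro: continuous_on_subset\<close>)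
    ultimately show ?thesis by simp
  qed
  have arcs: "norm (\<Phi> (Complex (ln r) b) - \<Phi> (Complex (ln r) a)) \<le> M' * \<bar>b - a\<bar>"
    if r: "0 < r" "r \<le> r1" and M': "\<And>\<theta>. \<theta> \<in> closed_segment a b \<Longrightarrow> norm (g (of_real r * cis \<theta>)) * r \<le> M'" for r M'
  proof -
    let ?L = "closed_segment (Complex (ln r) a) (Complex (ln r) b)"
    have L: "Im \<zeta> \<in> closed_segment a b \<and> Re \<zeta> = ln r" if "\<zeta> \<in> ?L" for \<zeta>
    proof -
      from that obtain u where u: "0 \<le> u" "u \<le> 1" and "\<zeta> = (1 - u) *\<^sub>R Complex (ln r) a + u *\<^sub>R Complex (ln r) b"
        by (auto simp: in_segment)
      then have "Im \<zeta> = (1 - u) *\<^sub>R a + u *\<^sub>R b" "Re \<zeta> = (1 - u) * ln r + u * ln r" by simp_all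
      with u show ?thesis by (auto simp: in_segment algebra_simps)
    qed
    have LS: "?L \<subseteq> S" using L r by (auto simp: S_def)
    have "norm (\<Phi> (Complex (ln r) b) - \<Phi> (Complex (ln r) a)) \<le> M' * norm (Complex (ln r) b - Complex (ln r) a)"
    proof (rule field_differentiable_bound[of ?L])
      show "(\<Phi> has_field_derivative G \<zeta>) (at \<zeta> within ?L)" if "\<zeta> \<in> ?L" for \<zeta>
        using DERIV_subset[OF \<Phi>] LS that by blast
      show "norm (G \<zeta>) \<le> M'" if "\<zeta> \<in> ?L" for \<zeta>
        using M'[of "Im \<zeta>"] L[OF that] r by (simp add: G_def exp_eq_polar norm_mult)
    qed auto
    moreover have "Complex (ln r) b - Complex (ln r) a = \<i> * of_real (b - a)" by (simp add: complex_eq_iff)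
    ultimately show ?thesis by (simp only: norm_mult norm_of_real norm_ii mult_1)
  qed
  let ?D = "norm ((LINT r:{0<..r1}|lborel. h b r) - (LINT r:{0<..r1}|lborel. h a r))"
  have main: "?D \<le> \<bar>b - a\<bar> * M + r0 * (B * (2 + \<bar>b - a\<bar>))" if r0: "0 < r0" "r0 < r1" for r0
  proof -
    have "norm (\<Phi> (Complex (ln r0) b) - \<Phi> (Complex (ln r0) a)) \<le> (B * r0) * \<bar>b - a\<bar>"
      using r0 bnd[of r0] by (intro arcs) (auto intro!: mult_right_mono)
    moreover have "norm (\<Phi> (Complex (ln r1) b) - \<Phi> (Complex (ln r1) a)) \<le> M * \<bar>b - a\<bar>"
      using r1 arc by (intro arcs) auto
    moreover note near[OF ends_in_segment(1) r0] near[OF ends_in_segment(2) r0]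
    moreover have "norm (X - Y) \<le> norm (X - (P - s)) + norm (Y - (P' - s')) + norm (P - P') + norm (s - s')"
      for X Y P s P' s' :: complex by norm
    note this[of "LINT r:{0<..r1}|lborel. h b r" "LINT r:{0<..r1}|lborel. h a r" "\<Phi> (Complex (ln r1) b)"
       "\<Phi> (Complex (ln r0) b)" "\<Phi> (Complex (ln r1) a)" "\<Phi> (Complex (ln r0) a)"]
    ultimately have "?D \<le> B * r0 + B * r0 + M * \<bar>b - a\<bar> + (B * r0) * \<bar>b - a\<bar>"
      by linarith
    then show ?thesis by (simp add: algebra_simps)
  qed
  have "?D \<le> \<bar>b - a\<bar> * M"
  proof (rule field_le_epsilon)
    fix e :: real assume e: "e > 0"
    define c where "c = B * (2 + \<bar>b - a\<bar>) + 1"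
    have c: "c > 0" using B0 by (simp add: c_def add_nonneg_pos)
    define r0 where "r0 = min (r1 / 2) (e / c)"
    have r0: "0 < r0" "r0 < r1" "r0 \<le> e / c" using r1 e c by (auto simp: r0_def)
    have "r0 * (B * (2 + \<bar>b - a\<bar>)) \<le> r0 * c" using r0 by (simp add: c_def)
    also have "\<dots> \<le> e" using r0(3) c by (simp add: field_simps)
    finally show "?D \<le> \<bar>b - a\<bar> * M + e" using main[OF r0(1,2)] by simp
  qed
  then show ?thesis by (simp add: h_def)
qed

text \<open>The decay of order \<open>-3/2\<close> makes the contribution of the arc of radius \<open>R\<close> and of the tails beyond
  it tend to \<open>0\<close>.\<close>

lemma halfline_integral_rotate:
  fixes g :: "complex \<Rightarrow> complex"
  assumes hol: "g holomorphic_on A" 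
    and sub: "\<And>r \<theta>. 0 < r \<Longrightarrow> \<theta> \<in> closed_segment a b \<Longrightarrow> of_real r * cis \<theta> \<in> A"
    and near: "\<And>r \<theta>. 0 < r \<Longrightarrow> \<theta> \<in> closed_segment a b \<Longrightarrow> norm (g (of_real r * cis \<theta>)) \<le> B"
    and far: "\<And>r \<theta>. 1 \<le> r \<Longrightarrow> \<theta> \<in> closed_segment a b \<Longrightarrow> norm (g (of_real r * cis \<theta>)) \<le> B * r powr (- 3 / 2)"
  shows "halfline_integral b g = halfline_integral a g"
proof -
  define h where "h \<theta> r = g (of_real r * cis \<theta>) * cis \<theta>" for \<theta> r
  have conth: "continuous_on {0<..} (h \<theta>)" if "\<theta> \<in> closed_segment a b" for \<theta>
    unfolding h_def
    by (intro continuous_intros continuous_on_compose2[OF holomorphic_on_imp_continuous_on[OF hol]])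
       (use sub that in auto)
  have B0: "B \<ge> 0" using near[of 1 a] by (metis ends_in_segment(1) norm_ge_zero order_trans zero_less_one)
  have tri: "norm ((x + y) - (z + w)) \<le> norm (x - z) + norm y + norm w" for x y z w :: complex
    by norm
  have main: "norm (halfline_integral b g - halfline_integral a g) \<le> (\<bar>b - a\<bar> + 4) * B * R powr (- 1 / 2)" if R: "R \<ge> 1" for R
  proof -
    have R0: "R > 0" using R by simp
    have n: "set_integrable lborel {0<..R} (h \<theta>)" if "\<theta> \<in> closed_segment a b" for \<theta>
      by (rule norm_near_le(1)[OF R0, of _ B])
         (use conth[OF that] near that in \<open>auto simp: h_def norm_mult intro: continuous_on_subset\<close>)
    have bb: "norm (h \<theta> x) \<le> B * x powr (- 3 / 2)" if "R < x" "\<theta> \<in> closed_segment a b" for x \<theta>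
      using far[of x \<theta>] that R by (simp add: h_def norm_mult)
    have ct: "continuous_on {R<..} (h \<theta>)" if "\<theta> \<in> closed_segment a b" for \<theta>
      by (rule continuous_on_subset[OF conth[OF that]]) (use R0 in auto)
    have f: "set_integrable lborel {R<..} (h \<theta>)" 
        "norm (LINT x:{R<..}|lborel. h \<theta> x) \<le> 2 * B * R powr (- 1 / 2)" if "\<theta> \<in> closed_segment a b" for \<theta>
      using norm_far_le[OF R0 ct[OF that] bb[OF _ that]] by auto
    have s: "halfline_integral \<theta> g = (LINT x:{0<..R}|lborel. h \<theta> x) + (LINT x:{R<..}|lborel. h \<theta> x)"
      if "\<theta> \<in> closed_segment a b" for \<theta>
      unfolding halfline_integral_def using ray_integral_split(2)[OF R0 n[OF that] f(1)[OF that]]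
      by (simp add: h_def)
    have "norm ((LINT x:{0<..R}|lborel. h b x) - (LINT x:{0<..R}|lborel. h a x)) \<le> \<bar>b - a\<bar> * (B * R powr (- 1 / 2))"
      unfolding h_def
    proof (rule ray_integral_rotate_le[OF R0 hol, of a b B])
      fix \<theta> assume \<theta>: "\<theta> \<in> closed_segment a b"
      have "norm (g (complex_of_real R * cis \<theta>)) * R \<le> B * R powr (- 3 / 2) * R"
        using far[OF R \<theta>] R by (intro mult_right_mono) auto
      also have "\<dots> = B * (R powr (- 3 / 2) * R powr 1)" using R0 by simp
      also have "R powr (- 3 / 2) * R powr 1 = R powr (- 1 / 2)" by (subst powr_add[symmetric]) simp
      finally show "norm (g (complex_of_real R * cis \<theta>)) * R \<le> B * R powr (- 1 / 2)" .
    qed (use sub near in auto)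
    moreover have "norm (halfline_integral b g - halfline_integral a g) \<le>
        norm ((LINT x:{0<..R}|lborel. h b x) - (LINT x:{0<..R}|lborel. h a x)) +
        norm (LINT x:{R<..}|lborel. h b x) + norm (LINT x:{R<..}|lborel. h a x)"
      unfolding s[OF ends_in_segment(1)] s[OF ends_in_segment(2)] by (rule tri)
    moreover note f(2)[OF ends_in_segment(1)] f(2)[OF ends_in_segment(2)]
    ultimately have "norm (halfline_integral b g - halfline_integral a g) \<le> \<bar>b - a\<bar> * (B * R powr (- 1 / 2)) + 2 * B * R powr (- 1 / 2) + 2 * B * R powr (- 1 / 2)"
      by linarith
    then show ?thesis by (simp add: algebra_simps)
  qed
  have "((\<lambda>R. (\<bar>b - a\<bar> + 4) * B * R powr (- 1 / 2)) \<longlongrightarrow> (\<bar>b - a\<bar> + 4) * B * 0) at_top"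
    by (intro tendsto_intros tendsto_neg_powr filterlim_ident) auto
  then have "norm (halfline_integral b g - halfline_integral a g) \<le> (\<bar>b - a\<bar> + 4) * B * 0"
  proof (rule tendsto_lowerbound)
    show "\<forall>\<^sub>F R in at_top. norm (halfline_integral b g - halfline_integral a g) \<le> (\<bar>b - a\<bar> + 4) * B * R powr (- 1 / 2)"
      using eventually_ge_at_top[of 1] by eventually_elim (rule main)
  qed simp
  then show ?thesis by simp
qed

section \<open>Integrals against the theta kernel\<close>

text \<open>The factor that makes a difference flat; \<open>L\<close> is the logarithm of a modulus.\<close>

definition gauss :: "real \<Rightarrow> real \<Rightarrow> real \<Rightarrow> real" where
  "gauss q k L = exp (- (k * L\<^sup>2 / (2 * ln q)))"

lemma gauss_pos [simp]: "gauss q k L > 0"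
  by (simp add: gauss_def)

lemma gauss_nonneg [simp]: "gauss q k L \<ge> 0"
  by (rule less_imp_le[OF gauss_pos])

text \<open>The zeros of \<open>u \<mapsto> Theta q k (u / T)\<close> lie on the half-line through \<open>- T\<close>. This predicate says that the
  half-line of direction \<open>\<theta>\<close> keeps away from them in the scale-invariant sense of
  \<open>Theta_lower_bound\<close>.\<close>

definition clear :: "real \<Rightarrow> complex \<Rightarrow> real \<Rightarrow> bool" where
  "clear \<delta> T \<theta> \<longleftrightarrow> (\<forall>r\<ge>0. \<delta> < norm (1 + of_real r * (cis \<theta> / T)))"

definition laplace_kernel :: "real \<Rightarrow> real \<Rightarrow> complex \<Rightarrow> (complex \<Rightarrow> complex) \<Rightarrow> complex \<Rightarrow> complex" where
  "laplace_kernel q k T w u = w u / Theta q k (u / T) / u"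

text \<open>What is required of a function on the half-line of direction \<open>\<theta>\<close> in order to bound its q-Laplace
  transform: at most the growth of a negative power near \<open>0\<close>, where the kernel decays faster than any power,
  and beyond the radius \<open>r1\<close> the growth that the kernel can absorb. The constant \<open>A\<close> is shared so that
  all estimates are linear in it.\<close>

definition ray_bounded ::
  "real \<Rightarrow> real \<Rightarrow> real \<Rightarrow> nat \<Rightarrow> real \<Rightarrow> real \<Rightarrow> (complex \<Rightarrow> complex) \<Rightarrow> real \<Rightarrow> bool" where
  "ray_bounded q k \<nu> j r1 A w \<theta> \<longleftrightarrow>
     continuous_on {0<..} (\<lambda>r. w (of_real r * cis \<theta>)) \<and>
     (\<forall>r. 0 < r \<longrightarrow> r \<le> r1 \<longrightarrow> norm (w (of_real r * cis \<theta>)) \<le> A / r ^ j) \<and>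
     (\<forall>r\<ge>r1. norm (w (of_real r * cis \<theta>)) \<le> A * q_growth q k \<nu> r)"

lemma quadratic_le:
  fixes a b x :: real
  assumes "a > 0"
  shows "b * x - a * x\<^sup>2 \<le> b\<^sup>2 / (4 * a)"
proof -
  have "b\<^sup>2 / (4 * a) - (b * x - a * x\<^sup>2) = a * (x - b / (2 * a))\<^sup>2"
    using assms by (simp add: field_simps power2_eq_square)
  moreover have "a * (x - b / (2 * a))\<^sup>2 \<ge> 0" using assms by simp
  ultimately show ?thesis by linarith
qed

context
  fixes q k \<delta> c :: real
  assumes q: "q > 1" and k: "k > 0" and c: "c > 0"
    and theta: "\<forall>x. x \<noteq> 0 \<longrightarrow> (\<forall>r\<ge>0. \<delta> < norm (1 + of_real r * x)) \<longrightarrow>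
       c * q_growth q k (1/2) (norm x) \<le> norm (Theta q k x)"
begin

lemma ln_q_pos: "ln q > 0" using q by simp

lemma theta_ray:
  assumes "T \<noteq> 0" "clear \<delta> T \<theta>" "r > 0"
  shows "c * q_growth q k (1/2) (r / norm T) \<le> norm (Theta q k (of_real r * cis \<theta> / T))"
proof -
  have "\<forall>s\<ge>0. \<delta> < norm (1 + of_real s * (of_real r * cis \<theta> / T))"
  proof (intro allI impI)
    fix s :: real assume "s \<ge> 0"
    then have "\<delta> < norm (1 + of_real (s * r) * (cis \<theta> / T))"
      using assms unfolding clear_def by (meson mult_nonneg_nonneg less_imp_le)
    moreover have "complex_of_real (s * r) * (cis \<theta> / T) = of_real s * (of_real r * cis \<theta> / T)" by simp
    ultimately show "\<delta> < norm (1 + of_real s * (of_real r * cis \<theta> / T))" by (simp only:)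
  qed
  from theta[rule_format, OF _ this[rule_format]] assms show ?thesis by (simp add: norm_divide norm_mult)
qed

lemma theta_ray_nonzero:
  assumes "T \<noteq> 0" "clear \<delta> T \<theta>" "r > 0"
  shows "Theta q k (of_real r * cis \<theta> / T) \<noteq> 0"
  using theta_ray[OF assms] mult_pos_pos[OF c q_growth_pos[of q k "1/2" "r / norm T"]] by auto

lemma kernel_ray_le:
  assumes "T \<noteq> 0" "clear \<delta> T \<theta>" "r > 0" and w: "norm (w (of_real r * cis \<theta>)) \<le> W"
  shows "norm (laplace_kernel q k T w (of_real r * cis \<theta>)) \<le> W / (c * q_growth q k (1/2) (r / norm T)) / r"
proof -
  have "norm (laplace_kernel q k T w (of_real r * cis \<theta>)) =
      norm (w (of_real r * cis \<theta>)) / norm (Theta q k (of_real r * cis \<theta> / T)) / r"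
    using assms(3) by (simp add: laplace_kernel_def norm_divide norm_mult)
  also have "\<dots> \<le> W / (c * q_growth q k (1/2) (r / norm T)) / r"
    using assms(3) theta_ray[OF assms(1-3)] mult_pos_pos[OF c q_growth_pos[of q k "1/2" "r / norm T"]]
    by (intro divide_right_mono frac_le w order_trans[OF norm_ge_zero w]) auto
  finally show ?thesis .
qed

text \<open>Near \<open>0\<close> the decay of \<open>1 / Theta\<close> in \<open>log (r / |T|)\<close> is Gaussian and outweighs every power of \<open>r\<close>; the
  price is a power of \<open>1 / |T|\<close>.\<close>

lemma kernel_near:
  assumes T: "T \<noteq> 0" and cl: "clear \<delta> T \<theta>" and r: "r > 0"
    and w: "norm (w (of_real r * cis \<theta>)) \<le> A / r ^ j" and A: "A \<ge> 0"
  shows "norm (laplace_kernel q k T w (of_real r * cis \<theta>)) \<le>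
     exp ((real j + 3/2)\<^sup>2 * ln q / (2 * k)) / c * A / norm T ^ Suc j"
proof -
  define y where "y = ln (r / norm T)"
  have rT: "r / norm T > 0" using T r by simp
  then have ry: "r = norm T * exp y" using T by (simp add: y_def)
  have "k / (2 * ln q) > 0" using k ln_q_pos by simp
  from quadratic_le[OF this, of "- (real j + 3/2)" y]
  have "- (real j + 3/2) * y - k / (2 * ln q) * y\<^sup>2 \<le> (real j + 3/2)\<^sup>2 / (4 * (k / (2 * ln q)))"
    by (simp add: power2_commute power2_eq_square algebra_simps)
  also have "\<dots> = (real j + 3/2)\<^sup>2 * ln q / (2 * k)" using k ln_q_pos by (simp add: field_simps)
  finally have e: "exp (- (real j + 3/2) * y - k / (2 * ln q) * y\<^sup>2) \<le> exp ((real j + 3/2)\<^sup>2 * ln q / (2 * k))" by simp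
  have "exp y ^ Suc j = exp ((real j + 1) * y)" by (simp only: exp_of_nat_mult[symmetric] of_nat_Suc add.commute)
  then have "q_growth q k (1/2) (r / norm T) * exp y ^ Suc j = exp (k * y\<^sup>2 / (2 * ln q) + y / 2 + (real j + 1) * y)"
    unfolding q_growth_half y_def[symmetric] by (simp only: mult_exp_exp)
  then have "1 / (q_growth q k (1/2) (r / norm T) * exp y ^ Suc j) = exp (- (k * y\<^sup>2 / (2 * ln q) + y / 2 + (real j + 1) * y))"
    by (simp only: exp_minus inverse_eq_divide)
  also have "- (k * y\<^sup>2 / (2 * ln q) + y / 2 + (real j + 1) * y) = - (real j + 3/2) * y - k / (2 * ln q) * y\<^sup>2"
    by (simp add: algebra_simps)
  finally have "1 / (q_growth q k (1/2) (r / norm T) * exp y ^ Suc j) = exp (- (real j + 3/2) * y - k / (2 * ln q) * y\<^sup>2)" .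
  with e have e': "1 / (q_growth q k (1/2) (r / norm T) * exp y ^ Suc j) \<le> exp ((real j + 3/2)\<^sup>2 * ln q / (2 * k))" by simp
  have "norm (laplace_kernel q k T w (of_real r * cis \<theta>)) \<le> A / r ^ j / (c * q_growth q k (1/2) (r / norm T)) / r"
    by (rule kernel_ray_le[where w = w, OF T cl r w])
  also have "\<dots> = A / c / norm T ^ Suc j * (1 / (q_growth q k (1/2) (r / norm T) * exp y ^ Suc j))"
    unfolding ry using T by (simp add: power_mult_distrib field_simps)
  also have "\<dots> \<le> A / c / norm T ^ Suc j * exp ((real j + 3/2)\<^sup>2 * ln q / (2 * k))"
    using A c by (intro mult_left_mono e') auto
  finally show ?thesis by (simp add: field_simps)
qed

text \<open>The quadratic terms in \<open>log r\<close> cancel. What is left is Gaussian in \<open>log |T|\<close> and a power of \<open>r\<close> that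
  depends linearly on \<open>log |T|\<close>; this is how growth of order \<open>k\<close> turns into flatness of order \<open>k\<close>.\<close>

lemma weight_shift:
  assumes T: "T \<noteq> 0" and r: "r > 0"
  shows "exp (k * (ln r)\<^sup>2 / (2 * ln q)) / q_growth q k (1/2) (r / norm T) =
    gauss q k (ln (norm T)) * exp (ln (norm T) * (1/2 + k * ln r / ln q)) * r powr (- 1 / 2)"
proof -
  have "k * (ln r)\<^sup>2 / (2 * ln q) - (k * (ln r - ln (norm T))\<^sup>2 / (2 * ln q) + (ln r - ln (norm T)) / 2)
     = - (k * (ln (norm T))\<^sup>2 / (2 * ln q)) + ln (norm T) * (1/2 + k * ln r / ln q) + (- 1 / 2) * ln r"
    using ln_q_pos by (simp add: field_simps power2_eq_square)
  moreover have "ln (r / norm T) = ln r - ln (norm T)" using T r by (simp add: ln_div)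
  moreover have "r powr (- 1 / 2) = exp ((- 1 / 2) * ln r)" using r by (simp add: powr_def)
  ultimately show ?thesis
    unfolding q_growth_half gauss_def by (simp only: mult_exp_exp exp_diff[symmetric])
qed

text \<open>The hypothesis on \<open>\<nu>\<close> says that the power of \<open>r\<close> left by \<open>weight_shift\<close> decreases. It is bounded by its
  value at \<open>r1\<close>, except for the factor \<open>r\<^sup>-\<^sup>3\<^sup>/\<^sup>2\<close> that makes the tail integrable.\<close>

lemma kernel_far:
  assumes T: "T \<noteq> 0" and cl: "clear \<delta> T \<theta>" and r1: "r1 > 0" and r: "r \<ge> r1"
    and w: "norm (w (of_real r * cis \<theta>)) \<le> A * q_growth q k \<nu> r" and A: "A \<ge> 0"
    and \<nu>: "\<nu> + k / ln q * ln (norm T) \<le> 0"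
  shows "norm (laplace_kernel q k T w (of_real r * cis \<theta>)) \<le>
     exp (\<nu> * ln r1) / c * A * (gauss q k (ln (norm T)) * exp ((1/2 + k * ln r1 / ln q) * ln (norm T))) * r powr (- 3 / 2)"
proof -
  define L where "L = ln (norm T)"
  have rp: "r > 0" using r r1 by simp
  have "(\<nu> + k / ln q * L) * ln r \<le> (\<nu> + k / ln q * L) * ln r1"
    using \<nu> r r1 by (intro mult_left_mono_neg) (auto simp: L_def)
  then have "\<nu> * ln r + L * (1/2 + k * ln r / ln q) \<le> \<nu> * ln r1 + (1/2 + k * ln r1 / ln q) * L"
    by (simp add: algebra_simps)
  then have e: "exp (\<nu> * ln r) * exp (L * (1/2 + k * ln r / ln q)) \<le> exp (\<nu> * ln r1) * exp ((1/2 + k * ln r1 / ln q) * L)"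
    by (simp flip: exp_add)
  have "norm (laplace_kernel q k T w (of_real r * cis \<theta>)) \<le>
     A * q_growth q k \<nu> r / (c * q_growth q k (1/2) (r / norm T)) / r"
    by (rule kernel_ray_le[where w = w, OF T cl rp w])
  also have "\<dots> = A / c * exp (\<nu> * ln r) * (exp (k * (ln r)\<^sup>2 / (2 * ln q)) / q_growth q k (1/2) (r / norm T)) / r"
    unfolding q_growth_def[of q k \<nu> r] by (simp add: exp_add field_simps)
  also have "\<dots> = A / c * gauss q k L * (exp (\<nu> * ln r) * exp (L * (1/2 + k * ln r / ln q))) * (r powr (- 1 / 2) / r)"
    unfolding weight_shift[OF T rp] L_def by (simp add: field_simps)
  also have "\<dots> \<le> A / c * gauss q k L * (exp (\<nu> * ln r1) * exp ((1/2 + k * ln r1 / ln q) * L)) * (r powr (- 1 / 2) / r)"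
    using A c rp by (intro mult_right_mono mult_left_mono e) (auto intro: less_imp_le)
  also have "r powr (- 1 / 2) / r = r powr (- 3 / 2)"
  proof -
    have "r powr (- 3 / 2) * r powr 1 = r powr (- 1 / 2)" by (subst powr_add[symmetric]) simp
    then show ?thesis using rp by (simp add: field_simps)
  qed
  finally show ?thesis by (simp add: L_def field_simps)
qed

lemma kernel_arc:
  assumes T: "T \<noteq> 0" and cl: "clear \<delta> T \<theta>" and r1: "r1 > 0"
    and w: "norm (w (of_real r1 * cis \<theta>)) \<le> A / r1 ^ j" and A: "A \<ge> 0"
  shows "norm (laplace_kernel q k T w (of_real r1 * cis \<theta>)) * r1 \<le>
     r1 powr (- 1 / 2) / (r1 ^ j * c) * A * (gauss q k (ln (norm T)) * exp ((1/2 + k * ln r1 / ln q) * ln (norm T)))"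
proof -
  have g: "k * (ln r1)\<^sup>2 / (2 * ln q) \<ge> 0" using k ln_q_pos by simp
  have "norm (laplace_kernel q k T w (of_real r1 * cis \<theta>)) * r1 \<le> A / r1 ^ j / (c * q_growth q k (1/2) (r1 / norm T))"
    by (rule pos_le_divide_eq[OF r1, THEN iffD1, OF kernel_ray_le[where w = w, OF T cl r1 w]])
  also have "\<dots> \<le> A / r1 ^ j / c * (exp (k * (ln r1)\<^sup>2 / (2 * ln q)) / q_growth q k (1/2) (r1 / norm T))"
  proof -
    have "A / r1 ^ j / c * (1 / q_growth q k (1/2) (r1 / norm T)) \<le> A / r1 ^ j / c * (exp (k * (ln r1)\<^sup>2 / (2 * ln q)) / q_growth q k (1/2) (r1 / norm T))"
      using A c r1 g by (intro mult_left_mono divide_right_mono) (auto intro: less_imp_le)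
    then show ?thesis by simp
  qed
  finally show ?thesis unfolding weight_shift[OF T r1] by (simp add: field_simps)
qed

lemma kernel_continuous:
  assumes T: "T \<noteq> 0" and cl: "clear \<delta> T \<theta>" and cont: "continuous_on {0<..} (\<lambda>r. w (of_real r * cis \<theta>))"
  shows "continuous_on {0<..} (\<lambda>r. laplace_kernel q k T w (of_real r * cis \<theta>) * cis \<theta>)"
proof -
  have "continuous_on {0<..} (\<lambda>r. Theta q k (of_real r * cis \<theta> / T))"
    by (rule continuous_on_compose2[OF Theta_continuous[OF q k, of "- {0}"]])
       (use T in \<open>auto intro!: continuous_intros\<close>)
  then show ?thesis unfolding laplace_kernel_def
    using theta_ray_nonzero[OF T cl] by (intro continuous_intros cont) auto
qed

lemma laplace_parts:
  assumes T: "T \<noteq> 0" and cl: "clear \<delta> T \<theta>" and r1: "r1 > 0" and A: "A \<ge> 0"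
    and \<nu>: "\<nu> + k / ln q * ln (norm T) \<le> 0" and w: "ray_bounded q k \<nu> j r1 A w \<theta>"
  defines "h \<equiv> \<lambda>r. laplace_kernel q k T w (of_real r * cis \<theta>) * cis \<theta>"
  shows "halfline_integral \<theta> (laplace_kernel q k T w) = (LINT r:{0<..r1}|lborel. h r) + (LINT r:{r1<..}|lborel. h r)"
    and "norm (LINT r:{0<..r1}|lborel. h r) \<le> exp ((real j + 3/2)\<^sup>2 * ln q / (2 * k)) / c * A / norm T ^ Suc j * r1"
    and "norm (LINT r:{r1<..}|lborel. h r) \<le> 
      2 * (exp (\<nu> * ln r1) / c * A * (gauss q k (ln (norm T)) * exp ((1/2 + k * ln r1 / ln q) * ln (norm T)))) * r1 powr (- 1 / 2)"
proof -
  have cont: "continuous_on {0<..} h"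
    unfolding h_def by (rule kernel_continuous[OF T cl]) (use w in \<open>simp add: ray_bounded_def\<close>)
  have n: "norm (h r) \<le> exp ((real j + 3/2)\<^sup>2 * ln q / (2 * k)) / c * A / norm T ^ Suc j" if "0 < r" "r \<le> r1" for r
    using kernel_near[OF T cl that(1) _ A, of w j] w that by (auto simp: h_def norm_mult ray_bounded_def)
  have f: "norm (h r) \<le> (exp (\<nu> * ln r1) / c * A * (gauss q k (ln (norm T)) * exp ((1/2 + k * ln r1 / ln q) * ln (norm T)))) * r powr (- 3 / 2)" if "r1 < r" for r
    using kernel_far[OF T cl r1 less_imp_le[OF that] _ A \<nu>, of w] w that by (auto simp: h_def norm_mult ray_bounded_def)
  have cn: "continuous_on {0<..r1} h" "continuous_on {r1<..} h"
    using r1 by (auto intro: continuous_on_subset[OF cont])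
  note N = norm_near_le[OF r1 cn(1) n] and F = norm_far_le[OF r1 cn(2) f]
  show "halfline_integral \<theta> (laplace_kernel q k T w) = (LINT r:{0<..r1}|lborel. h r) + (LINT r:{r1<..}|lborel. h r)"
    using ray_integral_split(2)[OF r1 N(1) F(1)] by (simp add: halfline_integral_def h_def)
  show "norm (LINT r:{0<..r1}|lborel. h r) \<le> exp ((real j + 3/2)\<^sup>2 * ln q / (2 * k)) / c * A / norm T ^ Suc j * r1"
    by (rule N(2))
  show "norm (LINT r:{r1<..}|lborel. h r) \<le> 
      2 * (exp (\<nu> * ln r1) / c * A * (gauss q k (ln (norm T)) * exp ((1/2 + k * ln r1 / ln q) * ln (norm T)))) * r1 powr (- 1 / 2)"
    by (rule F(2))
qed

lemma kernel_holomorphic: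
  assumes T: "T \<noteq> 0" and w: "w holomorphic_on H"
    and A: "\<And>u. u \<in> A \<Longrightarrow> u \<in> H \<and> (\<exists>r>0. \<exists>\<theta>. u = of_real r * cis \<theta> \<and> clear \<delta> T \<theta>)"
  shows "laplace_kernel q k T w holomorphic_on A"
proof -
  have nz: "Theta q k (u / T) \<noteq> 0" "u \<noteq> 0" if "u \<in> A" for u
    using A[OF that] theta_ray_nonzero[OF T] by auto
  have "(\<lambda>u. Theta q k (u / T)) holomorphic_on A"
    by (rule holomorphic_on_compose_gen[OF _ Theta_holomorphic[OF q k, of "- {0}"], unfolded comp_def])
       (use T nz in \<open>auto intro!: holomorphic_intros\<close>)
  moreover have "w holomorphic_on A" by (rule holomorphic_on_subset[OF w]) (use A in auto)
  ultimately show ?thesis unfolding laplace_kernel_def[abs_def]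
    by (intro holomorphic_intros nz) auto
qed

text \<open>The factors in the bounds may depend on \<open>T\<close> and on the sector, since only an equality is at stake.\<close>

lemma laplace_direction_independent:
  assumes T: "T \<noteq> 0" and r1: "0 < r1" "r1 \<le> 1" and A: "A \<ge> 0" and \<nu>: "\<nu> + k / ln q * ln (norm T) \<le> 0"
    and w: "w holomorphic_on H"
    and cl: "\<And>\<theta>. \<theta> \<in> closed_segment a b \<Longrightarrow>
       clear \<delta> T \<theta> \<and> ray_bounded q k \<nu> j r1 A w \<theta> \<and> (\<forall>r>0. of_real r * cis \<theta> \<in> H)"
  shows "halfline_integral b (laplace_kernel q k T w) = halfline_integral a (laplace_kernel q k T w)"
proof -
  define B1 where "B1 = exp ((real j + 3/2)\<^sup>2 * ln q / (2 * k)) / c * A / norm T ^ Suc j"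
  define B2 where "B2 = exp (\<nu> * ln r1) / c * A * (gauss q k (ln (norm T)) * exp ((1/2 + k * ln r1 / ln q) * ln (norm T)))"
  have B: "B1 \<ge> 0" "B2 \<ge> 0" using A c by (auto simp: B1_def B2_def)
  have p1: "1 \<le> r1 powr (- 3 / 2)" using r1 by (simp add: powr_minus one_le_inverse powr_le1)
  have n: "norm (laplace_kernel q k T w (of_real r * cis \<theta>)) \<le> B1" if "0 < r" "r \<le> r1" "\<theta> \<in> closed_segment a b" for r \<theta>
    unfolding B1_def using cl[OF that(3)] that by (intro kernel_near[OF T _ that(1) _ A]) (auto simp: ray_bounded_def)
  have f: "norm (laplace_kernel q k T w (of_real r * cis \<theta>)) \<le> B2 * r powr (- 3 / 2)" if "r1 \<le> r" "\<theta> \<in> closed_segment a b" for r \<theta>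
    unfolding B2_def using cl[OF that(2)] that by (intro kernel_far[OF T _ r1(1) that(1) _ A \<nu>]) (auto simp: ray_bounded_def)
  define B where "B = B1 + B2 * r1 powr (- 3 / 2)"
  show ?thesis
  proof (rule halfline_integral_rotate[where A = "{of_real r * cis \<theta> | r \<theta>. 0 < r \<and> \<theta> \<in> closed_segment a b}" and B = B])
    show "laplace_kernel q k T w holomorphic_on {of_real r * cis \<theta> | r \<theta>. 0 < r \<and> \<theta> \<in> closed_segment a b}"
      by (rule kernel_holomorphic[OF T w]) (use cl in blast)
    fix r \<theta> :: real
    show "norm (laplace_kernel q k T w (of_real r * cis \<theta>)) \<le> B" if r: "0 < r" and \<theta>: "\<theta> \<in> closed_segment a b"
    proof (cases "r \<le> r1")
      case True
      then show ?thesis using n[OF r _ \<theta>] B by (simp add: B_def add_increasing2)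
    next
      case False
      then have "r powr (- 3 / 2) \<le> r1 powr (- 3 / 2)" using r1 by (intro powr_mono2') auto
      then have "B2 * r powr (- 3 / 2) \<le> B2 * r1 powr (- 3 / 2)" by (rule mult_left_mono[OF _ B(2)])
      then show ?thesis using f[of r \<theta>] \<theta> False B by (simp add: B_def)
    qed
    show "norm (laplace_kernel q k T w (of_real r * cis \<theta>)) \<le> B * r powr (- 3 / 2)" if r: "1 \<le> r" and \<theta>: "\<theta> \<in> closed_segment a b"
    proof -
      have "B2 * 1 \<le> B2 * r1 powr (- 3 / 2)" by (rule mult_left_mono[OF p1 B(2)])
      then have "B2 \<le> B" using B by (simp add: B_def)
      then have "B2 * r powr (- 3 / 2) \<le> B * r powr (- 3 / 2)" by (rule mult_right_mono) simp
      moreover have "norm (laplace_kernel q k T w (of_real r * cis \<theta>)) \<le> B2 * r powr (- 3 / 2)"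
        by (rule f) (use r1 r \<theta> in auto)
      ultimately show ?thesis by (rule order_trans[rotated])
    qed
  qed auto
qed

lemma kernel_rotate_le:
  assumes T: "T \<noteq> 0" and r1: "r1 > 0" and A: "A \<ge> 0" and w: "w holomorphic_on H"
    and cl: "\<And>r \<theta>. 0 < r \<Longrightarrow> r \<le> r1 \<Longrightarrow> \<theta> \<in> closed_segment a b \<Longrightarrow>
       clear \<delta> T \<theta> \<and> of_real r * cis \<theta> \<in> H \<and> norm (w (of_real r * cis \<theta>)) \<le> A / r ^ j"
  shows "norm ((LINT r:{0<..r1}|lborel. laplace_kernel q k T w (of_real r * cis b) * cis b) -
               (LINT r:{0<..r1}|lborel. laplace_kernel q k T w (of_real r * cis a) * cis a)) \<le>
     \<bar>b - a\<bar> * (r1 powr (- 1 / 2) / (r1 ^ j * c) * A * (gauss q k (ln (norm T)) * exp ((1/2 + k * ln r1 / ln q) * ln (norm T))))"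
proof (rule ray_integral_rotate_le[OF r1])
  show "laplace_kernel q k T w holomorphic_on {of_real r * cis \<theta> | r \<theta>. 0 < r \<and> r \<le> r1 \<and> \<theta> \<in> closed_segment a b}"
    by (rule kernel_holomorphic[OF T w]) (use cl in blast)
  show "norm (laplace_kernel q k T w (of_real r * cis \<theta>)) \<le> exp ((real j + 3/2)\<^sup>2 * ln q / (2 * k)) / c * A / norm T ^ Suc j"
    if "0 < r" "r \<le> r1" "\<theta> \<in> closed_segment a b" for r \<theta>
    using cl[OF that] that A by (intro kernel_near[OF T]) auto
  show "norm (laplace_kernel q k T w (complex_of_real r1 * cis \<theta>)) * r1
         \<le> r1 powr (- 1 / 2) / (r1 ^ j * c) * A * (gauss q k (ln (norm T)) * exp ((1/2 + k * ln r1 / ln q) * ln (norm T)))"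
    if "\<theta> \<in> closed_segment a b" for \<theta>
    using cl[OF r1 order.refl that] A by (intro kernel_arc[OF T _ r1]) auto
qed auto

text \<open>The integrand of the outer transform near \<open>0\<close> is the product of a Gaussian in \<open>log r\<close> and a Gaussian in
  \<open>log (r / |T|)\<close>. Completing the square shows that its maximum over \<open>r\<close> is Gaussian in \<open>log |T|\<close>, and
  that the orders \<open>\<kappa>\<close> and \<open>k\<close> combine as their harmonic sum \<open>k1\<close>.\<close>

lemma kernel_gauss:
  assumes T: "T \<noteq> 0" and cl: "clear \<delta> T \<theta>" and r: "r > 0" and A: "A \<ge> 0"
    and \<kappa>: "\<kappa> > 0" and k1: "k1 = \<kappa> * k / (\<kappa> + k)"
    and w: "norm (w (of_real r * cis \<theta>)) \<le> A * (gauss q \<kappa> (ln r) * exp (M * ln r))"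
  shows "norm (laplace_kernel q k T w (of_real r * cis \<theta>)) \<le>
     exp ((M - 3/2)\<^sup>2 * ln q / (2 * (\<kappa> + k))) / c * A *
       (gauss q k1 (ln (norm T)) * exp (((M - 3/2) * k / (\<kappa> + k) + 1/2) * ln (norm T)))"
proof -
  define L where "L = ln (norm T)"
  define x where "x = ln r"
  define s where "s = \<kappa> + k"
  define lq where "lq = ln q"
  have s: "s > 0" "lq > 0" using \<kappa> k ln_q_pos by (auto simp: s_def lq_def)
  define U where "U = (M - 3/2)\<^sup>2 * lq / (2 * s) - k1 * L\<^sup>2 / (2 * lq) + ((M - 3/2) * k / s + 1/2) * L"
  define V where "V = - (\<kappa> * x\<^sup>2 / (2 * lq)) + M * x - (k * (x - L)\<^sup>2 / (2 * lq) + (x - L) / 2) - x"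
  have "U - V = s / (2 * lq) * (x - k * L / s - (M - 3/2) * lq / s)\<^sup>2"
  proof -
    have "\<kappa> = s - k" by (simp add: s_def)
    then show ?thesis using s unfolding k1 s_def[symmetric] U_def V_def
      by (simp add: divide_simps power2_eq_square) (simp add: algebra_simps)
  qed
  also have "\<dots> \<ge> 0" using s by simp
  finally have UV: "exp V \<le> exp U" by simp
  have lx: "ln (r / norm T) = x - L" using r T by (simp add: x_def L_def ln_div)
  have er: "r = exp x" using r by (simp add: x_def)
  have eV: "exp V = gauss q \<kappa> x * exp (M * x) / q_growth q k (1/2) (r / norm T) / r"
    unfolding q_growth_half lx gauss_def lq_def[symmetric] V_def 
    by (subst er) (simp only: mult_exp_exp exp_diff[symmetric])
  have "norm (laplace_kernel q k T w (of_real r * cis \<theta>)) \<le>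
     A * (gauss q \<kappa> (ln r) * exp (M * ln r)) / (c * q_growth q k (1/2) (r / norm T)) / r"
    by (rule kernel_ray_le[where w = w, OF T cl r w])
  also have "\<dots> = A / c * exp V" unfolding eV x_def by simp
  also have "\<dots> \<le> A / c * exp U" using A c by (intro mult_left_mono UV) auto
  also have "exp U = exp ((M - 3/2)\<^sup>2 * lq / (2 * s)) * (gauss q k1 L * exp (((M - 3/2) * k / s + 1/2) * L))"
    unfolding gauss_def lq_def U_def by (simp add: mult_exp_exp algebra_simps)
  finally show ?thesis by (simp add: L_def s_def lq_def mult_ac)
qed

text \<open>The near part of each ray is rotated to the middle direction \<open>\<theta>0\<close>, the only one where both functions
  are assumed to be defined; there their difference is controlled by \<open>B\<close>. The tails, which cannot be
  compared, and the two arcs are small by themselves.\<close>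

lemma laplace_difference:
  fixes a b :: real
  defines "\<theta>0 \<equiv> (a + b) / 2"
  assumes T: "T \<noteq> 0" and r1: "r1 > 0" and A: "A \<ge> 0" and \<nu>: "\<nu> + k / ln q * ln (norm T) \<le> 0"
    and ab: "\<bar>a - b\<bar> \<le> 2 * pi"
    and clr: "\<And>\<theta>. \<theta> \<in> closed_segment a b \<Longrightarrow> clear \<delta> T \<theta>"
    and wa: "ray_bounded q k \<nu> j r1 A wa a" "wa holomorphic_on Ha"
      "\<And>r \<theta>. 0 < r \<Longrightarrow> r \<le> r1 \<Longrightarrow> \<theta> \<in> closed_segment a \<theta>0 \<Longrightarrow>
          of_real r * cis \<theta> \<in> Ha \<and> norm (wa (of_real r * cis \<theta>)) \<le> A / r ^ j"
    and wb: "ray_bounded q k \<nu> j r1 A wb b" "wb holomorphic_on Hb"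
      "\<And>r \<theta>. 0 < r \<Longrightarrow> r \<le> r1 \<Longrightarrow> \<theta> \<in> closed_segment b \<theta>0 \<Longrightarrow>
          of_real r * cis \<theta> \<in> Hb \<and> norm (wb (of_real r * cis \<theta>)) \<le> A / r ^ j"
    and B: "\<And>r. 0 < r \<Longrightarrow> r \<le> r1 \<Longrightarrow>
          norm (laplace_kernel q k T (\<lambda>u. wb u - wa u) (of_real r * cis \<theta>0)) \<le> B"
  shows "norm (halfline_integral b (laplace_kernel q k T wb) - halfline_integral a (laplace_kernel q k T wa))
     \<le> (4 * exp (\<nu> * ln r1) + 2 * pi / r1 ^ j) * r1 powr (- 1 / 2) / c * A *
          (gauss q k (ln (norm T)) * exp ((1/2 + k * ln r1 / ln q) * ln (norm T))) + B * r1"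
proof -
  define G where "G = gauss q k (ln (norm T)) * exp ((1/2 + k * ln r1 / ln q) * ln (norm T))"
  define N where "N w \<theta> = (LINT r:{0<..r1}|lborel. laplace_kernel q k T w (of_real r * cis \<theta>) * cis \<theta>)" for w \<theta>
  define F where "F w \<theta> = (LINT r:{r1<..}|lborel. laplace_kernel q k T w (of_real r * cis \<theta>) * cis \<theta>)" for w \<theta>
  have G0: "G \<ge> 0" by (simp add: G_def less_imp_le)
  have mid: "\<theta>0 \<in> closed_segment a b" 
    unfolding \<theta>0_def using midpoint_in_closed_segment[of a b] by (simp add: midpoint_def field_simps)
  have seg: "closed_segment a \<theta>0 \<subseteq> closed_segment a b" "closed_segment b \<theta>0 \<subseteq> closed_segment a b"
    using mid by (auto simp: subset_closed_segment)
  note pa = laplace_parts[OF T clr[OF ends_in_segment(1)] r1 A \<nu> wa(1), folded N_def F_def G_def]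
  note pb = laplace_parts[OF T clr[OF ends_in_segment(2)] r1 A \<nu> wb(1), folded N_def F_def G_def]
  have sa: "norm (N wa \<theta>0 - N wa a) \<le> \<bar>\<theta>0 - a\<bar> * (r1 powr (- 1 / 2) / (r1 ^ j * c) * A * G)"
    unfolding N_def G_def
    by (rule kernel_rotate_le[OF T r1 A wa(2)]) (use wa(3) clr seg in auto)
  have sb: "norm (N wb \<theta>0 - N wb b) \<le> \<bar>\<theta>0 - b\<bar> * (r1 powr (- 1 / 2) / (r1 ^ j * c) * A * G)"
    unfolding N_def G_def
    by (rule kernel_rotate_le[OF T r1 A wb(2)]) (use wb(3) clr seg in auto)
  have cont: "continuous_on {0<..r1} (\<lambda>r. laplace_kernel q k T w (of_real r * cis \<theta>0) * cis \<theta>0)"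
    if "w holomorphic_on H" "\<And>r. 0 < r \<Longrightarrow> r \<le> r1 \<Longrightarrow> of_real r * cis \<theta>0 \<in> H" for w H
  proof -
    have "laplace_kernel q k T w holomorphic_on {of_real r * cis \<theta> | r \<theta>. 0 < r \<and> r \<le> r1 \<and> \<theta> \<in> {\<theta>0}}"
      by (rule kernel_holomorphic[OF T that(1)]) (use that clr mid in blast)
    from holomorphic_on_imp_continuous_on[OF this]
    have "continuous_on {0<..r1} (\<lambda>r. laplace_kernel q k T w (of_real r * cis \<theta>0))"
      by (rule continuous_on_compose2) (auto intro!: continuous_intros)
    then show ?thesis by (intro continuous_intros)
  qed
  have ca: "continuous_on {0<..r1} (\<lambda>r. laplace_kernel q k T wa (of_real r * cis \<theta>0) * cis \<theta>0)"
    by (rule cont[OF wa(2)]) (use wa(3) in auto)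
  have cb: "continuous_on {0<..r1} (\<lambda>r. laplace_kernel q k T wb (of_real r * cis \<theta>0) * cis \<theta>0)"
    by (rule cont[OF wb(2)]) (use wb(3) in auto)
  have na: "norm (laplace_kernel q k T wa (of_real r * cis \<theta>0) * cis \<theta>0) \<le> exp ((real j + 3/2)\<^sup>2 * ln q / (2 * k)) / c * A / norm T ^ Suc j"
    if "0 < r" "r \<le> r1" for r
    using kernel_near[OF T clr[OF mid] that(1) _ A, of wa j] wa(3) that by (auto simp: norm_mult)
  have nb: "norm (laplace_kernel q k T wb (of_real r * cis \<theta>0) * cis \<theta>0) \<le> exp ((real j + 3/2)\<^sup>2 * ln q / (2 * k)) / c * A / norm T ^ Suc j"
    if "0 < r" "r \<le> r1" for r
    using kernel_near[OF T clr[OF mid] that(1) _ A, of wb j] wb(3) that by (auto simp: norm_mult)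
  have "N wb \<theta>0 - N wa \<theta>0 = (LINT r:{0<..r1}|lborel. laplace_kernel q k T wb (of_real r * cis \<theta>0) * cis \<theta>0 - laplace_kernel q k T wa (of_real r * cis \<theta>0) * cis \<theta>0)"
    unfolding N_def
    by (rule set_integral_diff(2)[symmetric]) (rule norm_near_le(1)[OF r1 cb nb] norm_near_le(1)[OF r1 ca na]; assumption)+
  also have "norm \<dots> \<le> B * r1"
  proof (rule norm_near_le(2)[OF r1])
    fix r assume r: "0 < r" "r \<le> r1"
    have "laplace_kernel q k T wb (of_real r * cis \<theta>0) * cis \<theta>0 - laplace_kernel q k T wa (of_real r * cis \<theta>0) * cis \<theta>0
       = laplace_kernel q k T (\<lambda>u. wb u - wa u) (of_real r * cis \<theta>0) * cis \<theta>0"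
      by (simp add: laplace_kernel_def algebra_simps diff_divide_distrib)
    then show "norm (laplace_kernel q k T wb (of_real r * cis \<theta>0) * cis \<theta>0 - laplace_kernel q k T wa (of_real r * cis \<theta>0) * cis \<theta>0) \<le> B"
      using B[OF r] by (simp add: norm_mult)
  qed (intro continuous_intros ca cb)
  finally have mid_le: "norm (N wb \<theta>0 - N wa \<theta>0) \<le> B * r1" .
  have tri: "norm ((nb + fb) - (na + fa)) \<le> norm (mb - ma) + norm (ma - na) + norm (mb - nb) + norm fa + norm fb"
    for na fa nb fb ma mb :: complex by norm
  define Y where "Y = r1 powr (- 1 / 2) / (r1 ^ j * c) * A * G"
  have Y0: "Y \<ge> 0" using A c r1 G0 by (simp add: Y_def)
  have "\<bar>\<theta>0 - a\<bar> * Y + \<bar>\<theta>0 - b\<bar> * Y = \<bar>a - b\<bar> * Y"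
    unfolding \<theta>0_def by (simp add: abs_if field_simps)
  also have "\<dots> \<le> 2 * pi * Y" using ab Y0 by (intro mult_right_mono) auto
  finally have "norm (halfline_integral b (laplace_kernel q k T wb) - halfline_integral a (laplace_kernel q k T wa))
     \<le> B * r1 + 2 * pi * Y + 2 * (2 * (exp (\<nu> * ln r1) / c * A * G) * r1 powr (- 1 / 2))"
    unfolding pa(1) pb(1)
    using order_trans[OF tri[of "N wb b" "F wb b" "N wa a" "F wa a" "N wb \<theta>0" "N wa \<theta>0"]
        add_mono[OF add_mono[OF add_mono[OF add_mono[OF mid_le sa[folded Y_def]] sb[folded Y_def]] pa(3)] pb(3)]]
    by argo
  also have "\<dots> = (4 * exp (\<nu> * ln r1) + 2 * pi / r1 ^ j) * r1 powr (- 1 / 2) / c * A * G + B * r1"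
    using c r1 by (simp add: Y_def field_simps)
  finally show ?thesis by (simp add: G_def)
qed

end

section \<open>Directions that avoid the zeros of the kernel\<close>

lemma norm_one_plus_cis: "(norm (1 + of_real r * cis x))\<^sup>2 = 1 + 2 * r * cos x + r\<^sup>2"
  unfolding cmod_power2 by (simp add: power_mult_distrib sin_squared_eq) (simp add: power2_eq_square algebra_simps)

lemma norm_one_plus_cis_mono:
  assumes "\<bar>x\<bar> \<le> \<bar>y\<bar>" "\<bar>y\<bar> \<le> pi" "r \<ge> 0"
  shows "norm (1 + of_real r * cis y) \<le> norm (1 + of_real r * cis x)"
proof -
  have "cos \<bar>y\<bar> \<le> cos \<bar>x\<bar>" using assms by (intro cos_monotone_0_pi_le) auto
  then have "r * cos y \<le> r * cos x" using assms(3) by (intro mult_left_mono) auto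
  then have "(norm (1 + of_real r * cis y))\<^sup>2 \<le> (norm (1 + of_real r * cis x))\<^sup>2"
    unfolding norm_one_plus_cis by simp
  then show ?thesis by (rule power2_le_imp_le) simp
qed

lemma calR_iff_clear: "T \<in> calR d \<delta> \<longleftrightarrow> T \<noteq> 0 \<and> clear \<delta> T d"
  by (simp add: calR_def clear_def mult.commute)

lemma clear_polar:
  assumes "t > 0"
  shows "clear \<delta> (of_real t * cis \<phi>) \<theta> \<longleftrightarrow> (\<forall>r\<ge>0. \<delta> < norm (1 + of_real r * cis (\<theta> - \<phi>)))"
proof -
  have e: "of_real r * (cis \<theta> / (of_real t * cis \<phi>)) = of_real (r / t) * cis (\<theta> - \<phi>)" for r
    using assms by (simp add: cis_divide[symmetric])
  show ?thesis
  proof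
    assume c: "clear \<delta> (of_real t * cis \<phi>) \<theta>"
    show "\<forall>r\<ge>0. \<delta> < norm (1 + of_real r * cis (\<theta> - \<phi>))"
    proof (intro allI impI)
      fix r :: real assume "r \<ge> 0"
      with c assms have "\<delta> < norm (1 + of_real (r * t) * (cis \<theta> / (of_real t * cis \<phi>)))"
        unfolding clear_def by (meson mult_nonneg_nonneg less_imp_le)
      then show "\<delta> < norm (1 + of_real r * cis (\<theta> - \<phi>))" unfolding e using assms by simp
    qed
  next
    assume "\<forall>r\<ge>0. \<delta> < norm (1 + of_real r * cis (\<theta> - \<phi>))"
    then show "clear \<delta> (of_real t * cis \<phi>) \<theta>"
      unfolding clear_def e using assms by (meson divide_nonneg_pos)
  qed
qed

lemma clear_cong: "cis a = cis d \<Longrightarrow> clear \<delta> T a \<longleftrightarrow> clear \<delta> T d"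
  by (simp add: clear_def)

text \<open>The distance of the half-line to \<open>-1\<close> only depends on the angle to \<open>\<phi>\<close> and decreases with it.\<close>

lemma clear_closer:
  assumes "t > 0" "clear \<delta> (of_real t * cis \<phi>) a" "\<bar>\<theta> - \<phi>\<bar> \<le> \<bar>a - \<phi>\<bar>" "\<bar>a - \<phi>\<bar> \<le> pi"
  shows "clear \<delta> (of_real t * cis \<phi>) \<theta>"
  using assms(2) norm_one_plus_cis_mono[OF assms(3,4)] unfolding clear_polar[OF assms(1)]
  by (meson less_le_trans)

text \<open>Representatives \<open>a\<close> and \<open>b\<close> of the two directions are chosen within \<open>\<pi>\<close> of the argument \<open>\<phi>\<close> of \<open>T\<close>. The
  segment between them then avoids the direction of \<open>- T\<close>. A point between \<open>a\<close> and the midpoint is at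
  distance at most \<open>|a - b| / 2\<close> from \<open>a\<close>, which does not exceed the larger of the distances of \<open>a\<close> and \<open>b\<close>
  from \<open>\<phi>\<close>. The condition that defines \<open>calR\<close> is monotone in this distance, so that it passes from
  \<open>T\<close> to the point.\<close>

lemma rotation_between_directions:
  assumes T1: "T \<in> calR d1 \<delta>" and T2: "T \<in> calR d2 \<delta>"
  obtains a b where "cis a = cis d1" "cis b = cis d2" "\<bar>a - b\<bar> \<le> 2 * pi"
    "\<And>\<theta>. \<theta> \<in> closed_segment a b \<Longrightarrow> clear \<delta> T \<theta>"
    "\<And>r \<theta>. r > 0 \<Longrightarrow> \<theta> \<in> closed_segment a ((a + b) / 2) \<Longrightarrow> of_real r * cis \<theta> \<in> calR d1 \<delta>"
    "\<And>r \<theta>. r > 0 \<Longrightarrow> \<theta> \<in> closed_segment b ((a + b) / 2) \<Longrightarrow> of_real r * cis \<theta> \<in> calR d2 \<delta>"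
proof -
  define t \<phi> where "t = norm T" and "\<phi> = Arg T"
  have t: "t > 0" using T1 by (simp add: t_def calR_def)
  have T: "T = of_real t * cis \<phi>" using t by (simp add: t_def \<phi>_def rcis_cmod_Arg flip: rcis_def)
  define a b where "a = \<phi> + Arg (cis (d1 - \<phi>))" and "b = \<phi> + Arg (cis (d2 - \<phi>))"
  have c: "cis a = cis d1" "cis b = cis d2"
    unfolding a_def b_def by (simp_all add: cis_mult[symmetric] cis_Arg sgn_eq) (simp_all add: cis_mult)
  have ab: "\<bar>a - \<phi>\<bar> \<le> pi" "\<bar>b - \<phi>\<bar> \<le> pi"
    using Arg_bounded[of "cis (d1 - \<phi>)"] Arg_bounded[of "cis (d2 - \<phi>)"] by (auto simp: a_def b_def)
  have ca: "clear \<delta> (of_real t * cis \<phi>) a" "clear \<delta> (of_real t * cis \<phi>) b"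
    using T1 T2 clear_cong[OF c(1)] clear_cong[OF c(2)] by (simp_all add: calR_iff_clear flip: T)
  have cl: "clear \<delta> T \<theta>" if "\<theta> \<in> closed_segment a b" for \<theta>
  proof -
    have "\<bar>\<theta> - \<phi>\<bar> \<le> \<bar>a - \<phi>\<bar> \<or> \<bar>\<theta> - \<phi>\<bar> \<le> \<bar>b - \<phi>\<bar>"
      using that by (auto simp: closed_segment_eq_real_ivl split: if_splits)
    then show ?thesis unfolding T using clear_closer[OF t] ca ab by blast
  qed
  have rot: "of_real r * cis \<theta> \<in> calR d \<delta>" if r: "r > 0" and d: "cis d = cis e" and \<theta>: "\<bar>\<theta> - e\<bar> \<le> \<bar>a - b\<bar> / 2" for r \<theta> d e
  proof -
    define x where "x = (if \<bar>a - \<phi>\<bar> \<le> \<bar>b - \<phi>\<bar> then b else a)"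
    have x: "\<bar>a - b\<bar> / 2 \<le> \<bar>x - \<phi>\<bar>" "\<bar>x - \<phi>\<bar> \<le> pi" "clear \<delta> (of_real t * cis \<phi>) x"
      using ab ca abs_triangle_ineq4[of "a - \<phi>" "b - \<phi>"] by (auto simp: x_def)
    have "\<delta> < norm (1 + of_real s * cis (e - \<theta>))" if s: "s \<ge> 0" for s
    proof -
      have "\<delta> < norm (1 + of_real s * cis (x - \<phi>))" using x(3) s unfolding clear_polar[OF t] by blast
      also have "\<dots> \<le> norm (1 + of_real s * cis (e - \<theta>))"
        using x \<theta> s abs_minus_commute[of \<theta> e] by (intro norm_one_plus_cis_mono) auto
      finally show ?thesis .
    qed
    then have "clear \<delta> (of_real r * cis \<theta>) e" unfolding clear_polar[OF r] by blast
    then show ?thesis using r clear_cong[OF d] by (simp add: calR_iff_clear)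
  qed
  show thesis
  proof (rule that[OF c])
    show "\<bar>a - b\<bar> \<le> 2 * pi" using ab by linarith
    show "of_real r * cis \<theta> \<in> calR d1 \<delta>" if "r > 0" "\<theta> \<in> closed_segment a ((a + b) / 2)" for r \<theta>
      using that by (intro rot[OF _ c(1)[symmetric]]) (auto simp: closed_segment_eq_real_ivl split: if_splits)
    show "of_real r * cis \<theta> \<in> calR d2 \<delta>" if "r > 0" "\<theta> \<in> closed_segment b ((a + b) / 2)" for r \<theta>
      using that by (intro rot[OF _ c(2)[symmetric]]) (auto simp: closed_segment_eq_real_ivl split: if_splits)
  qed (rule cl)
qed

lemma norm_one_plus_cis_ge:
  assumes "r \<ge> 0"
  shows "(1 + cos x) / 2 \<le> norm (1 + of_real r * cis x)"
proof -
  have c: "0 \<le> 1 + cos x" "cos x \<le> 1" using cos_ge_minus_one[of x] cos_le_one[of x] by linarith+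
  have "((1 + cos x) / 2)\<^sup>2 \<le> 1 + 2 * r * cos x + r\<^sup>2"
  proof (cases "cos x \<ge> 0")
    case True
    have "((1 + cos x) / 2)\<^sup>2 \<le> 1" using c by (intro power_le_one) simp_all
    moreover have "0 \<le> 2 * r * cos x" using True assms by simp
    ultimately show ?thesis using zero_le_power2[of r] by linarith
  next
    case False
    have "(1 + cos x)\<^sup>2 \<le> (1 - cos x) * (1 + cos x)"
      unfolding power2_eq_square using False c by (intro mult_right_mono) auto
    then have "(1 + cos x)\<^sup>2 \<le> 1 - (cos x)\<^sup>2" by (simp add: power2_eq_square algebra_simps)
    moreover have "((1 + cos x) / 2)\<^sup>2 \<le> (1 + cos x)\<^sup>2" using c by (intro power_mono) auto
    moreover have "1 + 2 * r * cos x + r\<^sup>2 = (r + cos x)\<^sup>2 + (1 - (cos x)\<^sup>2)" by (simp add: power2_eq_square algebra_simps)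
    ultimately show ?thesis using zero_le_power2[of "r + cos x"] by linarith
  qed
  then show ?thesis unfolding norm_one_plus_cis[symmetric] using power2_le_imp_le by fastforce
qed

text \<open>The lower bound \<open>norm_one_plus_cis_ge\<close> is continuous in the angle and positive off the direction of
  \<open>- T\<close>, hence bounded below on a compact set of directions.\<close>

lemma clear_on_segment:
  assumes T: "T \<noteq> 0" and seg: "\<And>\<theta>. \<theta> \<in> closed_segment a b \<Longrightarrow> - T \<notin> halfline \<theta>"
  obtains \<delta> where "\<delta> > 0" "\<And>\<theta>. \<theta> \<in> closed_segment a b \<Longrightarrow> clear \<delta> T \<theta>"
proof -
  define t \<phi> where "t = norm T" and "\<phi> = Arg T"
  have t: "t > 0" using T by (simp add: t_def)
  have Tp: "T = of_real t * cis \<phi>" by (simp add: t_def \<phi>_def rcis_cmod_Arg flip: rcis_def)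
  have pos: "(1 + cos (\<theta> - \<phi>)) / 2 > 0" if "\<theta> \<in> closed_segment a b" for \<theta>
  proof (rule ccontr)
    assume "\<not> ?thesis"
    then have "1 + cos (\<theta> - \<phi>) \<le> 0" by simp
    then have "cos (\<theta> - \<phi>) = - 1" using cos_ge_minus_one[of "\<theta> - \<phi>"] by linarith
    then have c: "cis (\<theta> - \<phi>) = - 1" using sin_cos_squared_add[of "\<theta> - \<phi>"] by (simp add: complex_eq_iff)
    have "cis \<theta> = cis (\<theta> - \<phi>) * cis \<phi>" by (simp add: cis_mult)
    then have "- T = of_real t * cis \<theta>" using Tp c by simp
    with seg[OF that] t show False by (auto simp: halfline_def)
  qed
  have "continuous_on (closed_segment a b) (\<lambda>\<theta>. (1 + cos (\<theta> - \<phi>)) / 2)"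
    by (intro continuous_intros) auto
  then obtain \<theta>1 where \<theta>1: "\<theta>1 \<in> closed_segment a b"
      "\<And>\<theta>. \<theta> \<in> closed_segment a b \<Longrightarrow> (1 + cos (\<theta>1 - \<phi>)) / 2 \<le> (1 + cos (\<theta> - \<phi>)) / 2"
    using continuous_attains_inf[of "closed_segment a b" "\<lambda>\<theta>. (1 + cos (\<theta> - \<phi>)) / 2"]
    by (metis compact_segment(1) ends_in_segment(1) empty_iff)
  show thesis
  proof (rule that)
    show "(1 + cos (\<theta>1 - \<phi>)) / 4 > 0" using pos[OF \<theta>1(1)] by simp
    fix \<theta> assume \<theta>: "\<theta> \<in> closed_segment a b"
    show "clear ((1 + cos (\<theta>1 - \<phi>)) / 4) T \<theta>"
      unfolding Tp clear_polar[OF t]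
    proof (intro allI impI)
      fix r :: real assume "r \<ge> 0"
      then show "(1 + cos (\<theta>1 - \<phi>)) / 4 < norm (1 + of_real r * cis (\<theta> - \<phi>))"
        using norm_one_plus_cis_ge[of r "\<theta> - \<phi>"] \<theta>1(2)[OF \<theta>] pos[OF \<theta>1(1)] by linarith
    qed
  qed
qed

section \<open>Two iterated q-Laplace transforms\<close>

lemma q_laplace_kernel:
  "q_laplace q k \<gamma> w T = 1 / of_real (pi_q q k) * halfline_integral \<gamma> (laplace_kernel q k T w)"
  by (simp add: q_laplace_def laplace_kernel_def[abs_def])

lemma gauss_exp_le:
  fixes q k M L :: real
  assumes "q > 1" "k > 0"
  shows "gauss q k L * exp (M * L) \<le> exp (M\<^sup>2 * ln q / (2 * k))"
proof -
  have "k / (2 * ln q) > 0" using assms by simp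
  from quadratic_le[OF this, of M L] have "M * L - k / (2 * ln q) * L\<^sup>2 \<le> M\<^sup>2 * ln q / (2 * k)"
    using assms by (simp add: field_simps)
  then show ?thesis unfolding gauss_def mult_exp_exp by (simp add: algebra_simps)
qed

lemma gauss_mono:
  assumes "q > 1" "k1 \<le> k2"
  shows "gauss q k2 L \<le> gauss q k1 L"
  using assms unfolding gauss_def by (auto intro!: divide_right_mono mult_right_mono)

lemma halfline_integral_cong: "cis a = cis d \<Longrightarrow> halfline_integral a g = halfline_integral d g"
  by (simp add: halfline_integral_def)

lemma ray_bounded_cong: "cis a = cis d \<Longrightarrow> ray_bounded q k \<nu> j r1 A w a = ray_bounded q k \<nu> j r1 A w d"
  by (simp add: ray_bounded_def)

lemma ray_bounded_mono:
  assumes "ray_bounded q k \<nu> j r1 A w \<theta>" "A \<le> A'"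
  shows "ray_bounded q k \<nu> j r1 A' w \<theta>"
  unfolding ray_bounded_def
proof (intro conjI allI impI)
  fix r assume r: "0 < r" "r \<le> r1"
  have "A / r ^ j \<le> A' / r ^ j" using assms r by (intro divide_right_mono) auto
  then show "norm (w (of_real r * cis \<theta>)) \<le> A' / r ^ j"
    using assms r unfolding ray_bounded_def by (meson order_trans)
next
  fix r assume r: "r1 \<le> r"
  have "A * q_growth q k \<nu> r \<le> A' * q_growth q k \<nu> r"
    by (rule mult_right_mono[OF assms(2)]) simp
  then show "norm (w (of_real r * cis \<theta>)) \<le> A' * q_growth q k \<nu> r"
    using assms r unfolding ray_bounded_def by (meson order_trans)
qed (use assms in \<open>simp add: ray_bounded_def\<close>)

text \<open>A pair of functions of one variable such as \<open>w1\<close> and \<open>w2\<close>, or \<open>\<psi>1\<close> and \<open>\<psi>2\<close>, for fixed \<open>m\<close> and \<open>\<epsilon>\<close>. The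
  dependence on \<open>m\<close> only enters through \<open>A\<close>, because all bounds below are linear in \<open>A\<close>.\<close>

definition laplace_pair ::
  "real \<Rightarrow> real \<Rightarrow> real \<Rightarrow> real \<Rightarrow> real \<Rightarrow> real \<Rightarrow> real \<Rightarrow> real \<Rightarrow> real \<Rightarrow> real \<Rightarrow>
   (complex \<Rightarrow> complex) \<Rightarrow> (complex \<Rightarrow> complex) \<Rightarrow> bool" where
  "laplace_pair q \<kappa> k2 \<alpha> \<nu> \<rho> R \<delta> A d v w \<longleftrightarrow>
     v holomorphic_on ball 0 \<rho> \<and> (\<forall>\<tau>\<in>ball 0 \<rho>. norm (v \<tau>) \<le> A) \<and>
     ray_bounded q \<kappa> \<alpha> 0 (\<rho> / 2) A v d \<and>
     (\<forall>\<tau>\<in>calR d \<delta> \<inter> ball 0 R. w \<tau> = q_laplace q \<kappa> d v \<tau>) \<and>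
     w holomorphic_on (calR d \<delta> \<inter> ball 0 R) \<and>
     continuous_on {0<..} (\<lambda>r. w (of_real r * cis d)) \<and>
     (\<forall>r\<ge>R / 2. norm (w (of_real r * cis d)) \<le> A * q_growth q k2 \<nu> r)"

lemma laplace_pair_mono:
  assumes "laplace_pair q \<kappa> k2 \<alpha> \<nu> \<rho> R \<delta> A d v w" "A \<le> A'"
  shows "laplace_pair q \<kappa> k2 \<alpha> \<nu> \<rho> R \<delta> A' d v w"
proof -
  have "A * q_growth q k2 \<nu> r \<le> A' * q_growth q k2 \<nu> r" for r
    by (rule mult_right_mono[OF assms(2)]) simp
  then show ?thesis
    using assms ray_bounded_mono[of q \<kappa> \<alpha> 0 "\<rho> / 2" A v d A'] unfolding laplace_pair_def
    by (meson order_trans)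
qed

context
  fixes q \<kappa> k1 k2 \<alpha> \<nu> \<rho> R \<delta> :: real
  assumes q: "q > 1" and \<kappa>: "\<kappa> > 0" and k2: "k2 > 0" and k1: "k1 = \<kappa> * k2 / (\<kappa> + k2)"
    and \<delta>: "\<delta> > 0" and \<rho>: "\<rho> > 0" and R: "0 < R" "R \<le> 1"
    and \<alpha>: "\<alpha> + \<kappa> / ln q * ln R \<le> 0" and \<nu>: "\<nu> + k2 / ln q * ln R \<le> 0"
begin

lemma growth_exponent_nonpos:
  assumes "k > 0" "s + k / ln q * ln R \<le> 0" "norm T < R" "T \<noteq> 0"
  shows "s + k / ln q * ln (norm T) \<le> 0"
proof -
  have "k / ln q * ln (norm T) \<le> k / ln q * ln R"
    using assms q R by (intro mult_left_mono) auto
  then show ?thesis using assms(2) by linarith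
qed

text \<open>The growth admitted by the weighted norm near \<open>0\<close> is not integrable against the outer kernel. As an
  inner transform, however, \<open>w\<close> is at most of size \<open>1 / |\<tau>|\<close>.\<close>

lemma inner_laplace_bound:
  "\<exists>K>0. \<forall>A d v w \<tau>. 0 \<le> A \<longrightarrow> laplace_pair q \<kappa> k2 \<alpha> \<nu> \<rho> R \<delta> A d v w \<longrightarrow>
     \<tau> \<in> calR d \<delta> \<inter> ball 0 R \<longrightarrow> norm (w \<tau>) \<le> K * A / norm \<tau>"
proof -
  obtain c where c: "c > 0" and th: "\<forall>x. x \<noteq> 0 \<longrightarrow> (\<forall>r\<ge>0. \<delta> < norm (1 + of_real r * x)) \<longrightarrow>
       c * q_growth q \<kappa> (1/2) (norm x) \<le> norm (Theta q \<kappa> x)"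
    using Theta_lower_bound[OF q \<kappa> \<delta>] by blast
  define p where "p = norm (1 / complex_of_real (pi_q q \<kappa>))"
  define M where "M = 1/2 + \<kappa> * ln (\<rho>/2) / ln q"
  define Kn where "Kn = exp ((real 0 + 3/2)\<^sup>2 * ln q / (2 * \<kappa>)) / c * (\<rho> / 2)"
  define Kf where "Kf = 2 * (exp (\<alpha> * ln (\<rho>/2)) / c * exp ((M + 1)\<^sup>2 * ln q / (2 * \<kappa>))) * (\<rho>/2) powr (- 1 / 2)"
  define K where "K = p * (Kn + Kf) + 1"
  have p0: "p \<ge> 0" by (simp add: p_def)
  have Kp: "Kn \<ge> 0" "Kf \<ge> 0" using c \<rho> by (auto simp: Kn_def Kf_def)
  then have K: "K > 0" "p * (Kn + Kf) \<le> K" using p0 by (auto simp: K_def intro: add_nonneg_pos)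
  have "norm (w \<tau>) \<le> K * A / norm \<tau>" if A: "0 \<le> A" and lp: "laplace_pair q \<kappa> k2 \<alpha> \<nu> \<rho> R \<delta> A d v w"
    and \<tau>: "\<tau> \<in> calR d \<delta> \<inter> ball 0 R" for A d v w \<tau>
  proof -
    have \<tau>0: "\<tau> \<noteq> 0" and cl: "clear \<delta> \<tau> d" and \<tau>R: "norm \<tau> < R" using \<tau> by (auto simp: calR_iff_clear)
    have r1: "\<rho> / 2 > 0" using \<rho> by simp
    have rb: "ray_bounded q \<kappa> \<alpha> 0 (\<rho> / 2) A v d" and w: "w \<tau> = q_laplace q \<kappa> d v \<tau>"
      using lp \<tau> by (auto simp: laplace_pair_def)
    note P = laplace_parts[OF q \<kappa> c th \<tau>0 cl r1 A growth_exponent_nonpos[OF \<kappa> \<alpha> \<tau>R \<tau>0] rb]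
    define L where "L = ln (norm \<tau>)"
    define G where "G = gauss q \<kappa> L * exp (M * L)"
    have "G = gauss q \<kappa> L * exp ((M + 1) * L) / norm \<tau>"
      using \<tau>0 by (simp add: G_def L_def exp_add distrib_right)
    also have "\<dots> \<le> exp ((M + 1)\<^sup>2 * ln q / (2 * \<kappa>)) / norm \<tau>"
      by (intro divide_right_mono gauss_exp_le q \<kappa>) simp
    finally have G: "G \<le> exp ((M + 1)\<^sup>2 * ln q / (2 * \<kappa>)) / norm \<tau>" .
    have n: "exp ((real 0 + 3/2)\<^sup>2 * ln q / (2 * \<kappa>)) / c * A / norm \<tau> ^ Suc 0 * (\<rho> / 2) = Kn * A / norm \<tau>"
      by (simp add: Kn_def field_simps)
    have "2 * (exp (\<alpha> * ln (\<rho>/2)) / c * A * G) * (\<rho>/2) powr (- 1 / 2) \<le>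
        2 * (exp (\<alpha> * ln (\<rho>/2)) / c * A * (exp ((M + 1)\<^sup>2 * ln q / (2 * \<kappa>)) / norm \<tau>)) * (\<rho>/2) powr (- 1 / 2)"
      using A c by (intro mult_right_mono mult_left_mono G) auto
    also have "\<dots> = Kf * A / norm \<tau>" by (simp add: Kf_def field_simps)
    finally have f: "2 * (exp (\<alpha> * ln (\<rho>/2)) / c * A * G) * (\<rho>/2) powr (- 1 / 2) \<le> Kf * A / norm \<tau>" .
    have "norm (halfline_integral d (laplace_kernel q \<kappa> \<tau> v)) \<le> Kn * A / norm \<tau> + Kf * A / norm \<tau>"
      unfolding P(1) n[symmetric]
      using P(3) f unfolding G_def M_def L_def
      by (intro order_trans[OF norm_triangle_ineq add_mono[OF P(2)]]) (rule order_trans)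
    then have "norm (w \<tau>) \<le> p * (Kn * A / norm \<tau> + Kf * A / norm \<tau>)"
      unfolding w q_laplace_kernel norm_mult p_def by (intro mult_left_mono) auto
    also have "\<dots> = p * (Kn + Kf) * (A / norm \<tau>)" by (simp add: algebra_simps add_divide_distrib)
    also have "\<dots> \<le> K * (A / norm \<tau>)" using K(2) A by (intro mult_right_mono) auto
    finally show ?thesis by simp
  qed
  then show ?thesis using K(1) by blast
qed

text \<open>The functions \<open>v1\<close> and \<open>v2\<close> coincide near \<open>0\<close>, so the near parts cancel up to arcs and only the flat
  terms of order \<open>\<kappa>\<close> are left.\<close>

lemma inner_laplace_difference:
  "\<exists>K>0. \<exists>M. \<forall>A d1 d2 v1 v2 w1 w2 \<tau>. 0 \<le> A \<longrightarrow>
     laplace_pair q \<kappa> k2 \<alpha> \<nu> \<rho> R \<delta> A d1 v1 w1 \<longrightarrow> laplace_pair q \<kappa> k2 \<alpha> \<nu> \<rho> R \<delta> A d2 v2 w2 \<longrightarrow>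
     (\<forall>u\<in>ball 0 \<rho>. v1 u = v2 u) \<longrightarrow> \<tau> \<in> calR d1 \<delta> \<inter> calR d2 \<delta> \<inter> ball 0 R \<longrightarrow>
     norm (w2 \<tau> - w1 \<tau>) \<le> K * A * (gauss q \<kappa> (ln (norm \<tau>)) * exp (M * ln (norm \<tau>)))"
proof -
  obtain c where c: "c > 0" and th: "\<forall>x. x \<noteq> 0 \<longrightarrow> (\<forall>r\<ge>0. \<delta> < norm (1 + of_real r * x)) \<longrightarrow>
       c * q_growth q \<kappa> (1/2) (norm x) \<le> norm (Theta q \<kappa> x)"
    using Theta_lower_bound[OF q \<kappa> \<delta>] by blast
  define p where "p = norm (1 / complex_of_real (pi_q q \<kappa>))"
  define M where "M = 1/2 + \<kappa> * ln (\<rho>/2) / ln q"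
  define K0 where "K0 = (4 * exp (\<alpha> * ln (\<rho>/2)) + 2 * pi / (\<rho>/2) ^ 0) * (\<rho>/2) powr (- 1 / 2) / c"
  have p0: "p \<ge> 0" by (simp add: p_def)
  have K0: "K0 \<ge> 0" using c \<rho> by (simp add: K0_def add_nonneg_nonneg)
  have K: "p * K0 + 1 > 0" using p0 K0 by (simp add: add_nonneg_pos)
  have "norm (w2 \<tau> - w1 \<tau>) \<le> (p * K0 + 1) * A * (gauss q \<kappa> (ln (norm \<tau>)) * exp (M * ln (norm \<tau>)))"
    if A: "0 \<le> A" and lp: "laplace_pair q \<kappa> k2 \<alpha> \<nu> \<rho> R \<delta> A d1 v1 w1" "laplace_pair q \<kappa> k2 \<alpha> \<nu> \<rho> R \<delta> A d2 v2 w2"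
    and vv: "\<forall>u\<in>ball 0 \<rho>. v1 u = v2 u"
    and \<tau>: "\<tau> \<in> calR d1 \<delta> \<inter> calR d2 \<delta> \<inter> ball 0 R" for A d1 d2 v1 v2 w1 w2 \<tau>
  proof -
    have \<tau>0: "\<tau> \<noteq> 0" and \<tau>R: "norm \<tau> < R" using \<tau> by (auto simp: calR_iff_clear)
    have r1: "\<rho> / 2 > 0" using \<rho> by simp
    have \<tau>12: "\<tau> \<in> calR d1 \<delta>" "\<tau> \<in> calR d2 \<delta>" using \<tau> by auto
    obtain a b where ab: "cis a = cis d1" "cis b = cis d2" "\<bar>a - b\<bar> \<le> 2 * pi"
      "\<And>\<theta>. \<theta> \<in> closed_segment a b \<Longrightarrow> clear \<delta> \<tau> \<theta>"
      using rotation_between_directions[OF \<tau>12] by metis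
    have in_ball: "of_real r * cis \<theta> \<in> ball 0 \<rho>" if "0 < r" "r \<le> \<rho> / 2" for r \<theta>
      using that \<rho> by (simp add: norm_mult)
    have rb: "ray_bounded q \<kappa> \<alpha> 0 (\<rho> / 2) A v1 a" "ray_bounded q \<kappa> \<alpha> 0 (\<rho> / 2) A v2 b"
      using lp ray_bounded_cong[OF ab(1)] ray_bounded_cong[OF ab(2)] by (auto simp: laplace_pair_def)
    have w: "w1 \<tau> = q_laplace q \<kappa> a v1 \<tau>" "w2 \<tau> = q_laplace q \<kappa> b v2 \<tau>"
      using lp \<tau> halfline_integral_cong[OF ab(1)] halfline_integral_cong[OF ab(2)]
      by (auto simp: laplace_pair_def q_laplace_kernel)
    have v: "v1 holomorphic_on ball 0 \<rho>" "\<forall>\<tau>\<in>ball 0 \<rho>. norm (v1 \<tau>) \<le> A"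
      "v2 holomorphic_on ball 0 \<rho>" "\<forall>\<tau>\<in>ball 0 \<rho>. norm (v2 \<tau>) \<le> A"
      using lp by (auto simp: laplace_pair_def)
    have "norm (halfline_integral b (laplace_kernel q \<kappa> \<tau> v2) - halfline_integral a (laplace_kernel q \<kappa> \<tau> v1))
     \<le> K0 * A * (gauss q \<kappa> (ln (norm \<tau>)) * exp (M * ln (norm \<tau>))) + 0 * (\<rho> / 2)"
      unfolding K0_def M_def
    proof (rule laplace_difference[OF q \<kappa> c th \<tau>0 r1 A growth_exponent_nonpos[OF \<kappa> \<alpha> \<tau>R \<tau>0] ab(3) ab(4) rb(1) v(1) _ rb(2) v(3)])
      fix r assume r: "0 < r" "r \<le> \<rho> / 2"
      have "v2 (of_real r * cis ((a + b) / 2)) - v1 (of_real r * cis ((a + b) / 2)) = 0"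
        using vv in_ball[OF r] by simp
      then show "norm (laplace_kernel q \<kappa> \<tau> (\<lambda>u. v2 u - v1 u) (of_real r * cis ((a + b) / 2))) \<le> 0"
        by (simp add: laplace_kernel_def)
    qed (use v in_ball in auto)
    then have "norm (w2 \<tau> - w1 \<tau>) \<le> p * (K0 * A * (gauss q \<kappa> (ln (norm \<tau>)) * exp (M * ln (norm \<tau>))))"
      unfolding w q_laplace_kernel right_diff_distrib[symmetric] norm_mult p_def
      by (intro mult_left_mono) auto
    also have "\<dots> \<le> (p * K0 + 1) * A * (gauss q \<kappa> (ln (norm \<tau>)) * exp (M * ln (norm \<tau>)))"
      using A by (simp add: algebra_simps)
    finally show ?thesis .
  qed
  then show ?thesis using K by blast
qed

text \<open>The bound \<open>inner_laplace_bound\<close> applies on every half-line in \<open>calR d \<delta>\<close> near \<open>0\<close>.\<close>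

lemma outer_ray_bounded:
  "\<exists>K>0. \<forall>A d v w \<theta>. 0 \<le> A \<longrightarrow> laplace_pair q \<kappa> k2 \<alpha> \<nu> \<rho> R \<delta> A d v w \<longrightarrow>
      (\<forall>r>0. of_real r * cis \<theta> \<in> calR d \<delta>) \<longrightarrow>
      continuous_on {0<..} (\<lambda>r. w (of_real r * cis \<theta>)) \<longrightarrow>
      (\<forall>r\<ge>R / 2. norm (w (of_real r * cis \<theta>)) \<le> A * q_growth q k2 \<nu> r) \<longrightarrow>
      ray_bounded q k2 \<nu> 1 (R / 2) (K * A) w \<theta>"
proof -
  obtain K where K: "K > 0" and b: "\<And>A d v w \<tau>. 0 \<le> A \<Longrightarrow> laplace_pair q \<kappa> k2 \<alpha> \<nu> \<rho> R \<delta> A d v w \<Longrightarrow>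
     \<tau> \<in> calR d \<delta> \<inter> ball 0 R \<Longrightarrow> norm (w \<tau>) \<le> K * A / norm \<tau>"
    using inner_laplace_bound by blast
  have "ray_bounded q k2 \<nu> 1 (R / 2) ((K + 1) * A) w \<theta>" 
    if A: "0 \<le> A" and lp: "laplace_pair q \<kappa> k2 \<alpha> \<nu> \<rho> R \<delta> A d v w"
      and \<theta>: "\<forall>r>0. of_real r * cis \<theta> \<in> calR d \<delta>"
      and cont: "continuous_on {0<..} (\<lambda>r. w (of_real r * cis \<theta>))"
      and far: "\<forall>r\<ge>R / 2. norm (w (of_real r * cis \<theta>)) \<le> A * q_growth q k2 \<nu> r"
    for A d v w \<theta>
    unfolding ray_bounded_def
  proof (intro conjI allI impI)
    fix r :: real assume r: "0 < r" "r \<le> R / 2"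
    have "of_real r * cis \<theta> \<in> calR d \<delta> \<inter> ball 0 R" using r \<theta> R by (simp add: norm_mult)
    from b[OF A lp this] have "norm (w (of_real r * cis \<theta>)) \<le> K * A / r" using r by (simp add: norm_mult)
    also have "\<dots> \<le> (K + 1) * A / r" using r A by (intro divide_right_mono mult_right_mono) auto
    finally show "norm (w (of_real r * cis \<theta>)) \<le> (K + 1) * A / r ^ 1" by simp
  next
    fix r :: real assume r: "R / 2 \<le> r"
    have "1 * A \<le> (K + 1) * A" using A K by (intro mult_right_mono) auto
    then have "A * q_growth q k2 \<nu> r \<le> (K + 1) * A * q_growth q k2 \<nu> r"
      by (intro mult_right_mono) auto
    with far r show "norm (w (of_real r * cis \<theta>)) \<le> (K + 1) * A * q_growth q k2 \<nu> r"
      by force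
  qed (rule cont)
  moreover have "K + 1 > 0" using K by simp
  ultimately show ?thesis by blast
qed

lemma own_direction_in_calR:
  assumes "T \<in> calR d \<delta>" "r > 0"
  shows "of_real r * cis d \<in> calR d \<delta>"
proof -
  have "\<delta> < 1" using assms(1) by (auto simp: calR_def dest: spec[of _ 0])
  moreover have "1 \<le> norm (1 + of_real s * cis 0)" if "s \<ge> 0" for s
    using norm_of_real[of "1 + s", where 'a = complex] that by simp
  ultimately have "clear \<delta> (of_real r * cis d) d"
    unfolding clear_polar[OF assms(2)] by (auto intro: less_le_trans)
  then show ?thesis using assms(2) by (simp add: calR_iff_clear)
qed

lemma outer_laplace_bound:
  "\<exists>K. \<forall>A d v w. 0 \<le> A \<longrightarrow> laplace_pair q \<kappa> k2 \<alpha> \<nu> \<rho> R \<delta> A d v w \<longrightarrow>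
     T \<in> calR d \<delta> \<inter> ball 0 R \<longrightarrow> norm (halfline_integral d (laplace_kernel q k2 T w)) \<le> K * A"
proof -
  obtain K where K: "K > 0" and rb: "\<And>A d v w \<theta>. 0 \<le> A \<Longrightarrow> laplace_pair q \<kappa> k2 \<alpha> \<nu> \<rho> R \<delta> A d v w \<Longrightarrow>
      (\<forall>r>0. of_real r * cis \<theta> \<in> calR d \<delta>) \<Longrightarrow>
      continuous_on {0<..} (\<lambda>r. w (of_real r * cis \<theta>)) \<Longrightarrow>
      (\<forall>r\<ge>R / 2. norm (w (of_real r * cis \<theta>)) \<le> A * q_growth q k2 \<nu> r) \<Longrightarrow>
      ray_bounded q k2 \<nu> 1 (R / 2) (K * A) w \<theta>"
    using outer_ray_bounded by blast
  obtain c where c: "c > 0" and th: "\<forall>x. x \<noteq> 0 \<longrightarrow> (\<forall>r\<ge>0. \<delta> < norm (1 + of_real r * x)) \<longrightarrow>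
       c * q_growth q k2 (1/2) (norm x) \<le> norm (Theta q k2 x)"
    using Theta_lower_bound[OF q k2 \<delta>] by blast
  define X where "X = exp ((real 1 + 3/2)\<^sup>2 * ln q / (2 * k2)) / c * K / norm T ^ Suc 1 * (R / 2)"
  define Y where "Y = 2 * (exp (\<nu> * ln (R / 2)) / c * K * (gauss q k2 (ln (norm T)) * exp ((1/2 + k2 * ln (R / 2) / ln q) * ln (norm T)))) * (R / 2) powr (- 1 / 2)"
  have "norm (halfline_integral d (laplace_kernel q k2 T w)) \<le> (X + Y) * A"
    if A: "0 \<le> A" and lp: "laplace_pair q \<kappa> k2 \<alpha> \<nu> \<rho> R \<delta> A d v w" and T: "T \<in> calR d \<delta> \<inter> ball 0 R" for A d v w
  proof -
    have T0: "T \<noteq> 0" and cl: "clear \<delta> T d" and TR: "norm T < R" using T by (auto simp: calR_iff_clear)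
    have r1: "R / 2 > 0" and KA: "K * A \<ge> 0" using R K A by auto
    have "ray_bounded q k2 \<nu> 1 (R / 2) (K * A) w d"
      using lp own_direction_in_calR T by (intro rb[OF A lp]) (auto simp: laplace_pair_def)
    note P = laplace_parts[OF q k2 c th T0 cl r1 KA growth_exponent_nonpos[OF k2 \<nu> TR T0] this]
    have "norm (halfline_integral d (laplace_kernel q k2 T w)) \<le> X * A + Y * A"
      unfolding P(1) by (rule order_trans[OF norm_triangle_ineq add_mono])
        (use P(2,3) in \<open>simp_all only: X_def Y_def mult_ac times_divide_eq_right times_divide_eq_left\<close>)
    then show ?thesis by (simp add: algebra_simps)
  qed
  then show ?thesis by blast
qed

text \<open>The distance \<open>\<delta>\<close> does not control how close the direction \<open>\<gamma>\<close> comes to \<open>- T\<close>; a distance \<open>e\<close> that depends on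
  \<open>T\<close> and on the segment of directions is used instead.\<close>

lemma outer_direction_independent:
  assumes A: "0 \<le> A" and lp: "laplace_pair q \<kappa> k2 \<alpha> \<nu> \<rho> R \<delta> A d v w"
    and T: "T \<noteq> 0" "norm T < R"
    and hol: "w holomorphic_on S" and S: "S \<subseteq> calR d \<delta>"
    and seg: "\<And>\<theta>. \<theta> \<in> closed_segment d \<gamma> \<Longrightarrow> halfline \<theta> \<subseteq> S \<and> - T \<notin> halfline \<theta>"
    and far: "\<And>u. u \<in> S \<Longrightarrow> R / 2 \<le> norm u \<Longrightarrow>
       norm (w u) \<le> A * q_growth q k2 \<nu> (norm u)"
  shows "halfline_integral \<gamma> (laplace_kernel q k2 T w) = halfline_integral d (laplace_kernel q k2 T w)"
proof -
  obtain K where K: "K > 0" and rb: "\<And>A d v w \<theta>. 0 \<le> A \<Longrightarrow> laplace_pair q \<kappa> k2 \<alpha> \<nu> \<rho> R \<delta> A d v w \<Longrightarrow>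
      (\<forall>r>0. of_real r * cis \<theta> \<in> calR d \<delta>) \<Longrightarrow>
      continuous_on {0<..} (\<lambda>r. w (of_real r * cis \<theta>)) \<Longrightarrow>
      (\<forall>r\<ge>R / 2. norm (w (of_real r * cis \<theta>)) \<le> A * q_growth q k2 \<nu> r) \<Longrightarrow>
      ray_bounded q k2 \<nu> 1 (R / 2) (K * A) w \<theta>"
    using outer_ray_bounded by blast
  obtain e where e: "e > 0" "\<And>\<theta>. \<theta> \<in> closed_segment d \<gamma> \<Longrightarrow> clear e T \<theta>"
    using clear_on_segment[OF T(1), of d \<gamma>] seg by blast
  obtain c where c: "c > 0" and th: "\<forall>x. x \<noteq> 0 \<longrightarrow> (\<forall>r\<ge>0. e < norm (1 + of_real r * x)) \<longrightarrow>
       c * q_growth q k2 (1/2) (norm x) \<le> norm (Theta q k2 x)"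
    using Theta_lower_bound[OF q k2 e(1)] by blast
  have inS: "of_real r * cis \<theta> \<in> S" if "\<theta> \<in> closed_segment d \<gamma>" "r > 0" for r \<theta>
    using seg[OF that(1)] that(2) by (auto simp: halfline_def)
  have r1: "0 < R / 2" "R / 2 \<le> 1" and KA: "K * A \<ge> 0" using R K A by auto
  have "ray_bounded q k2 \<nu> 1 (R / 2) (K * A) w \<theta>" if \<theta>: "\<theta> \<in> closed_segment d \<gamma>" for \<theta>
  proof (rule rb[OF A lp])
    show "\<forall>r>0. of_real r * cis \<theta> \<in> calR d \<delta>" using inS[OF \<theta>] S by auto
    show "continuous_on {0<..} (\<lambda>r. w (of_real r * cis \<theta>))"
      by (rule continuous_on_compose2[OF holomorphic_on_imp_continuous_on[OF hol]])
         (use inS[OF \<theta>] in \<open>auto intro!: continuous_intros\<close>)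
    show "\<forall>r\<ge>R / 2. norm (w (of_real r * cis \<theta>)) \<le> A * q_growth q k2 \<nu> r"
    proof (intro allI impI)
      fix r :: real assume r: "R / 2 \<le> r"
      then have "r > 0" using R by simp
      then show "norm (w (of_real r * cis \<theta>)) \<le> A * q_growth q k2 \<nu> r"
        using far[OF inS[OF \<theta>], of r] r by (simp add: norm_mult)
    qed
  qed
  then show ?thesis
    using laplace_direction_independent[OF q k2 c th T(1) r1 KA growth_exponent_nonpos[OF k2 \<nu> T(2,1)] hol] inS e(2)
    by blast
qed

text \<open>The tails and arcs are flat of order \<open>k2\<close>, which exceeds \<open>k1\<close>. On the middle direction the flatness of
  order \<open>\<kappa>\<close> of \<open>w2 - w1\<close> is combined with the kernel by \<open>kernel_gauss\<close>.\<close>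

lemma outer_laplace_difference:
  "\<exists>K>0. \<exists>M. \<forall>A d1 d2 v1 v2 w1 w2 T. 0 \<le> A \<longrightarrow>
     laplace_pair q \<kappa> k2 \<alpha> \<nu> \<rho> R \<delta> A d1 v1 w1 \<longrightarrow> laplace_pair q \<kappa> k2 \<alpha> \<nu> \<rho> R \<delta> A d2 v2 w2 \<longrightarrow>
     (\<forall>u\<in>ball 0 \<rho>. v1 u = v2 u) \<longrightarrow> T \<in> calR d1 \<delta> \<inter> calR d2 \<delta> \<inter> ball 0 R \<longrightarrow>
     norm (halfline_integral d2 (laplace_kernel q k2 T w2) - halfline_integral d1 (laplace_kernel q k2 T w1))
       \<le> K * A * (gauss q k1 (ln (norm T)) * exp (M * ln (norm T)))"
proof -
  obtain K1 where K1: "K1 > 0" and rb: "\<And>A d v w \<theta>. 0 \<le> A \<Longrightarrow> laplace_pair q \<kappa> k2 \<alpha> \<nu> \<rho> R \<delta> A d v w \<Longrightarrow>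
      (\<forall>r>0. of_real r * cis \<theta> \<in> calR d \<delta>) \<Longrightarrow>
      continuous_on {0<..} (\<lambda>r. w (of_real r * cis \<theta>)) \<Longrightarrow>
      (\<forall>r\<ge>R / 2. norm (w (of_real r * cis \<theta>)) \<le> A * q_growth q k2 \<nu> r) \<Longrightarrow>
      ray_bounded q k2 \<nu> 1 (R / 2) (K1 * A) w \<theta>"
    using outer_ray_bounded by blast
  obtain K3 where K3: "K3 > 0" and bd: "\<And>A d v w \<tau>. 0 \<le> A \<Longrightarrow> laplace_pair q \<kappa> k2 \<alpha> \<nu> \<rho> R \<delta> A d v w \<Longrightarrow>
     \<tau> \<in> calR d \<delta> \<inter> ball 0 R \<Longrightarrow> norm (w \<tau>) \<le> K3 * A / norm \<tau>"
    using inner_laplace_bound by blast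
  obtain K2 M2 where K2: "K2 > 0" and df: "\<And>A d1 d2 v1 v2 w1 w2 \<tau>. 0 \<le> A \<Longrightarrow>
     laplace_pair q \<kappa> k2 \<alpha> \<nu> \<rho> R \<delta> A d1 v1 w1 \<Longrightarrow> laplace_pair q \<kappa> k2 \<alpha> \<nu> \<rho> R \<delta> A d2 v2 w2 \<Longrightarrow>
     (\<forall>u\<in>ball 0 \<rho>. v1 u = v2 u) \<Longrightarrow> \<tau> \<in> calR d1 \<delta> \<inter> calR d2 \<delta> \<inter> ball 0 R \<Longrightarrow>
     norm (w2 \<tau> - w1 \<tau>) \<le> K2 * A * (gauss q \<kappa> (ln (norm \<tau>)) * exp (M2 * ln (norm \<tau>)))"
    using inner_laplace_difference by blast
  obtain c where c: "c > 0" and th: "\<forall>x. x \<noteq> 0 \<longrightarrow> (\<forall>r\<ge>0. \<delta> < norm (1 + of_real r * x)) \<longrightarrow>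
       c * q_growth q k2 (1/2) (norm x) \<le> norm (Theta q k2 x)"
    using Theta_lower_bound[OF q k2 \<delta>] by blast
  define r1 where "r1 = R / 2"
  have r1: "r1 > 0" using R by (simp add: r1_def)
  define Md where "Md = 1/2 + k2 * ln r1 / ln q"
  define Mn where "Mn = (M2 - 3/2) * k2 / (\<kappa> + k2) + 1/2"
  define M where "M = min Md Mn"
  define K' where "K' = K1 + K3"
  define Kd where "Kd = (4 * exp (\<nu> * ln r1) + 2 * pi / r1 ^ 1) * r1 powr (- 1 / 2) / c * K'"
  define Kn where "Kn = exp ((M2 - 3/2)\<^sup>2 * ln q / (2 * (\<kappa> + k2))) / c * K2 * r1"
  have K': "K' > 0" using K1 K3 by (simp add: K'_def)
  have pos: "Kd > 0" "Kn > 0" using c K' K2 r1 by (auto simp: Kd_def Kn_def intro!: add_pos_pos mult_pos_pos divide_pos_pos)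
  have k12: "k1 \<le> k2"
  proof -
    have "\<kappa> * k2 \<le> k2 * (\<kappa> + k2)" using \<kappa> k2 by (simp add: algebra_simps)
    then show ?thesis unfolding k1 using \<kappa> k2 by (simp add: divide_le_eq)
  qed
  have "norm (halfline_integral d2 (laplace_kernel q k2 T w2) - halfline_integral d1 (laplace_kernel q k2 T w1))
       \<le> (Kd + Kn) * A * (gauss q k1 (ln (norm T)) * exp (M * ln (norm T)))"
    if A: "0 \<le> A" and lp1: "laplace_pair q \<kappa> k2 \<alpha> \<nu> \<rho> R \<delta> A d1 v1 w1" and lp2: "laplace_pair q \<kappa> k2 \<alpha> \<nu> \<rho> R \<delta> A d2 v2 w2"
    and vv: "\<forall>u\<in>ball 0 \<rho>. v1 u = v2 u" and T: "T \<in> calR d1 \<delta> \<inter> calR d2 \<delta> \<inter> ball 0 R"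
    for A d1 d2 v1 v2 w1 w2 T
  proof -
    have T0: "T \<noteq> 0" and TR: "norm T < R" using T by (auto simp: calR_iff_clear)
    have T12: "T \<in> calR d1 \<delta>" "T \<in> calR d2 \<delta>" using T by auto
    define L where "L = ln (norm T)"
    have L: "L \<le> 0" using T0 TR R by (simp add: L_def)
    have g1: "gauss q k2 L * exp (Md * L) \<le> gauss q k1 L * exp (M * L)"
      using L by (intro mult_mono gauss_mono[OF q k12]) (auto simp: M_def intro: mult_right_mono_neg)
    have g2: "gauss q k1 L * exp (Mn * L) \<le> gauss q k1 L * exp (M * L)"
      using L by (intro mult_left_mono) (auto simp: M_def intro: mult_right_mono_neg)
    obtain a b where ab: "cis a = cis d1" "cis b = cis d2" "\<bar>a - b\<bar> \<le> 2 * pi"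
      and cl: "\<And>\<theta>. \<theta> \<in> closed_segment a b \<Longrightarrow> clear \<delta> T \<theta>"
      and sa: "\<And>r \<theta>. r > 0 \<Longrightarrow> \<theta> \<in> closed_segment a ((a + b) / 2) \<Longrightarrow> of_real r * cis \<theta> \<in> calR d1 \<delta>"
      and sb: "\<And>r \<theta>. r > 0 \<Longrightarrow> \<theta> \<in> closed_segment b ((a + b) / 2) \<Longrightarrow> of_real r * cis \<theta> \<in> calR d2 \<delta>"
      using rotation_between_directions[OF T12] by metis
    have KA: "K' * A \<ge> 0" using K' A by simp
    have mono: "ray_bounded q k2 \<nu> 1 r1 (K' * A) w \<theta>" if "ray_bounded q k2 \<nu> 1 r1 (K1 * A) w \<theta>" for w \<theta>
      by (rule ray_bounded_mono[OF that]) (use K3 A in \<open>auto simp: K'_def intro: mult_right_mono\<close>)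
    have ra: "ray_bounded q k2 \<nu> 1 r1 (K' * A) w1 a" unfolding ray_bounded_cong[OF ab(1)]
      by (rule mono, unfold r1_def, rule rb[OF A lp1]) (use lp1 own_direction_in_calR[OF T12(1)] in \<open>auto simp: laplace_pair_def\<close>)
    have rb': "ray_bounded q k2 \<nu> 1 r1 (K' * A) w2 b" unfolding ray_bounded_cong[OF ab(2)]
      by (rule mono, unfold r1_def, rule rb[OF A lp2]) (use lp2 own_direction_in_calR[OF T12(2)] in \<open>auto simp: laplace_pair_def\<close>)
    have hol: "w1 holomorphic_on calR d1 \<delta> \<inter> ball 0 R" "w2 holomorphic_on calR d2 \<delta> \<inter> ball 0 R"
      using lp1 lp2 by (auto simp: laplace_pair_def)
    have nr: "norm (w u) \<le> K' * A / r ^ 1" if "0 < r" and u: "u = of_real r * cis \<theta>" "u \<in> calR d \<delta> \<inter> ball 0 R" 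
      and lp: "laplace_pair q \<kappa> k2 \<alpha> \<nu> \<rho> R \<delta> A d v w" for w u r \<theta> d v
    proof -
      have "norm (w u) \<le> K3 * A / r" using bd[OF A lp u(2)] u(1) that(1) by (simp add: norm_mult)
      also have "\<dots> \<le> K' * A / r" using that(1) A K1 by (intro divide_right_mono mult_right_mono) (auto simp: K'_def)
      finally show ?thesis by simp
    qed
    have inb: "of_real r * cis \<theta> \<in> ball 0 R" if "0 < r" "r \<le> r1" for r \<theta>
      using that R by (simp add: norm_mult r1_def)
    have "norm (halfline_integral b (laplace_kernel q k2 T w2) - halfline_integral a (laplace_kernel q k2 T w1))
     \<le> (4 * exp (\<nu> * ln r1) + 2 * pi / r1 ^ 1) * r1 powr (- 1 / 2) / c * (K' * A) *
          (gauss q k2 (ln (norm T)) * exp ((1/2 + k2 * ln r1 / ln q) * ln (norm T)))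
       + exp ((M2 - 3/2)\<^sup>2 * ln q / (2 * (\<kappa> + k2))) / c * (K2 * A) *
       (gauss q k1 (ln (norm T)) * exp (((M2 - 3/2) * k2 / (\<kappa> + k2) + 1/2) * ln (norm T))) * r1"
    proof (rule laplace_difference[OF q k2 c th T0 r1 KA growth_exponent_nonpos[OF k2 \<nu> TR T0] ab(3) cl ra hol(1) _ rb' hol(2)])
      fix r \<theta> assume r: "0 < r" "r \<le> r1" and "\<theta> \<in> closed_segment a ((a + b) / 2)"
      then have "of_real r * cis \<theta> \<in> calR d1 \<delta> \<inter> ball 0 R" using sa inb by auto
      then show "of_real r * cis \<theta> \<in> calR d1 \<delta> \<inter> ball 0 R \<and> norm (w1 (of_real r * cis \<theta>)) \<le> K' * A / r ^ 1"
        using nr[OF r(1) refl _ lp1] by blast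
    next
      fix r \<theta> assume r: "0 < r" "r \<le> r1" and "\<theta> \<in> closed_segment b ((a + b) / 2)"
      then have "of_real r * cis \<theta> \<in> calR d2 \<delta> \<inter> ball 0 R" using sb inb by auto
      then show "of_real r * cis \<theta> \<in> calR d2 \<delta> \<inter> ball 0 R \<and> norm (w2 (of_real r * cis \<theta>)) \<le> K' * A / r ^ 1"
        using nr[OF r(1) refl _ lp2] by blast
    next
      fix r assume r: "0 < r" "r \<le> r1"
      let ?u = "of_real r * cis ((a + b) / 2)"
      have "?u \<in> calR d1 \<delta> \<inter> calR d2 \<delta> \<inter> ball 0 R"
        using sa[OF r(1) ends_in_segment(2)] sb[OF r(1) ends_in_segment(2)] inb[OF r] by simp
      from df[OF A lp1 lp2 vv this]
      have "norm (w2 ?u - w1 ?u) \<le> K2 * A * (gauss q \<kappa> (ln r) * exp (M2 * ln r))"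
        using r by (simp add: norm_mult)
      then show "norm (laplace_kernel q k2 T (\<lambda>u. w2 u - w1 u) ?u) \<le> exp ((M2 - 3/2)\<^sup>2 * ln q / (2 * (\<kappa> + k2))) / c * (K2 * A) *
       (gauss q k1 (ln (norm T)) * exp (((M2 - 3/2) * k2 / (\<kappa> + k2) + 1/2) * ln (norm T)))"
        using K2 A cl by (intro kernel_gauss[OF q k2 c th T0 _ r(1) _ \<kappa> k1])
          (auto simp: midpoint_def[symmetric] intro!: cl[unfolded midpoint_def] simp: closed_segment_eq_real_ivl)
    qed
    also have "\<dots> = Kd * A * (gauss q k2 L * exp (Md * L)) + Kn * A * (gauss q k1 L * exp (Mn * L))"
      by (simp add: Kd_def Kn_def L_def Md_def Mn_def mult_ac)
    also have "\<dots> \<le> Kd * A * (gauss q k1 L * exp (M * L)) + Kn * A * (gauss q k1 L * exp (M * L))"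
      using pos A by (intro add_mono mult_left_mono g1 g2) auto
    also have "\<dots> = (Kd + Kn) * A * (gauss q k1 L * exp (M * L))" by (simp add: algebra_simps)
    finally show ?thesis
      unfolding L_def halfline_integral_cong[OF ab(1)] halfline_integral_cong[OF ab(2)] .
  qed
  moreover have "Kd + Kn > 0" using pos by simp
  ultimately show ?thesis by blast
qed

end

section \<open>Uniqueness near the origin in the Borel plane\<close>

lemma integrable_exp_abs:
  fixes a :: real
  assumes a: "a > 0"
  shows "integrable lborel (\<lambda>x. exp (- a * \<bar>x\<bar>))"
proof -
  have "(\<lambda>x. exp (- a * x)) integrable_on {0..}" by (rule integrable_on_exp_minus_to_infinity[OF a])
  then have "(\<lambda>x. exp (- a * x)) absolutely_integrable_on {0..}"
    by (intro nonnegative_absolutely_integrable_1) auto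
  then have 1: "integrable lborel (\<lambda>x. indicat_real {0..} x * exp (- a * x))"
    unfolding set_integrable_def by (subst (asm) integrable_completion) auto
  from lborel_integrable_real_affine[OF this, of "- 1" 0]
  have 2: "integrable lborel (\<lambda>x. indicat_real {0..} (- x) * exp (a * x))" by simp
  have "integrable lborel (\<lambda>x. indicat_real {0..} x * exp (- a * x) + indicat_real {0..} (- x) * exp (a * x))"
    by (rule Bochner_Integration.integrable_add[OF 1 2])
  then show ?thesis
    by (rule Bochner_Integration.integrable_bound) (auto simp: indicator_def)
qed

lemma poly_imaginary_le:
  "\<exists>K>0. \<forall>m::real. norm (poly P (\<i> * of_real m)) \<le> K * (1 + \<bar>m\<bar>) ^ degree P"
proof (induction P)
  case 0
  then show ?case by (auto intro: exI[of _ 1])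
next
  case (pCons a P)
  then obtain K where K: "K > 0" "\<And>m::real. norm (poly P (\<i> * of_real m)) \<le> K * (1 + \<bar>m\<bar>) ^ degree P" by blast
  show ?case
  proof (cases "P = 0")
    case True
    have "norm a \<le> norm a + 1" by simp
    then show ?thesis using True by (intro exI[of _ "norm a + 1"]) (auto simp: add_nonneg_pos)
  next
    case False
    have "norm (poly (pCons a P) (\<i> * of_real m)) \<le> (norm a + K) * (1 + \<bar>m\<bar>) ^ degree (pCons a P)" for m :: real
    proof -
      have "norm (poly (pCons a P) (\<i> * of_real m)) \<le> norm a + \<bar>m\<bar> * norm (poly P (\<i> * of_real m))"
        using norm_triangle_ineq[of a "\<i> * of_real m * poly P (\<i> * of_real m)"] by (simp add: norm_mult)
      also have "\<dots> \<le> norm a * (1 + \<bar>m\<bar>) ^ Suc (degree P) + (1 + \<bar>m\<bar>) * (K * (1 + \<bar>m\<bar>) ^ degree P)"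
      proof (intro add_mono mult_mono K)
        show "norm a \<le> norm a * (1 + \<bar>m\<bar>) ^ Suc (degree P)"
          using one_le_power[of "1 + \<bar>m\<bar>" "Suc (degree P)"] by (simp add: mult_le_cancel_left1 del: power_Suc)
      qed (use K in auto)
      finally show ?thesis using False by (simp add: algebra_simps)
    qed
    then show ?thesis using K(1) by (intro exI[of _ "norm a + K"]) (auto simp: add_nonneg_pos)
  qed
qed

text \<open>By induction over the factors: the roots have nonzero real part, so that a linear factor is bounded
  below by a multiple of \<open>1 + |m|\<close> on the imaginary axis.\<close>

lemma poly_imaginary_ge:
  assumes "\<And>m::real. poly P (\<i> * of_real m) \<noteq> 0"
  shows "\<exists>c>0. \<forall>m::real. c * (1 + \<bar>m\<bar>) ^ degree P \<le> norm (poly P (\<i> * of_real m))"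
  using assms
proof (induction "degree P" arbitrary: P)
  case 0
  then obtain a where "P = [:a:]" by (metis degree_eq_zeroE)
  then show ?case using 0 by (intro exI[of _ "norm a"]) auto
next
  case (Suc n)
  then have "\<not> constant (poly P)" by (simp add: constant_degree)
  then obtain z where "poly P z = 0" using fundamental_theorem_of_algebra by blast
  then obtain P' where P: "P = [:- z, 1:] * P'" by (metis dvd_def poly_eq_0_iff_dvd)
  have P'0: "P' \<noteq> 0" using Suc P by auto
  have "degree P = degree [:- z, 1:] + degree P'" unfolding P by (rule degree_mult_eq) (use P'0 in auto)
  then have d: "degree P = Suc (degree P')" by simp
  have "poly P' (\<i> * of_real m) \<noteq> 0" for m using Suc(3)[of m] by (simp add: P)
  with Suc(1)[of P'] Suc(2) d obtain c where c: "c > 0"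
    "\<And>m. c * (1 + \<bar>m\<bar>) ^ degree P' \<le> norm (poly P' (\<i> * of_real m))" by auto
  define e where "e = \<bar>Re z\<bar>"
  have e: "e > 0"
  proof (rule ccontr)
    assume "\<not> e > 0"
    then have "z = \<i> * of_real (Im z)" by (simp add: e_def complex_eq_iff)
    then show False using Suc(3)[of "Im z"] \<open>poly P z = 0\<close> by simp
  qed
  define g where "g = 1 + (1 + norm z) / e"
  have g: "g > 0" using e by (simp add: g_def add_pos_nonneg)
  have lin: "(1 + \<bar>m\<bar>) / g \<le> norm (\<i> * of_real m - z)" for m
  proof -
    let ?X = "norm (\<i> * of_real m - z)"
    have "e \<le> ?X" using abs_Re_le_cmod[of "\<i> * of_real m - z"] by (simp add: e_def)
    then have "1 \<le> ?X / e" using e by simp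
    then have "1 + norm z \<le> (1 + norm z) * (?X / e)" using mult_left_mono[of 1 "?X / e" "1 + norm z"] by simp
    moreover have "\<bar>m\<bar> \<le> ?X + norm z"
      using norm_triangle_sub[of "\<i> * of_real m" z] by (simp add: norm_mult add.commute)
    ultimately have "1 + \<bar>m\<bar> \<le> ?X + (1 + norm z) * (?X / e)" by argo
    then have "1 + \<bar>m\<bar> \<le> ?X * g" by (simp add: g_def algebra_simps)
    then show ?thesis using g by (simp add: divide_le_eq)
  qed
  have "c / g * (1 + \<bar>m\<bar>) ^ degree P \<le> norm (poly P (\<i> * of_real m))" for m
  proof -
    have "(1 + \<bar>m\<bar>) / g * (c * (1 + \<bar>m\<bar>) ^ degree P') \<le> norm (\<i> * of_real m - z) * norm (poly P' (\<i> * of_real m))"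
      using c(1) g by (intro mult_mono lin c) auto
    moreover have "poly P (\<i> * of_real m) = (\<i> * of_real m - z) * poly P' (\<i> * of_real m)"
      by (simp add: P algebra_simps)
    moreover have "(1 + \<bar>m\<bar>) / g * (c * (1 + \<bar>m\<bar>) ^ degree P') = c / g * (1 + \<bar>m\<bar>) ^ degree P"
      unfolding d power_Suc by (simp only: mult_ac times_divide_eq_left times_divide_eq_right)
    ultimately show ?thesis by (simp only: norm_mult)
  qed
  then show ?case using c g by (intro exI[of _ "c / g"]) auto
qed

text \<open>The convolution preserves exponential decay at a rate \<open>b\<close> below that of \<open>C\<close>. The polynomial factor is
  distributed by \<open>1 + |s| \<le> (1 + |m - s|) (1 + |m|)\<close>; its first part is absorbed by \<open>C\<close>, and its second
  part is later compensated by the division by \<open>Q\<close>.\<close>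

lemma conv_integrable_and_bound:
  fixes R :: "complex poly" and C h :: "real \<Rightarrow> complex"
  assumes b: "0 \<le> b" "b < \<beta>" and K: "K \<ge> 0" "\<And>m. norm (poly R (\<i> * of_real m)) \<le> K * (1 + \<bar>m\<bar>) ^ n"
    and C: "continuous_on UNIV C" "c \<ge> 0" "\<And>m. norm (C m) * (1 + \<bar>m\<bar>) ^ n \<le> c * exp (- \<beta> * \<bar>m\<bar>)"
    and h: "continuous_on UNIV h" "H \<ge> 0" "\<And>m. norm (h m) \<le> H * exp (- b * \<bar>m\<bar>)"
  shows "integrable lborel (\<lambda>m1. C (m - m1) * poly R (\<i> * of_real m1) * h m1)" (is "integrable _ ?f")
    and "norm (conv R C h m) \<le> K * c * (LINT y|lborel. exp (- (\<beta> - b) * \<bar>y\<bar>)) * H * (1 + \<bar>m\<bar>) ^ n * exp (- b * \<bar>m\<bar>)"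
proof -
  let ?e = "\<lambda>y. exp (- (\<beta> - b) * \<bar>y\<bar>)"
  define X where "X = K * c * H * (1 + \<bar>m\<bar>) ^ n * exp (- b * \<bar>m\<bar>)"
  have ie: "integrable lborel ?e" using b by (intro integrable_exp_abs) auto
  have ie': "integrable lborel (\<lambda>y. X * ?e (m - y))"
    using lborel_integrable_real_affine[OF ie, of "- 1" m] by (intro integrable_mult_right) simp
  have le: "norm (?f s) \<le> X * ?e (m - s)" for s
  proof -
    have "1 + \<bar>s\<bar> \<le> (1 + \<bar>m - s\<bar>) * (1 + \<bar>m\<bar>)" 
    proof -
      have "\<bar>s\<bar> \<le> \<bar>m - s\<bar> + \<bar>m\<bar>" by linarith
      moreover have "0 \<le> \<bar>m - s\<bar> * \<bar>m\<bar>" by simp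
      moreover have "(1 + \<bar>m - s\<bar>) * (1 + \<bar>m\<bar>) = 1 + \<bar>m - s\<bar> + \<bar>m\<bar> + \<bar>m - s\<bar> * \<bar>m\<bar>" by (simp add: algebra_simps)
      ultimately show ?thesis by linarith
    qed
    then have p: "(1 + \<bar>s\<bar>) ^ n \<le> (1 + \<bar>m - s\<bar>) ^ n * (1 + \<bar>m\<bar>) ^ n"
      unfolding power_mult_distrib[symmetric] by (intro power_mono) auto
    have "b * \<bar>m\<bar> \<le> b * (\<bar>m - s\<bar> + \<bar>s\<bar>)" using b by (intro mult_left_mono) auto
    then have ex: "exp (- \<beta> * \<bar>m - s\<bar>) * exp (- b * \<bar>s\<bar>) \<le> exp (- b * \<bar>m\<bar>) * ?e (m - s)"
      by (simp add: mult_exp_exp algebra_simps)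
    have "norm (?f s) \<le> norm (C (m - s)) * (K * (1 + \<bar>s\<bar>) ^ n) * (H * exp (- b * \<bar>s\<bar>))"
      unfolding norm_mult using K h by (intro mult_mono) auto
    also have "\<dots> \<le> norm (C (m - s)) * (K * ((1 + \<bar>m - s\<bar>) ^ n * (1 + \<bar>m\<bar>) ^ n)) * (H * exp (- b * \<bar>s\<bar>))"
      using K h by (intro mult_mono mult_left_mono p) auto
    also have "\<dots> = K * H * (1 + \<bar>m\<bar>) ^ n * (norm (C (m - s)) * (1 + \<bar>m - s\<bar>) ^ n * exp (- b * \<bar>s\<bar>))"
      by (simp add: mult_ac)
    also have "\<dots> \<le> K * H * (1 + \<bar>m\<bar>) ^ n * (c * exp (- \<beta> * \<bar>m - s\<bar>) * exp (- b * \<bar>s\<bar>))"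
      using K h C by (intro mult_left_mono mult_right_mono C) auto
    also have "\<dots> = K * H * (1 + \<bar>m\<bar>) ^ n * c * (exp (- \<beta> * \<bar>m - s\<bar>) * exp (- b * \<bar>s\<bar>))"
      by (simp add: mult_ac)
    also have "\<dots> \<le> K * H * (1 + \<bar>m\<bar>) ^ n * c * (exp (- b * \<bar>m\<bar>) * ?e (m - s))"
      using K h C by (intro mult_left_mono ex) auto
    finally show ?thesis by (simp add: X_def mult_ac)
  qed
  have X0: "X \<ge> 0" using K C h by (simp add: X_def)
  have cont: "continuous_on UNIV ?f"
    by (intro continuous_intros continuous_on_compose2[OF C(1)] h(1)) auto
  have meas: "?f \<in> borel_measurable lborel"
    using borel_measurable_continuous_onI[OF cont] by simp
  show int: "integrable lborel ?f"
    by (rule Bochner_Integration.integrable_bound[OF ie' meas]) (use le X0 in \<open>auto intro!: AE_I2\<close>)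
  have "norm (conv R C h m) \<le> (LINT s|lborel. norm (?f s))" unfolding conv_def by (rule integral_norm_bound)
  also have "\<dots> \<le> (LINT s|lborel. X * ?e (m - s))"
    by (rule integral_mono[OF integrable_norm[OF int] ie' le])
  also have "\<dots> = X * (LINT y|lborel. ?e y)"
    using lborel_integral_real_affine[of "- 1" ?e m] by simp
  finally show "norm (conv R C h m) \<le> K * c * (LINT y|lborel. ?e y) * H * (1 + \<bar>m\<bar>) ^ n * exp (- b * \<bar>m\<bar>)"
    by (simp add: X_def mult_ac)
qed

lemma cq_pos: "q > 1 \<Longrightarrow> cq q k n > 0"
  by (simp add: cq_def)

lemma sigma_contracts:
  fixes \<tau> :: complex
  assumes "q > 1" "s \<le> 0" "0 < norm \<tau>" "norm \<tau> < r"
  shows "0 < norm (of_real (q powr s) * \<tau>)" "norm (of_real (q powr s) * \<tau>) < r"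
proof -
  have "q powr s \<le> 1" using powr_mono[of s 0 q] assms by simp
  then have "q powr s * norm \<tau> \<le> norm \<tau>" by (simp add: mult_left_le_one_le)
  then have "q powr s * norm \<tau> < r" using assms by linarith
  then show "norm (of_real (q powr s) * \<tau>) < r" by (simp add: norm_mult)
  show "0 < norm (of_real (q powr s) * \<tau>)" using assms by (simp add: norm_mult)
qed

text \<open>After division by \<open>Q(im) \<tau>\<^sup>k\<close> the right-hand side of the homogeneous equation contains only positive
  powers of \<open>\<tau>\<close>, and the arguments are dilated by factors at most \<open>1\<close>. On a disc of small radius \<open>r\<close> a
  bound on the difference thus implies half of this bound, and iteration gives zero. The rate \<open>b\<close> of
  decay in \<open>m\<close> is smaller than \<open>\<beta>\<close>, so that \<open>conv_integrable_and_bound\<close> applies.\<close>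

lemma borel_equation_unique_near_0:
  fixes w w' :: "complex \<Rightarrow> real \<Rightarrow> complex"
  assumes q: "q > 1" and s: "s \<le> 0" and dD: "dD \<ge> 1" and \<rho>: "\<rho> > 0" and \<epsilon>: "norm \<epsilon> \<le> 1"
    and I: "\<And>l. l \<in> {1..D - 1} \<Longrightarrow> finite (I l)"
    and d: "\<And>l j. l \<in> {1..D - 1} \<Longrightarrow> j \<in> I l \<Longrightarrow> d j l \<ge> 1 \<and> real (dl l) - real (d j l) / real k - 1 \<le> 0"
    and Q: "\<And>m. poly Q (\<i> * of_real m) \<noteq> 0" "rQ > 0"
      "\<And>m. rQ * norm (poly (R D) (\<i> * of_real m)) \<le> norm (poly Q (\<i> * of_real m))"
    and b: "0 \<le> b" "b < \<beta>"
    and R: "\<And>l. l \<in> {1..D - 1} \<Longrightarrow> degree (R l) \<le> degree Q"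
    and C: "\<And>l j. l \<in> {1..D - 1} \<Longrightarrow> j \<in> I l \<Longrightarrow> continuous_on UNIV (\<lambda>m. C j l m \<epsilon>) \<and> 0 \<le> cb j l \<and>
       (\<forall>m. norm (C j l m \<epsilon>) * (1 + \<bar>m\<bar>) ^ degree (R l) \<le> cb j l * exp (- \<beta> * \<bar>m\<bar>))"
    and eqn: "borel_equation q k s D dD I d \<Delta> dl Q R C \<epsilon> \<psi> Dom w"
      "borel_equation q k s D dD I d \<Delta> dl Q R C \<epsilon> \<psi>' Dom' w'"
    and dom: "\<And>\<tau>. 0 < norm \<tau> \<Longrightarrow> norm \<tau> < \<rho> \<Longrightarrow> \<tau> \<in> Dom \<and> \<tau> \<in> Dom' \<and> (\<forall>m. \<psi> \<tau> m = \<psi>' \<tau> m)"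
    and w: "\<And>\<tau>. 0 < norm \<tau> \<Longrightarrow> norm \<tau> < \<rho> \<Longrightarrow> continuous_on UNIV (w \<tau>) \<and> (\<forall>m. norm (w \<tau> m) \<le> A * exp (- b * \<bar>m\<bar>))"
    and w': "\<And>\<tau>. 0 < norm \<tau> \<Longrightarrow> norm \<tau> < \<rho> \<Longrightarrow> continuous_on UNIV (w' \<tau>) \<and> (\<forall>m. norm (w' \<tau> m) \<le> A * exp (- b * \<bar>m\<bar>))"
  shows "\<exists>r>0. \<forall>\<tau> m. 0 < norm \<tau> \<longrightarrow> norm \<tau> < r \<longrightarrow> w \<tau> m = w' \<tau> m"
proof -
  define h where "h \<tau> m = w \<tau> m - w' \<tau> m" for \<tau> m
  obtain cQ where cQ: "cQ > 0" "\<And>m. cQ * (1 + \<bar>m\<bar>) ^ degree Q \<le> norm (poly Q (\<i> * of_real m))"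
    using poly_imaginary_ge[OF Q(1)] by blast
  obtain KR where KR: "\<And>l. KR l > 0" "\<And>l m. norm (poly (R l) (\<i> * of_real m)) \<le> KR l * (1 + \<bar>m\<bar>) ^ degree (R l)"
  proof -
    have "\<forall>l. \<exists>K>0. \<forall>m::real. norm (poly (R l) (\<i> * of_real m)) \<le> K * (1 + \<bar>m\<bar>) ^ degree (R l)"
      using poly_imaginary_le by blast
    from choice[OF this] show ?thesis using that by blast
  qed
  define J where "J = (LINT y|lborel. exp (- (\<beta> - b) * \<bar>y\<bar>))"
  have J: "J \<ge> 0" by (simp add: J_def)
  have A0: "A \<ge> 0"
  proof -
    have "0 < norm (of_real (\<rho> / 2) :: complex)" "norm (of_real (\<rho> / 2) :: complex) < \<rho>" using \<rho> by auto
    from w[OF this, THEN conjunct2, THEN spec, of 0] have "norm (w (of_real (\<rho> / 2)) 0) \<le> A" by simp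
    then show ?thesis by (rule order_trans[OF norm_ge_zero])
  qed
  define X where "X l j = KR l * cb j l * J / cQ" for l j
  have X0: "X l j \<ge> 0" if "l \<in> {1..D - 1}" "j \<in> I l" for l j
    using KR(1)[of l] C[OF that] J cQ by (simp add: X_def)
  have conv_le: "norm (conv (R l) (\<lambda>m'. C j l m' \<epsilon>) g m) \<le> X l j * H * norm (poly Q (\<i> * of_real m)) * exp (- b * \<bar>m\<bar>)"
    if lj: "l \<in> {1..D - 1}" "j \<in> I l" and g: "continuous_on UNIV g" "H \<ge> 0" "\<And>m. norm (g m) \<le> H * exp (- b * \<bar>m\<bar>)" for l j g H m
  proof -
    have "norm (conv (R l) (\<lambda>m'. C j l m' \<epsilon>) g m) \<le> KR l * cb j l * J * H * (1 + \<bar>m\<bar>) ^ degree (R l) * exp (- b * \<bar>m\<bar>)"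
      unfolding J_def using C[OF lj] KR[of l] by (intro conv_integrable_and_bound(2) b g) (auto intro: less_imp_le)
    also have "\<dots> \<le> KR l * cb j l * J * H * (norm (poly Q (\<i> * of_real m)) / cQ) * exp (- b * \<bar>m\<bar>)"
    proof (intro mult_right_mono mult_left_mono)
      have "(1 + \<bar>m\<bar>) ^ degree (R l) \<le> (1 + \<bar>m\<bar>) ^ degree Q" using R[OF lj(1)] by (intro power_increasing) auto
      then show "(1 + \<bar>m\<bar>) ^ degree (R l) \<le> norm (poly Q (\<i> * of_real m)) / cQ"
        using cQ(2)[of m] cQ(1) by (simp add: pos_le_divide_eq mult.commute) (meson mult_left_mono order_trans less_imp_le)
    qed (use C[OF lj] KR(1)[of l] J g in auto)
    finally show ?thesis by (simp add: X_def mult_ac)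
  qed
  have conv_diff: "conv (R l) (\<lambda>m'. C j l m' \<epsilon>) (w \<tau>) m - conv (R l) (\<lambda>m'. C j l m' \<epsilon>) (w' \<tau>) m = conv (R l) (\<lambda>m'. C j l m' \<epsilon>) (h \<tau>) m"
    if lj: "l \<in> {1..D - 1}" "j \<in> I l" and \<tau>: "0 < norm \<tau>" "norm \<tau> < \<rho>" for l j \<tau> m
  proof -
    have i: "integrable lborel (\<lambda>m1. C j l (m - m1) \<epsilon> * poly (R l) (\<i> * of_real m1) * g m1)"
      if "continuous_on UNIV g \<and> (\<forall>m. norm (g m) \<le> A * exp (- b * \<bar>m\<bar>))" for g
      using C[OF lj] KR[of l] that A0 by (intro conv_integrable_and_bound(1)[OF b, where K = "KR l" and n = "degree (R l)" and c = "cb j l" and H = A]) (auto intro: less_imp_le)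
    show ?thesis unfolding conv_def h_def
      by (subst Bochner_Integration.integral_diff[OF i[OF w[OF \<tau>]] i[OF w'[OF \<tau>]], symmetric]) (simp add: algebra_simps)
  qed
  define ck where "ck = cq q k k"
  have ck: "ck > 0" using q by (simp add: ck_def cq_pos)
  \<comment> \<open>\<open>Y\<close> bounds the coefficients of all terms on the right, relative to \<open>|Q(im)|\<close>.\<close>
  define Y where "Y = 1 / (rQ * cq q k (dD + k)) + (\<Sum>l = 1..D - 1. \<Sum>j\<in>I l. X l j / (cq q k (d j l + k) * sqrt (2 * pi)))"
  have Y: "Y \<ge> 0" unfolding Y_def using Q(2) q X0 by (intro add_nonneg_nonneg sum_nonneg) (auto simp: less_imp_le[OF cq_pos])
  define r where "r = min (min 1 \<rho>) (1 / (2 * (ck * Y + 1)))"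
  have ckY: "ck * Y + 1 > 0" using ck Y by (simp add: add_nonneg_pos)
  have r: "r > 0" "r \<le> 1" "r \<le> \<rho>" using \<rho> ckY by (auto simp: r_def)
  have rY: "r * (ck * Y) \<le> 1 / 2"
  proof -
    have "r * (ck * Y) \<le> r * (ck * Y + 1)" using r by simp
    also have "\<dots> \<le> 1 / (2 * (ck * Y + 1)) * (ck * Y + 1)" using ckY by (intro mult_right_mono) (auto simp: r_def)
    also have "\<dots> = 1 / 2" using ckY by (simp add: field_simps)
    finally show ?thesis .
  qed
  have step: "norm (h \<tau> m) \<le> H / 2 * exp (- b * \<bar>m\<bar>)"
    if H: "H \<ge> 0" "\<And>\<tau> m. 0 < norm \<tau> \<Longrightarrow> norm \<tau> < r \<Longrightarrow> norm (h \<tau> m) \<le> H * exp (- b * \<bar>m\<bar>)"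
    and \<tau>: "0 < norm \<tau>" "norm \<tau> < r" for H \<tau> m
  proof -
    define q0 where "q0 = norm (poly Q (\<i> * of_real m))"
    define t where "t = norm \<tau>"
    have q0: "q0 > 0" using Q(1)[of m] by (simp add: q0_def)
    have t: "0 < t" "t < r" "t \<le> 1" using \<tau> r by (auto simp: t_def)
    have \<tau>\<rho>: "norm \<tau> < \<rho>" using \<tau> r by simp
    have pw: "t ^ (n + k) \<le> t ^ k * r" if "n \<ge> 1" for n
    proof -
      have "t ^ n \<le> t ^ 1" using that t by (intro power_decreasing) auto
      then have "t ^ k * t ^ n \<le> t ^ k * r" using t by (intro mult_left_mono) auto
      then show ?thesis by (simp add: power_add mult.commute)
    qed
    have conth: "continuous_on UNIV (h \<tau>)" if "0 < norm \<tau>" "norm \<tau> < \<rho>" for \<tau>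
      unfolding h_def using w[OF that] w'[OF that] by (intro continuous_intros) auto
    define a where "a = \<tau> ^ (dD + k) / of_real (cq q k (dD + k)) * (poly (R D) (\<i> * of_real m) * h (of_real (q powr s) * \<tau>) m)"
    define e where "e l j = real (dl l) - real (d j l) / real k - 1" for l j
    define z where "z l j = \<epsilon> ^ (\<Delta> j l - d j l) * \<tau> ^ (d j l + k) / of_real (cq q k (d j l + k)) *
        (1 / of_real (sqrt (2 * pi)) * conv (R l) (\<lambda>m'. C j l m' \<epsilon>) (h (of_real (q powr e l j) * \<tau>)) m)" for l j
    \<comment> \<open>The difference of the two equations; the forcing terms cancel.\<close>
    have lhs: "poly Q (\<i> * of_real m) * (\<tau> ^ k / of_real ck) * h \<tau> m = a + (\<Sum>l = 1..D - 1. \<Sum>j\<in>I l. z l j)"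
    proof -
      have zz: "z l j = \<epsilon> ^ (\<Delta> j l - d j l) * \<tau> ^ (d j l + k) / of_real (cq q k (d j l + k))
             * sigma q (e l j) (\<lambda>x. 1 / of_real (sqrt (2 * pi)) * conv (R l) (\<lambda>m'. C j l m' \<epsilon>) (w x) m) \<tau>
         - \<epsilon> ^ (\<Delta> j l - d j l) * \<tau> ^ (d j l + k) / of_real (cq q k (d j l + k))
             * sigma q (e l j) (\<lambda>x. 1 / of_real (sqrt (2 * pi)) * conv (R l) (\<lambda>m'. C j l m' \<epsilon>) (w' x) m) \<tau>"
        if lj: "l \<in> {1..D - 1}" "j \<in> I l" for l j
      proof -
        have "e l j \<le> 0" using d[OF lj] by (simp add: e_def)
        note sg = sigma_contracts[OF q this \<tau>(1) \<tau>\<rho>]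
        show ?thesis unfolding z_def sigma_def conv_diff[OF lj sg, symmetric] by (simp add: algebra_simps diff_divide_distrib)
      qed
      have aa: "a = \<tau> ^ (dD + k) / of_real (cq q k (dD + k)) * sigma q s (\<lambda>x. poly (R D) (\<i> * of_real m) * w x m) \<tau>
         - \<tau> ^ (dD + k) / of_real (cq q k (dD + k)) * sigma q s (\<lambda>x. poly (R D) (\<i> * of_real m) * w' x m) \<tau>"
        by (simp add: a_def sigma_def h_def algebra_simps)
      have \<psi>: "\<psi> \<tau> m = \<psi>' \<tau> m" and D1: "\<tau> \<in> Dom" "\<tau> \<in> Dom'" using dom[OF \<tau>(1) \<tau>\<rho>] by auto
      note e1 = eqn(1)[unfolded borel_equation_def, rule_format, OF D1(1), of m]
      note e2 = eqn(2)[unfolded borel_equation_def, rule_format, OF D1(2), of m]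
      have "poly Q (\<i> * of_real m) * (\<tau> ^ k / of_real ck) * h \<tau> m =
        poly Q (\<i> * of_real m) * (\<tau> ^ k / of_real ck) * w \<tau> m - poly Q (\<i> * of_real m) * (\<tau> ^ k / of_real ck) * w' \<tau> m"
        by (simp add: h_def right_diff_distrib)
      also have "\<dots> = a + ((\<Sum>l = 1..D - 1. \<Sum>j\<in>I l.
             \<epsilon> ^ (\<Delta> j l - d j l) * \<tau> ^ (d j l + k) / of_real (cq q k (d j l + k))
             * sigma q (e l j) (\<lambda>x. 1 / of_real (sqrt (2 * pi)) * conv (R l) (\<lambda>m'. C j l m' \<epsilon>) (w x) m) \<tau>) -
          (\<Sum>l = 1..D - 1. \<Sum>j\<in>I l.
             \<epsilon> ^ (\<Delta> j l - d j l) * \<tau> ^ (d j l + k) / of_real (cq q k (d j l + k))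
             * sigma q (e l j) (\<lambda>x. 1 / of_real (sqrt (2 * pi)) * conv (R l) (\<lambda>m'. C j l m' \<epsilon>) (w' x) m) \<tau>))"
        unfolding ck_def e1 e2 aa \<psi> e_def by (simp only: algebra_simps)
      also have "\<dots> = a + (\<Sum>l = 1..D - 1. \<Sum>j\<in>I l. z l j)"
        unfolding sum_subtractf[symmetric] by (intro arg_cong2[where f = "(+)"] refl sum.cong zz[symmetric])
      finally show ?thesis .
    qed
    have na: "norm a \<le> (t ^ k * r * q0 * H * exp (- b * \<bar>m\<bar>)) * (1 / (rQ * cq q k (dD + k)))"
    proof -
      note sg = sigma_contracts[OF q s \<tau>]
      have "norm (poly (R D) (\<i> * of_real m)) \<le> q0 / rQ" using Q(2) Q(3)[of m] by (simp add: q0_def pos_le_divide_eq mult.commute)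
      moreover have "norm (\<tau> ^ (dD + k) / of_real (cq q k (dD + k))) \<le> t ^ k * r / cq q k (dD + k)"
      proof -
        have "norm (\<tau> ^ (dD + k) / of_real (cq q k (dD + k))) = t ^ (dD + k) / cq q k (dD + k)"
          using cq_pos[OF q, of k "dD + k"] by (simp add: norm_divide norm_power t_def)
        also have "\<dots> \<le> t ^ k * r / cq q k (dD + k)"
          by (intro divide_right_mono pw dD less_imp_le[OF cq_pos[OF q]])
        finally show ?thesis .
      qed
      ultimately have "norm a \<le> (t ^ k * r) / cq q k (dD + k) * (q0 / rQ * (H * exp (- b * \<bar>m\<bar>)))"
        unfolding a_def norm_mult
        using H(2)[OF sg] cq_pos[OF q, of k "dD + k"] q0 Q(2) r t
        by (intro mult_mono) auto
      then show ?thesis by (simp add: field_simps)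
    qed
    have nz: "norm (z l j) \<le> (t ^ k * r * q0 * H * exp (- b * \<bar>m\<bar>)) * (X l j / (cq q k (d j l + k) * sqrt (2 * pi)))"
      if lj: "l \<in> {1..D - 1}" "j \<in> I l" for l j
    proof -
      have el: "e l j \<le> 0" and d1: "d j l \<ge> 1" using d[OF lj] by (auto simp: e_def)
      note sg = sigma_contracts[OF q el \<tau>]
      have sg2: "norm (of_real (q powr e l j) * \<tau>) < \<rho>" using sg r by simp
      have cv: "norm (conv (R l) (\<lambda>m'. C j l m' \<epsilon>) (h (of_real (q powr e l j) * \<tau>)) m) \<le> X l j * H * q0 * exp (- b * \<bar>m\<bar>)"
        unfolding q0_def by (rule conv_le[OF lj conth[OF sg(1) sg2] H(1) H(2)[OF sg]])
      have "norm (\<epsilon> ^ (\<Delta> j l - d j l)) \<le> 1" using \<epsilon> by (simp add: norm_power power_le_one)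
      then have "norm (\<epsilon> ^ (\<Delta> j l - d j l)) * t ^ (d j l + k) \<le> 1 * (t ^ k * r)"
        using pw[OF d1] t by (intro mult_mono) auto
      then have "norm (\<epsilon> ^ (\<Delta> j l - d j l) * \<tau> ^ (d j l + k) / of_real (cq q k (d j l + k))) \<le> t ^ k * r / cq q k (d j l + k)"
        using cq_pos[OF q, of k "d j l + k"]
        by (simp add: norm_mult norm_divide norm_power t_def divide_right_mono)
      moreover have "norm (1 / of_real (sqrt (2 * pi)) * conv (R l) (\<lambda>m'. C j l m' \<epsilon>) (h (of_real (q powr e l j) * \<tau>)) m)
          \<le> 1 / sqrt (2 * pi) * (X l j * H * q0 * exp (- b * \<bar>m\<bar>))"
        unfolding norm_mult using cv by (intro mult_mono) (auto simp: norm_divide)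
      ultimately have "norm (z l j) \<le> (t ^ k * r) / cq q k (d j l + k) * (1 / sqrt (2 * pi) * (X l j * H * q0 * exp (- b * \<bar>m\<bar>)))"
        unfolding z_def norm_mult[of "_ / _" "_ * _"] using cq_pos[OF q, of k "d j l + k"] r t
        by (intro mult_mono) auto
      then show ?thesis by (simp add: field_simps)
    qed
    have "q0 * (t ^ k / ck) * norm (h \<tau> m) = norm (a + (\<Sum>l = 1..D - 1. \<Sum>j\<in>I l. z l j))"
      unfolding lhs[symmetric] using ck by (simp add: norm_mult norm_divide norm_power q0_def t_def)
    also have "\<dots> \<le> norm a + (\<Sum>l = 1..D - 1. \<Sum>j\<in>I l. norm (z l j))"
      by (intro order_trans[OF norm_triangle_ineq] add_left_mono order_trans[OF norm_sum] sum_mono norm_sum)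
    also have "\<dots> \<le> (t ^ k * r * q0 * H * exp (- b * \<bar>m\<bar>)) * (1 / (rQ * cq q k (dD + k))) +
       (\<Sum>l = 1..D - 1. \<Sum>j\<in>I l. (t ^ k * r * q0 * H * exp (- b * \<bar>m\<bar>)) * (X l j / (cq q k (d j l + k) * sqrt (2 * pi))))"
      by (intro add_mono na sum_mono nz)
    also have "\<dots> = (t ^ k * r * q0 * H * exp (- b * \<bar>m\<bar>)) * Y"
      unfolding Y_def by (simp add: distrib_left sum_distrib_left)
    finally have "q0 * (t ^ k / ck) * norm (h \<tau> m) \<le> (q0 * (t ^ k / ck)) * (r * (ck * Y) * (H * exp (- b * \<bar>m\<bar>)))"
      using ck by (simp add: mult_ac)
    then have "norm (h \<tau> m) \<le> r * (ck * Y) * (H * exp (- b * \<bar>m\<bar>))"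
      by (rule mult_left_le_imp_le) (use q0 t ck in auto)
    also have "\<dots> \<le> 1 / 2 * (H * exp (- b * \<bar>m\<bar>))" using H(1) by (intro mult_right_mono rY) auto
    finally show ?thesis by simp
  qed
  have iter: "norm (h \<tau> m) \<le> 2 * A / 2 ^ n * exp (- b * \<bar>m\<bar>)" if "0 < norm \<tau>" "norm \<tau> < r" for n \<tau> m
    using that
  proof (induction n arbitrary: \<tau> m)
    case 0
    then have "norm \<tau> < \<rho>" using r by simp
    then have "norm (w \<tau> m) \<le> A * exp (- b * \<bar>m\<bar>)" "norm (w' \<tau> m) \<le> A * exp (- b * \<bar>m\<bar>)" using w w' 0 by auto
    then show ?case using norm_triangle_ineq4[of "w \<tau> m" "w' \<tau> m"] unfolding h_def by simp
  next
    case (Suc n)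
    have "norm (h \<tau> m) \<le> (2 * A / 2 ^ n) / 2 * exp (- b * \<bar>m\<bar>)"
      by (rule step[OF _ Suc.IH Suc.prems]) (use A0 in auto)
    then show ?case by simp
  qed
  have "h \<tau> m = 0" if "0 < norm \<tau>" "norm \<tau> < r" for \<tau> m
  proof -
    have "(\<lambda>n. 2 * A * exp (- b * \<bar>m\<bar>) * (1 / 2) ^ n) \<longlonglongrightarrow> 2 * A * exp (- b * \<bar>m\<bar>) * 0"
      by (intro tendsto_intros LIMSEQ_power_zero) auto
    then have "norm (h \<tau> m) \<le> 2 * A * exp (- b * \<bar>m\<bar>) * 0"
      by (rule LIMSEQ_le_const) (use iter[OF that] in \<open>auto simp: power_one_over field_simps\<close>)
    then show ?thesis by simp
  qed
  then show ?thesis using r(1) by (auto simp: h_def)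
qed

section \<open>The weighted function spaces\<close>

lemma weight_E_pos [simp]: "weight_E \<beta> \<mu> m > 0"
  by (simp add: weight_E_def)

lemma weight_E_ge:
  assumes "\<mu> \<ge> real n"
  shows "(1 + \<bar>m\<bar>) ^ n * exp (\<beta> * \<bar>m\<bar>) \<le> weight_E \<beta> \<mu> m"
proof -
  have "(1 + \<bar>m\<bar>) ^ n = (1 + \<bar>m\<bar>) powr real n" by (simp add: powr_realpow)
  also have "\<dots> \<le> (1 + \<bar>m\<bar>) powr \<mu>" using assms by (intro powr_mono) auto
  finally show ?thesis unfolding weight_E_def by (rule mult_right_mono) simp
qed

lemma inverse_weight_E_le:
  assumes "\<mu> \<ge> 0"
  shows "1 / weight_E \<beta> \<mu> m \<le> exp (- \<beta> * \<bar>m\<bar>)"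
proof -
  have "exp (\<beta> * \<bar>m\<bar>) \<le> weight_E \<beta> \<mu> m" using weight_E_ge[of 0 \<mu> m \<beta>] assms by simp
  then have "1 / weight_E \<beta> \<mu> m \<le> 1 / exp (\<beta> * \<bar>m\<bar>)" by (intro divide_left_mono) auto
  then show ?thesis by (simp add: exp_minus field_simps)
qed

lemma halfline_in_sector: "unbounded_sector d S \<Longrightarrow> r > 0 \<Longrightarrow> of_real r * cis d \<in> S"
  unfolding unbounded_sector_def sector_def by force

text \<open>The two estimates are \<open>log (1 + x) \<le> x\<close> for the quotient of the moduli and for its inverse.\<close>

lemma shifted_log_bounds:
  fixes \<delta> c :: real and \<tau> :: complex
  assumes \<delta>: "\<delta> > 0" and c: "c > 0" "c \<le> norm (\<tau> + of_real \<delta>)" and \<tau>: "\<tau> \<noteq> 0"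
  shows "\<bar>ln (norm (\<tau> + of_real \<delta>)) - ln (norm \<tau>)\<bar> \<le> \<delta> * (1 + \<delta> / c) / norm \<tau>"
proof -
  define r s where "r = norm \<tau>" and "s = norm (\<tau> + of_real \<delta>)"
  have r: "r > 0" and s: "s > 0" using \<tau> c by (auto simp: r_def s_def)
  have rs: "s \<le> r + \<delta>" "r \<le> s + \<delta>"
    using norm_triangle_ineq[of \<tau> "of_real \<delta>"] norm_triangle_ineq4[of "\<tau> + of_real \<delta>" "of_real \<delta>"] \<delta>
    by (auto simp: r_def s_def)
  have "ln s - ln r = ln (s / r)" using r s by (simp add: ln_div)
  also have "\<dots> \<le> s / r - 1" using r s by (intro ln_le_minus_one) auto
  also have "\<dots> = (s - r) / r" using r by (simp add: diff_divide_distrib)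
  also have "\<dots> \<le> \<delta> / r" using r rs by (intro divide_right_mono) auto
  also have "\<dots> \<le> \<delta> * (1 + \<delta> / c) / r" using r \<delta> c by (intro divide_right_mono) auto
  finally have 1: "ln s - ln r \<le> \<delta> * (1 + \<delta> / c) / r" .
  have "ln r - ln s = ln (r / s)" using r s by (simp add: ln_div)
  also have "\<dots> \<le> r / s - 1" using r s by (intro ln_le_minus_one) auto
  also have rs': "\<dots> = (r - s) / s" using s by (simp add: diff_divide_distrib)
  also have ds: "\<dots> \<le> \<delta> / s" using s rs by (intro divide_right_mono) auto
  also have "\<dots> = \<delta> * (r / s) / r" using r by simp
  also have "\<dots> \<le> \<delta> * (1 + \<delta> / c) / r"
  proof -
    have "r / s \<le> 1 + \<delta> / s" using ds rs' by linarith
    also have "\<delta> / s \<le> \<delta> / c" using c \<delta> s by (intro divide_left_mono) (auto simp: s_def)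
    finally show ?thesis using \<delta> r by (intro divide_right_mono mult_left_mono) auto
  qed
  finally have 2: "ln r - ln s \<le> \<delta> * (1 + \<delta> / c) / r" .
  from 1 2 show ?thesis unfolding r_def s_def by linarith
qed

lemma abs_ln_le:
  fixes r :: real
  assumes "r > 0"
  shows "\<bar>ln r\<bar> \<le> r + 1 / r"
proof -
  have "ln r \<le> r" using ln_le_minus_one[OF assms] by simp
  moreover have "- ln r \<le> 1 / r" using ln_le_minus_one[of "1 / r"] assms by (simp add: ln_div)
  ultimately show ?thesis using assms by (auto simp: abs_if intro: add_increasing add_increasing2)
qed

text \<open>The shift by \<open>\<delta>\<close> in the weight changes the exponent by a bounded amount: on the disc all logarithms
  are bounded, and away from the origin \<open>log |\<tau> + \<delta>| - log |\<tau>|\<close> is of order \<open>1 / |\<tau>|\<close>, so that even its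
  product with \<open>log |\<tau>|\<close> is bounded.\<close>

lemma ExpU_bounds:
  assumes q: "q > 1" and k: "k \<ge> 0" and \<rho>: "\<rho> > 0" and \<delta>: "\<delta> > 0"
    and sep: "infdist (- of_real \<delta>) (U \<union> ball 0 \<rho>) > 0"
  shows "\<exists>B>0. \<forall>h W. h \<in> ExpU_space q k \<beta> \<mu> \<alpha> \<rho> \<delta> U \<longrightarrow> ExpU_norm q k \<beta> \<mu> \<alpha> \<rho> \<delta> U h \<le> W \<longrightarrow>
    0 \<le> W \<and> (\<forall>\<tau>\<in>cball 0 \<rho>. \<forall>m. norm (h \<tau> m) \<le> B * W / weight_E \<beta> \<mu> m) \<and>
    (\<forall>\<tau>\<in>U. \<forall>m. \<rho> / 2 \<le> norm \<tau> \<longrightarrow>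
       norm (h \<tau> m) \<le> B * W / weight_E \<beta> \<mu> m * q_growth q k \<alpha> (norm \<tau>))"
proof -
  define c where "c = infdist (- of_real \<delta> :: complex) (U \<union> ball 0 \<rho>)"
  have c: "c > 0" using sep by (simp add: c_def)
  have ln_q_pos: "ln q > 0" using q by simp
  have dist: "c \<le> norm (\<tau> + of_real \<delta>)" if "\<tau> \<in> U \<union> cball 0 \<rho>" for \<tau>
  proof -
    have "\<tau> \<in> closure (U \<union> ball 0 \<rho>)"
      using that \<rho> closure_subset[of U] by (auto simp: closure_Un)
    then have "infdist \<tau> (U \<union> ball 0 \<rho>) = 0"
      using in_closure_iff_infdist_zero[of "U \<union> ball 0 \<rho>" \<tau>] \<rho> by auto
    then have "c \<le> dist (- of_real \<delta>) \<tau>"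
      using infdist_triangle[of "- of_real \<delta>" "U \<union> ball 0 \<rho>" \<tau>] by (simp add: c_def)
    also have "dist (- of_real \<delta>) \<tau> = norm (\<tau> + of_real \<delta>)"
      by (metis dist_minus dist_norm minus_minus norm_minus_commute add.commute diff_minus_eq_add)
    finally show ?thesis .
  qed
  define Y where "Y = \<bar>ln c\<bar> + \<bar>ln (\<rho> + \<delta>)\<bar>"
  define E1 where "E1 = k * Y\<^sup>2 / (2 * ln q) + \<bar>\<alpha>\<bar> * Y"
  define B0 where "B0 = \<delta> * (1 + \<delta> / c)"
  define b1 where "b1 = 2 * B0 / \<rho>"
  define b2 where "b2 = B0 * (1 + 4 / \<rho>\<^sup>2)"
  define E2 where "E2 = k * (b1\<^sup>2 + 2 * b2) / (2 * ln q) + \<bar>\<alpha>\<bar> * b1"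
  have B0: "B0 \<ge> 0" using \<delta> c by (simp add: B0_def)
  define B where "B = exp E1 + exp E2"
  have near: "k * (ln (norm (\<tau> + of_real \<delta>)))\<^sup>2 / (2 * ln q) + \<alpha> * ln (norm (\<tau> + of_real \<delta>)) \<le> E1"
    if \<tau>: "\<tau> \<in> cball 0 \<rho>" for \<tau> :: complex
  proof -
    define y where "y = ln (norm (\<tau> + of_real \<delta>))"
    have "c \<le> norm (\<tau> + of_real \<delta>)" using dist \<tau> by auto
    moreover have "norm (\<tau> + of_real \<delta>) \<le> \<rho> + \<delta>"
      using norm_triangle_ineq[of \<tau> "of_real \<delta>"] \<tau> \<delta> by simp
    ultimately have "ln c \<le> y" "y \<le> ln (\<rho> + \<delta>)"
      using c unfolding y_def by (auto intro!: iffD2[OF ln_le_cancel_iff])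
    then have y: "\<bar>y\<bar> \<le> Y" unfolding Y_def by linarith
    have "y\<^sup>2 \<le> Y\<^sup>2" using power_mono[OF y, of 2] by simp
    moreover have "\<alpha> * y \<le> \<bar>\<alpha>\<bar> * Y" 
      by (rule order_trans[OF abs_ge_self]) (use y in \<open>auto simp: abs_mult intro: mult_left_mono\<close>)
    ultimately show ?thesis unfolding E1_def y_def[symmetric] using k ln_q_pos
      by (intro add_mono divide_right_mono mult_left_mono) auto
  qed
  have far: "k * (ln (norm (\<tau> + of_real \<delta>)))\<^sup>2 / (2 * ln q) + \<alpha> * ln (norm (\<tau> + of_real \<delta>)) \<le>
      E2 + (k * (ln (norm \<tau>))\<^sup>2 / (2 * ln q) + \<alpha> * ln (norm \<tau>))"
    if \<tau>: "\<tau> \<in> U" "\<rho> / 2 \<le> norm \<tau>" for \<tau>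
  proof -
    define x y r where "x = ln (norm \<tau>)" and "y = ln (norm (\<tau> + of_real \<delta>))" and "r = norm \<tau>"
    have r: "r \<ge> \<rho> / 2" "r > 0" using \<tau> \<rho> by (auto simp: r_def)
    have "\<tau> \<noteq> 0" using r by (auto simp: r_def)
    from shifted_log_bounds[OF \<delta> c _ this] dist[of \<tau>] \<tau>
    have yx: "\<bar>y - x\<bar> \<le> B0 / r" by (auto simp: x_def y_def r_def B0_def)
    have "B0 / r \<le> B0 / (\<rho> / 2)" using r \<rho> B0 by (intro divide_left_mono) auto
    with yx have yx1: "\<bar>y - x\<bar> \<le> b1" by (simp add: b1_def mult.commute)
    have "\<bar>x\<bar> * \<bar>y - x\<bar> \<le> (r + 1 / r) * (B0 / r)"
      using abs_ln_le[OF r(2)] yx r by (intro mult_mono) (auto simp: x_def r_def)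
    also have "\<dots> = B0 * (1 + 1 / r\<^sup>2)" using r by (simp add: field_simps power2_eq_square)
    also have "\<dots> \<le> b2"
    proof -
      have "(\<rho> / 2)\<^sup>2 \<le> r\<^sup>2" using r \<rho> by (intro power_mono) auto
      then have "1 / r\<^sup>2 \<le> 1 / (\<rho> / 2)\<^sup>2" using \<rho> r by (intro divide_left_mono mult_pos_pos) auto
      then show ?thesis unfolding b2_def using B0 by (intro mult_left_mono) (auto simp: power_divide)
    qed
    finally have xy: "\<bar>x\<bar> * \<bar>y - x\<bar> \<le> b2" .
    have "y\<^sup>2 = x\<^sup>2 + (y - x)\<^sup>2 + 2 * (x * (y - x))" by (simp add: power2_eq_square algebra_simps)
    moreover have "(y - x)\<^sup>2 \<le> b1\<^sup>2" using power_mono[OF yx1, of 2] by simp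
    moreover have "x * (y - x) \<le> b2" using xy by (metis abs_ge_self abs_mult order_trans)
    ultimately have "y\<^sup>2 \<le> x\<^sup>2 + (b1\<^sup>2 + 2 * b2)" by linarith
    then have "k * y\<^sup>2 / (2 * ln q) \<le> k * (x\<^sup>2 + (b1\<^sup>2 + 2 * b2)) / (2 * ln q)"
      using k ln_q_pos by (intro divide_right_mono mult_left_mono) auto
    moreover have "\<alpha> * (y - x) \<le> \<bar>\<alpha>\<bar> * b1"
      by (rule order_trans[OF abs_ge_self]) (use yx1 in \<open>auto simp: abs_mult intro: mult_left_mono\<close>)
    ultimately show ?thesis
      unfolding E2_def x_def[symmetric] y_def[symmetric] by (simp add: algebra_simps add_divide_distrib)
  qed
  have main: "0 \<le> W \<and> (\<forall>\<tau>\<in>cball 0 \<rho>. \<forall>m. norm (h \<tau> m) \<le> B * W / weight_E \<beta> \<mu> m) \<and>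
    (\<forall>\<tau>\<in>U. \<forall>m. \<rho> / 2 \<le> norm \<tau> \<longrightarrow>
       norm (h \<tau> m) \<le> B * W / weight_E \<beta> \<mu> m * q_growth q k \<alpha> (norm \<tau>))"
    if h: "h \<in> ExpU_space q k \<beta> \<mu> \<alpha> \<rho> \<delta> U" and W: "ExpU_norm q k \<beta> \<mu> \<alpha> \<rho> \<delta> U h \<le> W" for h W
  proof -
    define e where "e \<tau> = q_growth q k \<alpha> (norm (\<tau> + of_real \<delta>))" for \<tau> :: complex
    have pt: "norm (h \<tau> m) \<le> W / weight_E \<beta> \<mu> m * e \<tau>" "0 \<le> W" if "\<tau> \<in> U \<union> cball 0 \<rho>" for \<tau> m
    proof -
      have "weight_Exp q k \<beta> \<mu> \<alpha> (\<tau> + of_real \<delta>) m * norm (h \<tau> m) \<le> ExpU_norm q k \<beta> \<mu> \<alpha> \<rho> \<delta> U h"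
        unfolding ExpU_norm_def
        using cSUP_upper[of "(\<tau>, m)" "(U \<union> cball 0 \<rho>) \<times> UNIV" "\<lambda>(\<tau>, m). weight_Exp q k \<beta> \<mu> \<alpha> (\<tau> + of_real \<delta>) m * norm (h \<tau> m)"] h that
        by (simp add: ExpU_space_def)
      also note W
      finally have le: "weight_Exp q k \<beta> \<mu> \<alpha> (\<tau> + of_real \<delta>) m * norm (h \<tau> m) \<le> W" .
      have we: "weight_Exp q k \<beta> \<mu> \<alpha> (\<tau> + of_real \<delta>) m = weight_E \<beta> \<mu> m / e \<tau>"
        unfolding weight_Exp_def e_def q_growth_def by (simp add: exp_diff exp_minus exp_add field_simps)
      have ep: "e \<tau> > 0" by (simp add: e_def)
      show "norm (h \<tau> m) \<le> W / weight_E \<beta> \<mu> m * e \<tau>"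
        using le unfolding we using ep by (simp add: field_simps)
      have "0 \<le> weight_Exp q k \<beta> \<mu> \<alpha> (\<tau> + of_real \<delta>) m * norm (h \<tau> m)" unfolding we using ep by (simp add: less_imp_le)
      with le show "0 \<le> W" by simp
    qed
    have W0: "0 \<le> W" by (rule pt(2)[of 0]) (use \<rho> in auto)
    have B: "exp E1 \<le> B" "exp E2 \<le> B" by (auto simp: B_def)
    show ?thesis
    proof (intro conjI ballI allI impI W0)
      fix \<tau> :: complex and m assume \<tau>: "\<tau> \<in> cball 0 \<rho>"
      have "e \<tau> \<le> B" unfolding e_def by (rule order_trans[OF _ B(1)]) (use near[OF \<tau>] in \<open>simp add: q_growth_def\<close>)
      then have "W / weight_E \<beta> \<mu> m * e \<tau> \<le> W / weight_E \<beta> \<mu> m * B"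
        using W0 by (intro mult_left_mono) (auto simp: less_imp_le)
      then show "norm (h \<tau> m) \<le> B * W / weight_E \<beta> \<mu> m" using pt(1)[of \<tau> m] \<tau> by (simp add: mult.commute)
    next
      fix \<tau> m assume \<tau>: "\<tau> \<in> U" "\<rho> / 2 \<le> norm \<tau>"
      have "e \<tau> \<le> exp E2 * q_growth q k \<alpha> (norm \<tau>)"
        unfolding e_def q_growth_def mult_exp_exp using far[OF \<tau>] by simp
      also have "\<dots> \<le> B * q_growth q k \<alpha> (norm \<tau>)"
        by (rule mult_right_mono[OF B(2)]) simp
      finally have "W / weight_E \<beta> \<mu> m * e \<tau> \<le> W / weight_E \<beta> \<mu> m * (B * q_growth q k \<alpha> (norm \<tau>))"
        using W0 by (intro mult_left_mono) (auto simp: less_imp_le)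
      then show "norm (h \<tau> m) \<le> B * W / weight_E \<beta> \<mu> m * q_growth q k \<alpha> (norm \<tau>)"
        using pt(1)[of \<tau> m] \<tau> by (simp add: mult_ac)
    qed
  qed
  have "B > 0" by (simp add: B_def add_pos_pos)
  then show ?thesis using main by blast
qed

lemma ExpS_bound:
  assumes h: "h \<in> ExpS_space q k \<beta> \<mu> \<nu> S B" and W: "ExpS_norm q k \<beta> \<mu> \<nu> S B h \<le> W" and \<tau>: "\<tau> \<in> ExpS_dom S B"
  shows "0 \<le> W" "norm (h \<tau> m) \<le> W / weight_E \<beta> \<mu> m * q_growth q k \<nu> (norm \<tau>)"
proof -
  define e where "e = q_growth q k \<nu> (norm \<tau>)"
  have "weight_Exp q k \<beta> \<mu> \<nu> \<tau> m * norm (h \<tau> m) \<le> ExpS_norm q k \<beta> \<mu> \<nu> S B h"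
    unfolding ExpS_norm_def
    using cSUP_upper[of "(\<tau>, m)" "ExpS_dom S B \<times> UNIV" "\<lambda>(\<tau>, m). weight_Exp q k \<beta> \<mu> \<nu> \<tau> m * norm (h \<tau> m)"] h \<tau>
    by (simp add: ExpS_space_def)
  also note W
  finally have le: "weight_Exp q k \<beta> \<mu> \<nu> \<tau> m * norm (h \<tau> m) \<le> W" .
  have we: "weight_Exp q k \<beta> \<mu> \<nu> \<tau> m = weight_E \<beta> \<mu> m / e"
    unfolding weight_Exp_def e_def q_growth_def by (simp add: exp_diff exp_minus exp_add field_simps)
  have ep: "e > 0" by (simp add: e_def)
  show "norm (h \<tau> m) \<le> W / weight_E \<beta> \<mu> m * q_growth q k \<nu> (norm \<tau>)"
    using le unfolding we e_def[symmetric] using ep by (simp add: field_simps)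
  have "0 \<le> weight_Exp q k \<beta> \<mu> \<nu> \<tau> m * norm (h \<tau> m)" unfolding we using ep by (simp add: less_imp_le)
  with le show "0 \<le> W" by simp
qed

text \<open>The order \<open>k\<close> of growth of \<open>v\<close> may be smaller than \<open>\<kappa>\<close>: it is \<open>\<kappa>\<close> for the solutions, but \<open>k1\<close> for the
  forcing term.\<close>

lemma laplace_pair_of_Exp:
  assumes q: "q > 1" and k: "0 \<le> k" "k \<le> \<kappa>" and \<rho>: "\<rho> > 0" and \<delta>: "\<delta> > 0" and R: "R > 0"
    and sep: "infdist (- of_real \<delta>) (U \<union> ball 0 \<rho>) > 0"
    and sec: "unbounded_sector d U" "unbounded_sector d S" and Rb: "Rb = calR d \<delta>' \<inter> ball 0 R"
  shows "\<exists>B>0. \<forall>v w W. v \<in> ExpU_space q k \<beta> \<mu> \<alpha> \<rho> \<delta> U \<longrightarrow> ExpU_norm q k \<beta> \<mu> \<alpha> \<rho> \<delta> U v \<le> W \<longrightarrow>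
     w \<in> ExpS_space q k2 \<beta> \<mu> \<nu> S Rb \<longrightarrow> ExpS_norm q k2 \<beta> \<mu> \<nu> S Rb w \<le> W \<longrightarrow>
     (\<forall>\<tau>\<in>Rb. \<forall>m. w \<tau> m = q_laplace q \<kappa> d (\<lambda>h. v h m) \<tau>) \<longrightarrow>
     (\<forall>m. laplace_pair q \<kappa> k2 \<alpha> \<nu> \<rho> R \<delta>' (B * W / weight_E \<beta> \<mu> m) d (\<lambda>\<tau>. v \<tau> m) (\<lambda>\<tau>. w \<tau> m))"
proof -
  obtain B where B: "B > 0" and bd: "\<And>h W. h \<in> ExpU_space q k \<beta> \<mu> \<alpha> \<rho> \<delta> U \<Longrightarrow> ExpU_norm q k \<beta> \<mu> \<alpha> \<rho> \<delta> U h \<le> W \<Longrightarrow>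
    0 \<le> W \<and> (\<forall>\<tau>\<in>cball 0 \<rho>. \<forall>m. norm (h \<tau> m) \<le> B * W / weight_E \<beta> \<mu> m) \<and>
    (\<forall>\<tau>\<in>U. \<forall>m. \<rho> / 2 \<le> norm \<tau> \<longrightarrow>
       norm (h \<tau> m) \<le> B * W / weight_E \<beta> \<mu> m * q_growth q k \<alpha> (norm \<tau>))"
    using ExpU_bounds[OF q k(1) \<rho> \<delta> sep] by blast
  have ln_q_pos: "ln q > 0" using q by simp
  have "laplace_pair q \<kappa> k2 \<alpha> \<nu> \<rho> R \<delta>' ((B + 1) * W / weight_E \<beta> \<mu> m) d (\<lambda>\<tau>. v \<tau> m) (\<lambda>\<tau>. w \<tau> m)"
    if v: "v \<in> ExpU_space q k \<beta> \<mu> \<alpha> \<rho> \<delta> U" "ExpU_norm q k \<beta> \<mu> \<alpha> \<rho> \<delta> U v \<le> W"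
      and w: "w \<in> ExpS_space q k2 \<beta> \<mu> \<nu> S Rb" "ExpS_norm q k2 \<beta> \<mu> \<nu> S Rb w \<le> W"
      and vw: "\<forall>\<tau>\<in>Rb. \<forall>m. w \<tau> m = q_laplace q \<kappa> d (\<lambda>h. v h m) \<tau>" for v w W m
  proof -
    define X where "X = (B + 1) * W / weight_E \<beta> \<mu> m"
    have W: "W \<ge> 0" using bd[OF v] by blast
    have BX: "B * W / weight_E \<beta> \<mu> m \<le> X" "W / weight_E \<beta> \<mu> m \<le> X" "0 \<le> X"
      unfolding X_def using B W by (auto intro!: divide_right_mono mult_right_mono simp: less_imp_le mult_le_cancel_right1)
    have nv: "norm (v \<tau> m) \<le> X" if "\<tau> \<in> cball 0 \<rho>" for \<tau>
      using bd[OF v] BX(1) that by (meson order_trans)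
    have U: "of_real r * cis d \<in> U" if "r > 0" for r using halfline_in_sector[OF sec(1) that] .
    have S: "of_real r * cis d \<in> S" if "r > 0" for r using halfline_in_sector[OF sec(2) that] .
    show ?thesis unfolding laplace_pair_def X_def[symmetric]
    proof (intro conjI)
      have "(\<lambda>\<tau>. v \<tau> m) holomorphic_on (U \<union> ball 0 \<rho>)" using v by (auto simp: ExpU_space_def)
      then show "(\<lambda>\<tau>. v \<tau> m) holomorphic_on ball 0 \<rho>" by (rule holomorphic_on_subset) auto
      show "\<forall>\<tau>\<in>ball 0 \<rho>. norm (v \<tau> m) \<le> X" using nv by auto
      show "ray_bounded q \<kappa> \<alpha> 0 (\<rho> / 2) X (\<lambda>\<tau>. v \<tau> m) d"
        unfolding ray_bounded_def
      proof (intro conjI allI impI)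
        have "continuous_on ((U \<union> cball 0 \<rho>) \<times> UNIV) (\<lambda>(\<tau>, m). v \<tau> m)" using v by (auto simp: ExpU_space_def)
        then have "continuous_on {0<..} (\<lambda>r. case (of_real r * cis d, m) of (\<tau>, m) \<Rightarrow> v \<tau> m)"
          by (rule continuous_on_compose2) (use U in \<open>auto intro!: continuous_intros\<close>)
        then show "continuous_on {0<..} (\<lambda>r. v (of_real r * cis d) m)" by simp
      next
        fix r :: real assume "0 < r" "r \<le> \<rho> / 2"
        then show "norm (v (of_real r * cis d) m) \<le> X / r ^ 0" using nv[of "of_real r * cis d"] by (simp add: norm_mult)
      next
        fix r :: real assume r: "\<rho> / 2 \<le> r"
        then have r0: "r > 0" using \<rho> by simp
        have "norm (v (of_real r * cis d) m) \<le> B * W / weight_E \<beta> \<mu> m * q_growth q k \<alpha> r"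
          using bd[OF v, THEN conjunct2, THEN conjunct2, rule_format, OF U[OF r0], of m] r r0 by (simp add: norm_mult)
        also have "\<dots> \<le> X * q_growth q \<kappa> \<alpha> r"
          using BX by (intro mult_mono q_growth_mono q k) auto
        finally show "norm (v (of_real r * cis d) m) \<le> X * q_growth q \<kappa> \<alpha> r" .
      qed
      show "\<forall>\<tau>\<in>calR d \<delta>' \<inter> ball 0 R. w \<tau> m = q_laplace q \<kappa> d (\<lambda>\<tau>. v \<tau> m) \<tau>"
        using vw by (auto simp: Rb)
      have "(\<lambda>\<tau>. w \<tau> m) holomorphic_on (S \<union> Rb)" using w by (auto simp: ExpS_space_def)
      then show "(\<lambda>\<tau>. w \<tau> m) holomorphic_on (calR d \<delta>' \<inter> ball 0 R)" by (rule holomorphic_on_subset) (auto simp: Rb)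
      have "continuous_on (ExpS_dom S Rb \<times> UNIV) (\<lambda>(\<tau>, m). w \<tau> m)" using w by (auto simp: ExpS_space_def)
      then have "continuous_on {0<..} (\<lambda>r. case (of_real r * cis d, m) of (\<tau>, m) \<Rightarrow> w \<tau> m)"
        by (rule continuous_on_compose2) (use S in \<open>auto intro!: continuous_intros simp: ExpS_dom_def\<close>)
      then show "continuous_on {0<..} (\<lambda>r. w (of_real r * cis d) m)" by simp
      show "\<forall>r\<ge>R / 2. norm (w (of_real r * cis d) m) \<le> X * q_growth q k2 \<nu> r"
      proof (intro allI impI)
        fix r :: real assume "R / 2 \<le> r"
        then have r0: "r > 0" using R by simp
        then have "of_real r * cis d \<in> ExpS_dom S Rb" using S by (auto simp: ExpS_dom_def)
        from ExpS_bound(2)[OF w this, of m] r0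
        have "norm (w (of_real r * cis d) m) \<le> W / weight_E \<beta> \<mu> m * q_growth q k2 \<nu> r"
          by (simp add: norm_mult)
        also have "\<dots> \<le> X * q_growth q k2 \<nu> r" using BX by (intro mult_right_mono) auto
        finally show "norm (w (of_real r * cis d) m) \<le> X * q_growth q k2 \<nu> r" .
      qed
    qed
  qed
  moreover have "B + 1 > 0" using B by simp
  ultimately show ?thesis by blast
qed

lemma E_space_bound:
  assumes "h \<in> E_space \<beta> \<mu>" "E_norm \<beta> \<mu> h \<le> c"
  shows "continuous_on UNIV h" "0 \<le> c" "weight_E \<beta> \<mu> m * norm (h m) \<le> c"
proof -
  show "continuous_on UNIV h" using assms(1) by (simp add: E_space_def)
  have "weight_E \<beta> \<mu> m * norm (h m) \<le> E_norm \<beta> \<mu> h" for m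
    unfolding E_norm_def using assms(1) by (intro cSUP_upper) (auto simp: E_space_def)
  then have *: "weight_E \<beta> \<mu> m * norm (h m) \<le> c" for m using assms(2) order_trans by blast
  then show "weight_E \<beta> \<mu> m * norm (h m) \<le> c" .
  have "0 \<le> weight_E \<beta> \<mu> 0 * norm (h 0)" by (simp add: less_imp_le)
  then show "0 \<le> c" using * order_trans by blast
qed

section \<open>From pointwise estimates to flat differences\<close>

text \<open>With \<open>x = - log t\<close> and \<open>y = - log e\<close>, the inequality \<open>x \<ge> y > 0\<close> gives \<open>x\<^sup>2 - y\<^sup>2 \<ge> (x - y)\<^sup>2\<close>, and the
  Gaussian in \<open>x - y\<close> absorbs the power.\<close>

lemma gauss_power_mono:
  assumes q: "q > 1" and k: "k > 0" and T: "0 < t" "t \<le> e" "e < 1"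
  shows "gauss q k (ln t) * exp (M * ln t) \<le> exp (M\<^sup>2 * ln q / (2 * k)) * (gauss q k (ln e) * e powr (- \<bar>M\<bar>))"
proof -
  define a where "a = k / (2 * ln q)"
  have a: "a > 0" using q k by (simp add: a_def)
  define x y N where "x = - ln t" and "y = - ln e" and "N = \<bar>M\<bar>"
  have y: "y > 0" "y \<le> x" using T by (auto simp: x_def y_def)
  have "x\<^sup>2 - y\<^sup>2 = (x - y)\<^sup>2 + 2 * y * (x - y)" by (simp add: power2_eq_square algebra_simps)
  moreover have "2 * y * (x - y) \<ge> 0" using y by simp
  ultimately have "(x - y)\<^sup>2 \<le> x\<^sup>2 - y\<^sup>2" by linarith
  then have "a * (x - y)\<^sup>2 \<le> a * (x\<^sup>2 - y\<^sup>2)" using a by (intro mult_left_mono) auto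
  moreover have "N * (x - y) - a * (x - y)\<^sup>2 \<le> N\<^sup>2 / (4 * a)" by (rule quadratic_le[OF a])
  ultimately have "N * x - a * x\<^sup>2 \<le> N\<^sup>2 / (4 * a) + (N * y - a * y\<^sup>2)" by (simp add: algebra_simps)
  moreover have "M * ln t \<le> N * x" 
  proof -
    have "(- M) * x \<le> N * x" using y by (intro mult_right_mono) (auto simp: N_def)
    then show ?thesis by (simp add: x_def)
  qed
  ultimately have "exp (M * ln t - a * (ln t)\<^sup>2) \<le> exp (N\<^sup>2 / (4 * a) + (N * y - a * y\<^sup>2))"
    by (simp add: x_def)
  moreover have "gauss q k (ln t) * exp (M * ln t) = exp (M * ln t - a * (ln t)\<^sup>2)"
    unfolding gauss_def mult_exp_exp a_def by simp
  moreover have "N\<^sup>2 / (4 * a) = M\<^sup>2 * ln q / (2 * k)" using q k by (simp add: N_def a_def field_simps)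
  moreover have "gauss q k (ln e) * e powr (- \<bar>M\<bar>) = exp (N * y - a * y\<^sup>2)"
    using T unfolding gauss_def powr_def a_def y_def N_def by (simp add: mult_exp_exp)
  ultimately show ?thesis by (simp add: mult_exp_exp)
qed

lemma laplace_kernel_integral_measurable:
  fixes w :: "complex \<Rightarrow> real \<Rightarrow> complex"
  assumes q: "q > 1" and k: "k > 0" and \<delta>: "\<delta> > 0" and T: "T \<noteq> 0" and cl: "clear \<delta> T d"
    and w: "continuous_on (halfline d \<times> UNIV) (\<lambda>(\<tau>, m). w \<tau> m)"
  shows "(\<lambda>m. halfline_integral d (laplace_kernel q k T (\<lambda>\<tau>. w \<tau> m))) \<in> borel_measurable borel"
proof -
  obtain c where c: "c > 0" and th: "\<forall>x. x \<noteq> 0 \<longrightarrow> (\<forall>r\<ge>0. \<delta> < norm (1 + of_real r * x)) \<longrightarrow>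
       c * q_growth q k (1/2) (norm x) \<le> norm (Theta q k x)"
    using Theta_lower_bound[OF q k \<delta>] by blast
  define g where "g = (\<lambda>(m, r). laplace_kernel q k T (\<lambda>\<tau>. w \<tau> m) (of_real r * cis d) * cis d)"
  have 1: "continuous_on (UNIV \<times> {0<..}) (\<lambda>x. w (of_real (snd x) * cis d) (fst x))"
  proof -
    have "continuous_on (UNIV \<times> {0<..}) (\<lambda>x. case (of_real (snd x) * cis d, fst x) of (\<tau>, m) \<Rightarrow> w \<tau> m)"
      by (rule continuous_on_compose2[OF w]) (auto intro!: continuous_intros simp: halfline_def)
    then show ?thesis by simp
  qed
  have 2: "continuous_on (UNIV \<times> {0<..} :: (real \<times> real) set) (\<lambda>x. Theta q k (of_real (snd x) * cis d / T))"
    by (rule continuous_on_compose2[OF Theta_continuous[OF q k, of "- {0}"]])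
       (use T in \<open>auto intro!: continuous_intros\<close>)
  have "continuous_on (UNIV \<times> {0<..}) g"
    unfolding g_def laplace_kernel_def split_def using theta_ray_nonzero[OF q k c th T cl]
    by (intro continuous_intros 1 2) auto
  then have "(\<lambda>x. indicat_real (UNIV \<times> {0<..}) x *\<^sub>R g x) \<in> borel_measurable borel"
    by (intro borel_measurable_continuous_on_indicator borel_open open_Times open_UNIV open_greaterThan)
  then have "(\<lambda>x. indicat_real (UNIV \<times> {0<..}) x *\<^sub>R g x) \<in> borel_measurable (borel \<Otimes>\<^sub>M lborel)"
    by (subst measurable_cong_sets[of _ borel _ borel]) (auto simp: borel_prod[symmetric] intro!: sets_pair_measure_cong)
  moreover have "(\<lambda>x. indicat_real (UNIV \<times> {0<..}) x *\<^sub>R g x) = (\<lambda>(m, r). indicat_real {0<..} r *\<^sub>R g (m, r))"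
    by (auto simp: fun_eq_iff indicator_def)
  ultimately have "(\<lambda>m. LINT r|lborel. indicat_real {0<..} r *\<^sub>R g (m, r)) \<in> borel_measurable borel"
    by (intro lborel.borel_measurable_lebesgue_integral) simp
  then show ?thesis
    unfolding halfline_integral_def set_lebesgue_integral_def g_def by (simp only: prod.case)
qed

text \<open>The decay of order \<open>\<beta>\<close> in \<open>m\<close> exceeds the growth of order \<open>\<beta>'\<close> of the exponential on the strip. The bounds by
  \<open>Y\<close> only serve to make the two integrals converge, so that they may be subtracted.\<close>

lemma fourier_difference_le:
  fixes Ja Jb :: "real \<Rightarrow> complex"
  assumes \<beta>: "\<beta>' < \<beta>" and \<mu>: "\<mu> \<ge> 0" and z: "z \<in> strip \<beta>'"
    and meas: "Ja \<in> borel_measurable borel" "Jb \<in> borel_measurable borel"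
    and bd: "\<And>m. norm (Ja m) \<le> Y / weight_E \<beta> \<mu> m" "\<And>m. norm (Jb m) \<le> Y / weight_E \<beta> \<mu> m"
    and diff: "\<And>m. norm (Jb m - Ja m) \<le> X / weight_E \<beta> \<mu> m"
  shows "norm ((LINT m|lborel. Jb m * exp (\<i> * z * of_real m)) - (LINT m|lborel. Ja m * exp (\<i> * z * of_real m)))
    \<le> X * (LINT m|lborel. exp (- (\<beta> - \<beta>') * \<bar>m\<bar>))"
proof -
  let ?e = "\<lambda>m. exp (- (\<beta> - \<beta>') * \<bar>m\<bar>)"
  have ie: "integrable lborel ?e" using \<beta> by (intro integrable_exp_abs) auto
  have le: "norm (j * exp (\<i> * z * of_real m)) \<le> A * ?e m" if j: "norm j \<le> A / weight_E \<beta> \<mu> m" for j A m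
  proof -
    have A: "A \<ge> 0" using j norm_ge_zero[of j] order_trans weight_E_pos[of \<beta> \<mu> m]
      by (metis divide_nonneg_pos divide_neg_pos not_less)
    have "\<bar>Im z * m\<bar> \<le> \<beta>' * \<bar>m\<bar>" using z by (auto simp: strip_def abs_mult intro!: mult_right_mono)
    then have 1: "norm (exp (\<i> * z * of_real m)) \<le> exp (\<beta>' * \<bar>m\<bar>)" by (simp add: norm_exp_eq_Re)
    have "norm j \<le> A * (1 / weight_E \<beta> \<mu> m)" using j by simp
    also have "\<dots> \<le> A * exp (- \<beta> * \<bar>m\<bar>)" by (intro mult_left_mono inverse_weight_E_le \<mu> A)
    finally have "norm (j * exp (\<i> * z * of_real m)) \<le> A * exp (- \<beta> * \<bar>m\<bar>) * exp (\<beta>' * \<bar>m\<bar>)"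
      unfolding norm_mult using 1 A by (intro mult_mono) auto
    also have "\<dots> = A * ?e m" by (simp add: mult.assoc mult_exp_exp algebra_simps)
    finally show ?thesis .
  qed
  have int: "integrable lborel (\<lambda>m. J m * exp (\<i> * z * of_real m))"
    if "J \<in> borel_measurable borel" "\<And>m. norm (J m) \<le> Y / weight_E \<beta> \<mu> m" for J
  proof (rule Bochner_Integration.integrable_bound)
    show "integrable lborel (\<lambda>m. Y * ?e m)" by (rule integrable_mult_right[OF ie])
    show "(\<lambda>m. J m * exp (\<i> * z * of_real m)) \<in> borel_measurable lborel"
      using that(1) by (intro borel_measurable_times) (auto intro!: borel_measurable_continuous_onI continuous_intros)
    show "AE m in lborel. norm (J m * exp (\<i> * z * of_real m)) \<le> norm (Y * ?e m)"
      using le[OF that(2)] by (intro AE_I2) (metis abs_ge_self order_trans real_norm_def)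
  qed
  note ia = int[OF meas(1) bd(1)] and ib = int[OF meas(2) bd(2)]
  have "norm ((LINT m|lborel. Jb m * exp (\<i> * z * of_real m)) - (LINT m|lborel. Ja m * exp (\<i> * z * of_real m)))
     = norm (LINT m|lborel. (Jb m - Ja m) * exp (\<i> * z * of_real m))"
    by (subst Bochner_Integration.integral_diff[OF ib ia, symmetric]) (simp add: left_diff_distrib)
  also have "\<dots> \<le> (LINT m|lborel. norm ((Jb m - Ja m) * exp (\<i> * z * of_real m)))" by (rule integral_norm_bound)
  also have "\<dots> \<le> (LINT m|lborel. X * ?e m)"
  proof (rule integral_mono)
    show "integrable lborel (\<lambda>m. norm ((Jb m - Ja m) * exp (\<i> * z * of_real m)))"
      using Bochner_Integration.integrable_diff[OF ib ia] by (intro integrable_norm) (simp add: left_diff_distrib)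
  qed (use le[OF diff] integrable_mult_right[OF ie] in auto)
  finally show ?thesis by simp
qed

text \<open>The constants of the estimate at fixed \<open>m\<close> and \<open>\<epsilon>\<close> do not depend on either of them, which permits
  integration over \<open>m\<close> and makes the result uniform in \<open>\<epsilon>\<close>.\<close>

lemma flat_difference:
  fixes q \<kappa> k1 k2 \<alpha> \<nu> \<rho> R \<delta> :: real and v1 v2 w1 w2 :: "complex \<Rightarrow> real \<Rightarrow> complex \<Rightarrow> complex"
    and g1 g2 :: "complex \<Rightarrow> complex \<Rightarrow> complex \<Rightarrow> complex"
  assumes q: "q > 1" and \<kappa>: "\<kappa> > 0" and k2: "k2 > 0" and k1: "k1 = \<kappa> * k2 / (\<kappa> + k2)"
    and \<delta>: "\<delta> > 0" and \<rho>: "\<rho> > 0" and R: "0 < R" "R \<le> 1"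
    and \<alpha>: "\<alpha> + \<kappa> / ln q * ln R \<le> 0" and \<nu>: "\<nu> + k2 / ln q * ln R \<le> 0"
    and \<beta>: "\<beta>' < \<beta>" and \<mu>: "\<mu> \<ge> 0" and A: "A \<ge> 0"
    and pair: "\<And>\<epsilon> m. \<epsilon> \<in> X \<Longrightarrow> laplace_pair q \<kappa> k2 \<alpha> \<nu> \<rho> R \<delta> (A / weight_E \<beta> \<mu> m) d1 (\<lambda>\<tau>. v1 \<tau> m \<epsilon>) (\<lambda>\<tau>. w1 \<tau> m \<epsilon>)"
      "\<And>\<epsilon> m. \<epsilon> \<in> X \<Longrightarrow> laplace_pair q \<kappa> k2 \<alpha> \<nu> \<rho> R \<delta> (A / weight_E \<beta> \<mu> m) d2 (\<lambda>\<tau>. v2 \<tau> m \<epsilon>) (\<lambda>\<tau>. w2 \<tau> m \<epsilon>)"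
    and agree: "\<And>\<epsilon> \<tau> m. \<epsilon> \<in> X \<Longrightarrow> \<tau> \<in> ball 0 \<rho> \<Longrightarrow> v1 \<tau> m \<epsilon> = v2 \<tau> m \<epsilon>"
    and cont: "\<And>\<epsilon>. \<epsilon> \<in> X \<Longrightarrow> continuous_on (halfline d1 \<times> UNIV) (\<lambda>(\<tau>, m). w1 \<tau> m \<epsilon>)"
      "\<And>\<epsilon>. \<epsilon> \<in> X \<Longrightarrow> continuous_on (halfline d2 \<times> UNIV) (\<lambda>(\<tau>, m). w2 \<tau> m \<epsilon>)"
    and T: "\<And>t \<epsilon>. t \<in> \<T> \<Longrightarrow> \<epsilon> \<in> X \<Longrightarrow> \<epsilon> * t \<in> calR d1 \<delta> \<inter> calR d2 \<delta> \<inter> ball 0 R"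
      "\<And>t. t \<in> \<T> \<Longrightarrow> norm t \<le> 1" "\<And>\<epsilon>. \<epsilon> \<in> X \<Longrightarrow> norm \<epsilon> < 1"
    and g: "\<And>t z \<epsilon>. t \<in> \<T> \<Longrightarrow> z \<in> strip \<beta>' \<Longrightarrow> \<epsilon> \<in> X \<Longrightarrow> g1 t z \<epsilon> =
        c0 * (LINT m|lborel. halfline_integral d1 (laplace_kernel q k2 (\<epsilon> * t) (\<lambda>\<tau>. w1 \<tau> m \<epsilon>)) * exp (\<i> * z * of_real m))"
      "\<And>t z \<epsilon>. t \<in> \<T> \<Longrightarrow> z \<in> strip \<beta>' \<Longrightarrow> \<epsilon> \<in> X \<Longrightarrow> g2 t z \<epsilon> =
        c0 * (LINT m|lborel. halfline_integral d2 (laplace_kernel q k2 (\<epsilon> * t) (\<lambda>\<tau>. w2 \<tau> m \<epsilon>)) * exp (\<i> * z * of_real m))"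
  shows "\<exists>K>0. \<exists>N. \<forall>t\<in>\<T>. \<forall>z\<in>strip \<beta>'. \<forall>\<epsilon>\<in>X.
     norm (g2 t z \<epsilon> - g1 t z \<epsilon>) \<le> K * gauss q k1 (ln (norm \<epsilon>)) * norm \<epsilon> powr N"
proof -
  obtain K M where K: "K > 0" and df: "\<And>A d1 d2 v1 v2 w1 w2 T. 0 \<le> A \<Longrightarrow>
     laplace_pair q \<kappa> k2 \<alpha> \<nu> \<rho> R \<delta> A d1 v1 w1 \<Longrightarrow> laplace_pair q \<kappa> k2 \<alpha> \<nu> \<rho> R \<delta> A d2 v2 w2 \<Longrightarrow>
     (\<forall>u\<in>ball 0 \<rho>. v1 u = v2 u) \<Longrightarrow> T \<in> calR d1 \<delta> \<inter> calR d2 \<delta> \<inter> ball 0 R \<Longrightarrow>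
     norm (halfline_integral d2 (laplace_kernel q k2 T w2) - halfline_integral d1 (laplace_kernel q k2 T w1))
       \<le> K * A * (gauss q k1 (ln (norm T)) * exp (M * ln (norm T)))"
    using outer_laplace_difference[OF q \<kappa> k2 k1 \<delta> \<rho> R \<alpha> \<nu>] by blast
  have k1p: "k1 > 0" unfolding k1 using \<kappa> k2 by simp
  define J where "J = (LINT m|lborel. exp (- (\<beta> - \<beta>') * \<bar>m\<bar>))"
  have J: "J \<ge> 0" by (simp add: J_def)
  define E where "E = exp (M\<^sup>2 * ln q / (2 * k1))"
  define K' where "K' = norm c0 * (K * A * J * E) + 1"
  have K': "K' > 0" using K A J by (simp add: K'_def E_def add_nonneg_pos)
  have "norm (g2 t z \<epsilon> - g1 t z \<epsilon>) \<le> K' * gauss q k1 (ln (norm \<epsilon>)) * norm \<epsilon> powr (- \<bar>M\<bar>)"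
    if t: "t \<in> \<T>" and z: "z \<in> strip \<beta>'" and \<epsilon>: "\<epsilon> \<in> X" for t z \<epsilon>
  proof -
    let ?T = "\<epsilon> * t"
    note TT = T(1)[OF t \<epsilon>]
    have T0: "?T \<noteq> 0" and cl: "clear \<delta> ?T d1" "clear \<delta> ?T d2" using TT by (auto simp: calR_iff_clear)
    define J1 where "J1 m = halfline_integral d1 (laplace_kernel q k2 ?T (\<lambda>\<tau>. w1 \<tau> m \<epsilon>))" for m
    define J2 where "J2 m = halfline_integral d2 (laplace_kernel q k2 ?T (\<lambda>\<tau>. w2 \<tau> m \<epsilon>))" for m
    define G where "G = gauss q k1 (ln (norm ?T)) * exp (M * ln (norm ?T))"
    have Am: "A / weight_E \<beta> \<mu> m \<ge> 0" for m using A by (simp add: less_imp_le)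
    obtain Kb where Kb: "\<And>A d v w. 0 \<le> A \<Longrightarrow> laplace_pair q \<kappa> k2 \<alpha> \<nu> \<rho> R \<delta> A d v w \<Longrightarrow>
       ?T \<in> calR d \<delta> \<inter> ball 0 R \<Longrightarrow> norm (halfline_integral d (laplace_kernel q k2 ?T w)) \<le> Kb * A"
      using outer_laplace_bound[OF q \<kappa> k2 k1 \<delta> \<rho> R \<alpha> \<nu>, of ?T] by blast
    have "norm ((LINT m|lborel. J2 m * exp (\<i> * z * of_real m)) - (LINT m|lborel. J1 m * exp (\<i> * z * of_real m)))
        \<le> (K * A * G) * J"
      unfolding J_def
    proof (rule fourier_difference_le[OF \<beta> \<mu> z])
      show "J1 \<in> borel_measurable borel" unfolding J1_def
        by (rule laplace_kernel_integral_measurable[OF q k2 \<delta> T0 cl(1) cont(1)[OF \<epsilon>]])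
      show "J2 \<in> borel_measurable borel" unfolding J2_def
        by (rule laplace_kernel_integral_measurable[OF q k2 \<delta> T0 cl(2) cont(2)[OF \<epsilon>]])
      show "norm (J1 m) \<le> (Kb * A) / weight_E \<beta> \<mu> m" for m
        using Kb[OF Am pair(1)[OF \<epsilon>], of m] TT by (simp add: J1_def)
      show "norm (J2 m) \<le> (Kb * A) / weight_E \<beta> \<mu> m" for m
        using Kb[OF Am pair(2)[OF \<epsilon>], of m] TT by (simp add: J2_def)
      show "norm (J2 m - J1 m) \<le> (K * A * G) / weight_E \<beta> \<mu> m" for m
        using df[OF Am pair(1)[OF \<epsilon>] pair(2)[OF \<epsilon>] _ TT, of m] agree[OF \<epsilon>]
        by (simp add: J1_def J2_def G_def mult_ac)
    qed
    then have 1: "norm (g2 t z \<epsilon> - g1 t z \<epsilon>) \<le> norm c0 * ((K * A * G) * J)"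
      unfolding g(1)[OF t z \<epsilon>] g(2)[OF t z \<epsilon>] right_diff_distrib[symmetric] norm_mult
      by (intro mult_left_mono) (auto simp: J1_def J2_def)
    have "norm ?T \<le> norm \<epsilon>" using T(2)[OF t] by (simp add: norm_mult mult_left_le)
    then have "G \<le> E * (gauss q k1 (ln (norm \<epsilon>)) * norm \<epsilon> powr (- \<bar>M\<bar>))"
      unfolding G_def E_def using T0 T(3)[OF \<epsilon>] by (intro gauss_power_mono[OF q k1p]) auto
    then have "norm c0 * ((K * A * G) * J) \<le> norm c0 * ((K * A * (E * (gauss q k1 (ln (norm \<epsilon>)) * norm \<epsilon> powr (- \<bar>M\<bar>)))) * J)"
      using K A J by (intro mult_left_mono mult_right_mono) auto
    also have "\<dots> \<le> K' * (gauss q k1 (ln (norm \<epsilon>)) * norm \<epsilon> powr (- \<bar>M\<bar>))"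
      by (simp add: K'_def algebra_simps)
    finally show ?thesis using 1 by simp
  qed
  then show ?thesis using K' by blast
qed

section \<open>The difference of neighbouring solutions\<close>

theorem proposition14:
  fixes q \<kappa> \<beta> \<beta>' \<mu> \<alpha> \<nu> \<rho> \<delta> \<delta>' \<epsilon>0 rT rQ \<eta>Q dQ CF \<zeta> \<omega> :: real
    and k1 k2 D dD N p0 :: nat
    and I :: "nat \<Rightarrow> nat set"
    and d \<Delta> :: "nat \<Rightarrow> nat \<Rightarrow> nat"
    and dl :: "nat \<Rightarrow> nat"
    and Q :: "complex poly" and R :: "nat \<Rightarrow> complex poly"
    and C :: "nat \<Rightarrow> nat \<Rightarrow> real \<Rightarrow> complex \<Rightarrow> complex" and Cbound :: "nat \<Rightarrow> nat \<Rightarrow> real"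
    and F :: "nat \<Rightarrow> real \<Rightarrow> complex \<Rightarrow> complex"
    and E U S Rb :: "nat \<Rightarrow> complex set" and \<T> :: "complex set"
    and dir :: "nat \<Rightarrow> real"
    and ql :: "nat \<Rightarrow> real \<Rightarrow> complex"
    and \<psi>1 \<psi>2 w1 w2 :: "nat \<Rightarrow> complex \<Rightarrow> real \<Rightarrow> complex \<Rightarrow> complex"
    and \<gamma> :: "nat \<Rightarrow> complex \<Rightarrow> real"
    and u f :: "nat \<Rightarrow> complex \<Rightarrow> complex \<Rightarrow> complex \<Rightarrow> complex"
  \<comment> \<open>parameters and coefficients\<close>
  assumes q: "q > 1"
    and k: "1 \<le> k1" "k1 < k2" "1 / \<kappa> = 1 / real k1 - 1 / real k2"
    and D: "D \<ge> 3" "dD \<ge> 1"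
    and I: "\<And>l. l \<in> {1..D - 1} \<Longrightarrow> finite (I l) \<and> I l \<noteq> {}"
    and dl: "dl 1 = 1" "\<And>l. l \<in> {1..D - 1} \<Longrightarrow> dl l \<ge> 1" "\<And>l. l \<in> {1..D - 2} \<Longrightarrow> dl l < dl (l + 1)"
    and d: "\<And>l j. l \<in> {1..D - 1} \<Longrightarrow> j \<in> I l \<Longrightarrow>
              d j l \<ge> 1 \<and> \<Delta> j l \<ge> d j l \<and> real (d j l) / real k2 + 1 \<ge> real (dl l)"
    and dD: "\<And>l. l \<in> {1..D - 1} \<Longrightarrow> (real dD - 1) / real k2 + 1 \<ge> real (dl l)"
    and deg: "degree Q \<ge> degree (R D)" "\<And>l. l \<in> {1..D - 1} \<Longrightarrow> degree (R D) \<ge> degree (R l)"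
    and nz: "\<And>m. poly Q (\<i> * of_real m) \<noteq> 0" "\<And>m. poly (R D) (\<i> * of_real m) \<noteq> 0"
    and SQ: "rQ > 0" "\<eta>Q > 0"
      "\<And>m. poly Q (\<i> * of_real m) / poly (R D) (\<i> * of_real m) \<in> closed_trunc_sector rQ dQ \<eta>Q"
    and \<beta>: "0 < \<beta>'" "\<beta>' < \<beta>"
    and \<mu>: "\<mu> > real (degree (R D)) + 1"
    and \<rho>: "\<rho> > 0"
    and C: "\<And>l j \<epsilon>. l \<in> {1..D - 1} \<Longrightarrow> j \<in> I l \<Longrightarrow> \<epsilon> \<in> ball 0 \<epsilon>0 \<Longrightarrow>
              (\<lambda>m. C j l m \<epsilon>) \<in> E_space \<beta> \<mu> \<and> E_norm \<beta> \<mu> (\<lambda>m. C j l m \<epsilon>) \<le> Cbound j l"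
      "\<And>l j m. l \<in> {1..D - 1} \<Longrightarrow> j \<in> I l \<Longrightarrow> (\<lambda>\<epsilon>. C j l m \<epsilon>) holomorphic_on ball 0 \<epsilon>0"
    and F: "\<And>n \<epsilon>. \<epsilon> \<in> ball 0 \<epsilon>0 \<Longrightarrow> (\<lambda>m. F n m \<epsilon>) \<in> E_space \<beta> \<mu> \<and>
              E_norm \<beta> \<mu> (\<lambda>m. F n m \<epsilon>)
                \<le> CF * \<rho> powr (- real n) * q powr (real n * (real n - 1) / (2 * real k1))"
      "\<And>n m. (\<lambda>\<epsilon>. F n m \<epsilon>) holomorphic_on ball 0 \<epsilon>0"
  \<comment> \<open>good covering and associated family\<close>
    and cov: "N \<ge> 2" "good_covering N \<epsilon>0 E"
    and US: "\<And>p. p < N \<Longrightarrow> unbounded_sector (dir p) (U p)"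
      "\<And>p. p < N \<Longrightarrow> unbounded_sector (dir p) (S p)"
    and \<delta>: "\<delta> > 0" "\<And>p. p < N \<Longrightarrow> infdist (- of_real \<delta>) (U p \<union> ball 0 \<rho>) > 0"
    and \<delta>': "\<delta>' > 0"
    and \<T>: "rT > 0" "bounded_sector rT \<T>"
    and Rb: "\<And>p. p < N \<Longrightarrow> Rb p = calR (dir p) \<delta>' \<inter> ball 0 (\<epsilon>0 * rT)"
      "\<And>p. p < N \<Longrightarrow> Rb p \<subseteq> cball 0 \<rho>"
      "\<And>p. p < N \<Longrightarrow> S p \<subseteq> calR (dir p) \<delta>'"
    and small: "0 < \<epsilon>0" "\<epsilon>0 < 1" "rT < 1"
      "\<nu> + real k2 / ln q * ln rT < 0"
      "\<alpha> + \<kappa> / ln q * ln (\<epsilon>0 * rT) < 0"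
      "\<epsilon>0 * rT \<le> q powr ((1 / 2 - \<nu>) / real k2) / 2"
    and roots: "\<And>m. bij_betw (\<lambda>l. ql l m) {..<dD}
        {\<tau>. poly Q (\<i> * of_real m) / of_real (cq q k2 k2)
              - poly (R D) (\<i> * of_real m) / of_real (cq q k2 (dD + k2)) * \<tau> ^ dD = 0}"
      "\<exists>M1>0. \<forall>l<dD. \<forall>m. \<forall>p<N. \<forall>\<tau>\<in>S p \<union> cball 0 \<rho>. norm (\<tau> - ql l m) \<ge> M1 * (1 + norm \<tau>)"
      "\<exists>M2>0. \<exists>l0<dD. \<forall>m. \<forall>p<N. \<forall>\<tau>\<in>S p \<union> cball 0 \<rho>. norm (\<tau> - ql l0 m) \<ge> M2 * norm (ql l0 m)"
    and assoc: "\<And>p. p < N \<Longrightarrow> Rb p \<inter> Rb (Suc p mod N) \<noteq> {}"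
      "\<And>p t \<epsilon>. p < N \<Longrightarrow> t \<in> \<T> \<Longrightarrow> \<epsilon> \<in> E p \<Longrightarrow> \<epsilon> * t \<in> Rb p"
  \<comment> \<open>forcing term\<close>
    and \<alpha>: "\<alpha> > 0"
    and \<psi>1: "\<And>p \<tau> m \<epsilon>. p < N \<Longrightarrow> \<epsilon> \<in> ball 0 \<epsilon>0 \<Longrightarrow> \<tau> \<in> ball 0 \<rho> \<Longrightarrow>
               (\<lambda>n. F n m \<epsilon> * \<tau> ^ n / of_real (cq q k1 n)) sums \<psi>1 p \<tau> m \<epsilon>"
      "\<And>p \<epsilon>. p < N \<Longrightarrow> \<epsilon> \<in> ball 0 \<epsilon>0 \<Longrightarrow>
         (\<lambda>\<tau> m. \<psi>1 p \<tau> m \<epsilon>) \<in> ExpU_space q k1 \<beta> \<mu> \<alpha> \<rho> \<delta> (U p) \<and>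
         ExpU_norm q k1 \<beta> \<mu> \<alpha> \<rho> \<delta> (U p) (\<lambda>\<tau> m. \<psi>1 p \<tau> m \<epsilon>) \<le> \<zeta>"
    and \<psi>2: "\<And>p \<tau> m \<epsilon>. p < N \<Longrightarrow> \<epsilon> \<in> ball 0 \<epsilon>0 \<Longrightarrow> \<tau> \<in> ExpS_dom (S p) (Rb p) \<Longrightarrow>
               \<psi>2 p \<tau> m \<epsilon> = q_laplace q \<kappa> (dir p) (\<lambda>h. \<psi>1 p h m \<epsilon>) \<tau>"
      "\<And>p. p < N \<Longrightarrow> \<exists>Z. \<forall>\<epsilon>\<in>ball 0 \<epsilon>0.
         (\<lambda>\<tau> m. \<psi>2 p \<tau> m \<epsilon>) \<in> ExpS_space q k2 \<beta> \<mu> \<nu> (S p) (Rb p) \<and>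
         ExpS_norm q k2 \<beta> \<mu> \<nu> (S p) (Rb p) (\<lambda>\<tau> m. \<psi>2 p \<tau> m \<epsilon>) \<le> Z"
    and f: "\<And>p t z \<epsilon>. p < N \<Longrightarrow> t \<in> \<T> \<Longrightarrow> z \<in> strip \<beta>' \<Longrightarrow> \<epsilon> \<in> E p \<Longrightarrow>
               f p t z \<epsilon> =
                 inv_fourier (\<lambda>m. q_laplace q k2 (dir p) (\<lambda>\<tau>. \<psi>2 p \<tau> m \<epsilon>) (\<epsilon> * t)) z"
  \<comment> \<open>construction of the solutions\<close>
    and \<omega>: "\<omega> > 0"
    and w1: "\<And>p \<epsilon>. p < N \<Longrightarrow> \<epsilon> \<in> ball 0 \<epsilon>0 \<Longrightarrow>
        unique_solution_in
          {h \<in> ExpU_space q \<kappa> \<beta> \<mu> \<alpha> \<rho> \<delta> (U p). ExpU_norm q \<kappa> \<beta> \<mu> \<alpha> \<rho> \<delta> (U p) h \<le> \<omega>}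
          (U p \<union> cball 0 \<rho>)
          (borel_equation q k1 (- real dD / \<kappa>) D dD I d \<Delta> dl Q R C \<epsilon> (\<lambda>\<tau> m. \<psi>1 p \<tau> m \<epsilon>)
             (U p \<union> cball 0 \<rho>))
          (\<lambda>\<tau> m. w1 p \<tau> m \<epsilon>)"
    and w2: "\<And>p \<epsilon>. p < N \<Longrightarrow> \<epsilon> \<in> ball 0 \<epsilon>0 \<Longrightarrow>
        unique_solution_in
          (ExpS_space q k2 \<beta> \<mu> \<nu> (S p) (Rb p))
          (ExpS_dom (S p) (Rb p))
          (borel_equation q k2 0 D dD I d \<Delta> dl Q R C \<epsilon> (\<lambda>\<tau> m. \<psi>2 p \<tau> m \<epsilon>)
             (ExpS_dom (S p) (Rb p)))
          (\<lambda>\<tau> m. w2 p \<tau> m \<epsilon>)"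
      "\<And>p \<epsilon>. p < N \<Longrightarrow> \<epsilon> \<in> ball 0 \<epsilon>0 \<Longrightarrow>
         ExpS_norm q k2 \<beta> \<mu> \<nu> (S p) (Rb p) (\<lambda>\<tau> m. w2 p \<tau> m \<epsilon>) \<le> \<omega>"
    and hol: "\<And>p \<tau> m. p < N \<Longrightarrow> \<tau> \<in> U p \<union> cball 0 \<rho> \<Longrightarrow>
         (\<lambda>\<epsilon>. w1 p \<tau> m \<epsilon>) holomorphic_on ball 0 \<epsilon>0"
      "\<And>p \<tau> m. p < N \<Longrightarrow> \<tau> \<in> ExpS_dom (S p) (Rb p) \<Longrightarrow>
         (\<lambda>\<epsilon>. w2 p \<tau> m \<epsilon>) holomorphic_on ball 0 \<epsilon>0"
    and cont: "\<And>p \<tau> m \<epsilon>. p < N \<Longrightarrow> \<epsilon> \<in> ball 0 \<epsilon>0 \<Longrightarrow> \<tau> \<in> Rb p \<Longrightarrow>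
         w2 p \<tau> m \<epsilon> = q_laplace q \<kappa> (dir p) (\<lambda>h. w1 p h m \<epsilon>) \<tau>"
    and \<gamma>: "\<And>p t \<epsilon>. p < N \<Longrightarrow> t \<in> \<T> \<Longrightarrow> \<epsilon> \<in> E p \<Longrightarrow>
         admissible_direction (dir p) (S p) (\<epsilon> * t) (\<gamma> p (\<epsilon> * t))"
    and u: "\<And>p t z \<epsilon>. p < N \<Longrightarrow> t \<in> \<T> \<Longrightarrow> z \<in> strip \<beta>' \<Longrightarrow> \<epsilon> \<in> E p \<Longrightarrow>
         u p t z \<epsilon> =
           1 / of_real (sqrt (2 * pi)) * (1 / of_real (pi_q q k2)) *
           (LINT m|lborel.
              halfline_integral (\<gamma> p (\<epsilon> * t)) (\<lambda>x. w2 p x m \<epsilon> / Theta q k2 (x / (\<epsilon> * t)) / x)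
              * exp (\<i> * z * of_real m))"
  \<comment> \<open>the proposition\<close>
    and p0: "p0 < N" "U p0 \<inter> U (Suc p0 mod N) = {}"
  shows "\<exists>K3>0. \<exists>K4::real.
           \<forall>t\<in>\<T>. \<forall>z\<in>strip \<beta>'. \<forall>\<epsilon>\<in>E p0 \<inter> E (Suc p0 mod N).
             norm (u (Suc p0 mod N) t z \<epsilon> - u p0 t z \<epsilon>)
               \<le> K3 * exp (- (real k1 / (2 * ln q)) * (ln (norm \<epsilon>))\<^sup>2) * norm \<epsilon> powr K4 \<and>
             norm (f (Suc p0 mod N) t z \<epsilon> - f p0 t z \<epsilon>)
               \<le> K3 * exp (- (real k1 / (2 * ln q)) * (ln (norm \<epsilon>))\<^sup>2) * norm \<epsilon> powr K4"
proof -
  define p1 where "p1 = Suc p0 mod N"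
  define R0 where "R0 = \<epsilon>0 * rT"
  define X where "X = E p0 \<inter> E p1"
  have p1: "p1 < N" using cov(1) by (simp add: p1_def)
  have ln_q_pos: "ln q > 0" using q by simp
  have kk: "real k1 > 0" "real k2 > 0" using k(1,2) by auto
  have "1 / \<kappa> > 0" unfolding k(3) using k(1,2) by (simp add: frac_less2)
  then have \<kappa>: "\<kappa> > 0" by simp
  have k1_eq: "real k1 = \<kappa> * real k2 / (\<kappa> + real k2)"
  proof -
    have "1 / real k1 = 1 / \<kappa> + 1 / real k2" using k(3) by simp
    also have "\<dots> = (\<kappa> + real k2) / (\<kappa> * real k2)" using \<kappa> kk by (simp add: field_simps)
    finally have "1 / (1 / real k1) = 1 / ((\<kappa> + real k2) / (\<kappa> * real k2))" by simp
    then show ?thesis by simp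
  qed
  have k1\<kappa>: "real k1 \<le> \<kappa>"
    unfolding k1_eq using \<kappa> kk(2) by (simp add: divide_le_eq algebra_simps)
  have R0: "R0 > 0" "R0 \<le> 1" using small(1-3) \<T>(1) by (auto simp: R0_def mult_le_one)
  have \<alpha>R: "\<alpha> + \<kappa> / ln q * ln R0 \<le> 0" using small(5) by (simp add: R0_def)
  have \<nu>R: "\<nu> + real k2 / ln q * ln R0 \<le> 0"
  proof -
    have "R0 \<le> rT" using small(1,2) \<T>(1) by (simp add: R0_def mult_left_le_one_le)
    then have "ln R0 \<le> ln rT" using R0(1) \<T>(1) by simp
    then have "real k2 / ln q * ln R0 \<le> real k2 / ln q * ln rT" using kk ln_q_pos by (intro mult_left_mono) auto
    then show ?thesis using small(4) by linarith
  qed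
  have \<mu>0: "\<mu> \<ge> 0" using \<mu> by linarith
  have E_ball: "\<epsilon> \<in> ball 0 \<epsilon>0" "\<epsilon> \<noteq> 0" if "p < N" "\<epsilon> \<in> E p" for p \<epsilon>
  proof -
    have "bounded_sector \<epsilon>0 (E p)" using cov(2) that(1) by (auto simp: good_covering_def)
    then show "\<epsilon> \<in> ball 0 \<epsilon>0" "\<epsilon> \<noteq> 0"
      using that(2) by (auto simp: bounded_sector_def sector_def)
  qed
  have \<T>1: "norm t \<le> 1" if "t \<in> \<T>" for t
    using that \<T>(2) small(3) by (auto simp: bounded_sector_def)
  have X_ball: "\<epsilon> \<in> ball 0 \<epsilon>0" "norm \<epsilon> < 1" if "\<epsilon> \<in> X" for \<epsilon>
  proof -
    have "\<epsilon> \<in> E p0" using that by (simp add: X_def)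
    from E_ball(1)[OF p0(1) this] small(2) show "\<epsilon> \<in> ball 0 \<epsilon>0" "norm \<epsilon> < 1" by auto
  qed
  have XT: "\<epsilon> * t \<in> calR (dir p0) \<delta>' \<inter> calR (dir p1) \<delta>' \<inter> ball 0 R0" if "t \<in> \<T>" "\<epsilon> \<in> X" for t \<epsilon>
    using assoc(2)[OF p0(1) that(1)] assoc(2)[OF p1 that(1)] that(2) Rb(1)[OF p0(1)] Rb(1)[OF p1]
    by (auto simp: X_def R0_def)
  have Rb': "Rb p = calR (dir p) \<delta>' \<inter> ball 0 R0" if "p < N" for p using Rb(1)[OF that] by (simp add: R0_def)
  have halfS: "halfline (dir p) \<subseteq> ExpS_dom (S p) (Rb p)" if "p < N" for p
    using halfline_in_sector[OF US(2)[OF that]] by (auto simp: halfline_def ExpS_dom_def)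
  have Rb_dom: "Rb p \<subseteq> ExpS_dom (S p) (Rb p)" if "p < N" for p
    using closure_subset[of "Rb p"] by (auto simp: ExpS_dom_def Rb'[OF that] calR_def)
  have w1E: "(\<lambda>\<tau> m. w1 p \<tau> m \<epsilon>) \<in> ExpU_space q \<kappa> \<beta> \<mu> \<alpha> \<rho> \<delta> (U p)"
    "ExpU_norm q \<kappa> \<beta> \<mu> \<alpha> \<rho> \<delta> (U p) (\<lambda>\<tau> m. w1 p \<tau> m \<epsilon>) \<le> \<omega>"
    "borel_equation q k1 (- real dD / \<kappa>) D dD I d \<Delta> dl Q R C \<epsilon> (\<lambda>\<tau> m. \<psi>1 p \<tau> m \<epsilon>)
             (U p \<union> cball 0 \<rho>) (\<lambda>\<tau> m. w1 p \<tau> m \<epsilon>)"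
    if "p < N" "\<epsilon> \<in> ball 0 \<epsilon>0" for p \<epsilon>
    using w1[OF that] by (auto simp: unique_solution_in_def)
  have w2E: "(\<lambda>\<tau> m. w2 p \<tau> m \<epsilon>) \<in> ExpS_space q k2 \<beta> \<mu> \<nu> (S p) (Rb p)"
    if "p < N" "\<epsilon> \<in> ball 0 \<epsilon>0" for p \<epsilon>
    using w2(1)[OF that] by (auto simp: unique_solution_in_def)
  have contS: "continuous_on (halfline (dir p) \<times> UNIV) (\<lambda>(\<tau>, m). w \<tau> m)"
    if "p < N" "w \<in> ExpS_space q k2 \<beta> \<mu> \<nu> (S p) (Rb p)" for p w
    using that(2) halfS[OF that(1)] by (auto simp: ExpS_space_def intro: continuous_on_subset)
  have \<psi>_agree: "\<psi>1 p0 \<tau> m \<epsilon> = \<psi>1 p1 \<tau> m \<epsilon>" if "\<epsilon> \<in> ball 0 \<epsilon>0" "\<tau> \<in> ball 0 \<rho>" for \<tau> m \<epsilon>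
    using sums_unique2[OF \<psi>1(1)[OF p0(1) that] \<psi>1(1)[OF p1 that]] .
  \<comment> \<open>The uniqueness of \<open>w1 p\<close> refers to the domain \<open>U p \<union> cball 0 \<rho>\<close>, which depends on \<open>p\<close>. The two
    solutions are therefore compared by means of the equation near \<open>0\<close> and the identity theorem.\<close>
  have w_agree: "w1 p0 \<tau> m \<epsilon> = w1 p1 \<tau> m \<epsilon>" if \<epsilon>: "\<epsilon> \<in> ball 0 \<epsilon>0" and \<tau>: "\<tau> \<in> ball 0 \<rho>" for \<tau> m \<epsilon>
  proof -
    \<comment> \<open>The rate \<open>\<beta> / 2\<close> could be any rate strictly below \<open>\<beta>\<close>, as the convolution requires.\<close>
    have bnd: "\<exists>A. \<forall>\<tau>\<in>cball 0 \<rho>. continuous_on UNIV (\<lambda>m. w1 p \<tau> m \<epsilon>) \<and> (\<forall>m. norm (w1 p \<tau> m \<epsilon>) \<le> A * exp (- (\<beta> / 2) * \<bar>m\<bar>))"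
      if p: "p < N" for p
    proof -
      obtain B where B0: "B > 0" and bd: "\<And>h W. h \<in> ExpU_space q \<kappa> \<beta> \<mu> \<alpha> \<rho> \<delta> (U p) \<Longrightarrow>
          ExpU_norm q \<kappa> \<beta> \<mu> \<alpha> \<rho> \<delta> (U p) h \<le> W \<Longrightarrow>
          0 \<le> W \<and> (\<forall>\<tau>\<in>cball 0 \<rho>. \<forall>m. norm (h \<tau> m) \<le> B * W / weight_E \<beta> \<mu> m)"
        using ExpU_bounds[OF q less_imp_le[OF \<kappa>] \<rho> \<delta>(1) \<delta>(2)[OF p], of \<beta> \<mu> \<alpha>] by metis
      note B = B0 bd[OF w1E(1,2)[OF p \<epsilon>], THEN conjunct1]
        bd[OF w1E(1,2)[OF p \<epsilon>], THEN conjunct2, rule_format]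
      have "norm (w1 p \<tau> m \<epsilon>) \<le> B * \<omega> * exp (- (\<beta> / 2) * \<bar>m\<bar>)" if "\<tau> \<in> cball 0 \<rho>" for \<tau> m
      proof -
        have "(\<beta> / 2) * \<bar>m\<bar> \<le> \<beta> * \<bar>m\<bar>" using \<beta> by (intro mult_right_mono) auto
        then have "exp (- \<beta> * \<bar>m\<bar>) \<le> exp (- (\<beta> / 2) * \<bar>m\<bar>)" by simp
        then have "1 / weight_E \<beta> \<mu> m \<le> exp (- (\<beta> / 2) * \<bar>m\<bar>)"
          using inverse_weight_E_le[OF \<mu>0, of \<beta> m] by linarith
        then have "B * \<omega> * (1 / weight_E \<beta> \<mu> m) \<le> B * \<omega> * exp (- (\<beta> / 2) * \<bar>m\<bar>)"
          using B by (intro mult_left_mono) auto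
        then show ?thesis using B(3)[OF that, of m] by simp
      qed
      moreover have "continuous_on UNIV (\<lambda>m. w1 p \<tau> m \<epsilon>)" if "\<tau> \<in> cball 0 \<rho>" for \<tau>
      proof -
        have "continuous_on ((U p \<union> cball 0 \<rho>) \<times> UNIV) (\<lambda>(\<tau>, m). w1 p \<tau> m \<epsilon>)"
          using w1E(1)[OF p \<epsilon>] by (simp add: ExpU_space_def)
        then have "continuous_on UNIV (\<lambda>m. case (\<tau>, m) of (\<tau>, m) \<Rightarrow> w1 p \<tau> m \<epsilon>)"
          by (rule continuous_on_compose2) (use that in \<open>auto intro!: continuous_intros\<close>)
        then show ?thesis by simp
      qed
      ultimately show ?thesis by blast
    qed
    obtain A0 A1 where A01: "\<And>\<tau> m. \<tau> \<in> cball 0 \<rho> \<Longrightarrow> norm (w1 p0 \<tau> m \<epsilon>) \<le> A0 * exp (- (\<beta> / 2) * \<bar>m\<bar>)"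
        "\<And>\<tau> m. \<tau> \<in> cball 0 \<rho> \<Longrightarrow> norm (w1 p1 \<tau> m \<epsilon>) \<le> A1 * exp (- (\<beta> / 2) * \<bar>m\<bar>)"
      and cnt: "\<And>\<tau>. \<tau> \<in> cball 0 \<rho> \<Longrightarrow> continuous_on UNIV (\<lambda>m. w1 p0 \<tau> m \<epsilon>)"
        "\<And>\<tau>. \<tau> \<in> cball 0 \<rho> \<Longrightarrow> continuous_on UNIV (\<lambda>m. w1 p1 \<tau> m \<epsilon>)"
      using bnd[OF p0(1)] bnd[OF p1] by blast
    have Amax: "a * exp (- (\<beta> / 2) * \<bar>m\<bar>) \<le> max A0 A1 * exp (- (\<beta> / 2) * \<bar>m\<bar>)" if "a = A0 \<or> a = A1" for a m
      using that by (intro mult_right_mono) auto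
    have "\<exists>r>0. \<forall>\<tau> m. 0 < norm \<tau> \<longrightarrow> norm \<tau> < r \<longrightarrow> w1 p0 \<tau> m \<epsilon> = w1 p1 \<tau> m \<epsilon>"
    proof (rule borel_equation_unique_near_0[where b = "\<beta> / 2" and \<beta> = \<beta> and A = "max A0 A1" and cb = Cbound,
          OF q _ D(2) \<rho> _ _ _ nz(1) SQ(1) _ _ _ _ _ w1E(3)[OF p0(1) \<epsilon>] w1E(3)[OF p1 \<epsilon>]])
      show "- real dD / \<kappa> \<le> 0" using \<kappa> by simp
      show "norm \<epsilon> \<le> 1" using \<epsilon> small(2) by simp
      show "finite (I l)" if "l \<in> {1..D - 1}" for l using I[OF that] by simp
      show "1 \<le> d j l \<and> real (dl l) - real (d j l) / real k1 - 1 \<le> 0" if "l \<in> {1..D - 1}" "j \<in> I l" for l j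
      proof -
        have "real (d j l) / real k2 \<le> real (d j l) / real k1" using k(1,2) by (intro divide_left_mono) auto
        then show ?thesis using d[OF that] by linarith
      qed
      show "rQ * norm (poly (R D) (\<i> * of_real m)) \<le> norm (poly Q (\<i> * of_real m))" for m
      proof -
        have "rQ \<le> norm (poly Q (\<i> * of_real m) / poly (R D) (\<i> * of_real m))"
          using SQ(3)[of m] by (simp add: closed_trunc_sector_def)
        then show ?thesis using nz(2)[of m] by (simp add: norm_divide pos_le_divide_eq)
      qed
      show "0 \<le> \<beta> / 2" "\<beta> / 2 < \<beta>" using \<beta> by auto
      show "degree (R l) \<le> degree Q" if "l \<in> {1..D - 1}" for l using deg(2)[OF that] deg(1) by linarith
      show "continuous_on UNIV (\<lambda>m. C j l m \<epsilon>) \<and> 0 \<le> Cbound j l \<and>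
         (\<forall>m. norm (C j l m \<epsilon>) * (1 + \<bar>m\<bar>) ^ degree (R l) \<le> Cbound j l * exp (- \<beta> * \<bar>m\<bar>))"
        if "l \<in> {1..D - 1}" "j \<in> I l" for l j
      proof (intro conjI allI)
        note CE = C(1)[OF that \<epsilon>]
        show "continuous_on UNIV (\<lambda>m. C j l m \<epsilon>)" "0 \<le> Cbound j l" using E_space_bound[OF CE[THEN conjunct1] CE[THEN conjunct2]] by auto
        fix m
        have "real (degree (R l)) \<le> \<mu>" using deg(2)[OF that(1)] \<mu> by linarith
        then have "(1 + \<bar>m\<bar>) ^ degree (R l) * exp (\<beta> * \<bar>m\<bar>) * norm (C j l m \<epsilon>) \<le> weight_E \<beta> \<mu> m * norm (C j l m \<epsilon>)"
          by (intro mult_right_mono weight_E_ge) auto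
        also have "\<dots> \<le> Cbound j l" by (rule E_space_bound(3)[OF CE[THEN conjunct1] CE[THEN conjunct2]])
        finally show "norm (C j l m \<epsilon>) * (1 + \<bar>m\<bar>) ^ degree (R l) \<le> Cbound j l * exp (- \<beta> * \<bar>m\<bar>)"
          by (simp add: exp_minus field_simps)
      qed
      fix \<tau> :: complex assume \<tau>: "0 < norm \<tau>" "norm \<tau> < \<rho>"
      show "\<tau> \<in> U p0 \<union> cball 0 \<rho> \<and> \<tau> \<in> U p1 \<union> cball 0 \<rho> \<and> (\<forall>m. \<psi>1 p0 \<tau> m \<epsilon> = \<psi>1 p1 \<tau> m \<epsilon>)"
        using \<tau> \<psi>_agree[OF \<epsilon>, of \<tau>] by auto
      show "continuous_on UNIV (\<lambda>m. w1 p0 \<tau> m \<epsilon>) \<and> (\<forall>m. norm (w1 p0 \<tau> m \<epsilon>) \<le> max A0 A1 * exp (- (\<beta> / 2) * \<bar>m\<bar>))"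
        using cnt(1)[of \<tau>] order_trans[OF A01(1) Amax, of \<tau>] \<tau> by auto
      show "continuous_on UNIV (\<lambda>m. w1 p1 \<tau> m \<epsilon>) \<and> (\<forall>m. norm (w1 p1 \<tau> m \<epsilon>) \<le> max A0 A1 * exp (- (\<beta> / 2) * \<bar>m\<bar>))"
        using cnt(2)[of \<tau>] order_trans[OF A01(2) Amax, of \<tau>] \<tau> by auto
    qed
    then obtain r where r: "r > 0" "\<And>\<tau> m. 0 < norm \<tau> \<Longrightarrow> norm \<tau> < r \<Longrightarrow> w1 p0 \<tau> m \<epsilon> = w1 p1 \<tau> m \<epsilon>" by blast
    have hol1: "(\<lambda>\<tau>. w1 p \<tau> m \<epsilon>) holomorphic_on ball 0 \<rho>" if "p < N" for p
      using w1E(1)[OF that \<epsilon>] by (auto simp: ExpU_space_def intro: holomorphic_on_subset)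
    show ?thesis
    proof (rule analytic_continuation_open[of "ball 0 (min r \<rho>) - {0}" "ball 0 \<rho>" "\<lambda>\<tau>. w1 p0 \<tau> m \<epsilon>" "\<lambda>\<tau>. w1 p1 \<tau> m \<epsilon>"])
      have "of_real (min r \<rho> / 2) \<in> ball (0::complex) (min r \<rho>) - {0}" using r(1) \<rho> by auto
      then show "ball (0::complex) (min r \<rho>) - {0} \<noteq> {}" by blast
    qed (use hol1[OF p0(1)] hol1[OF p1] r(2) \<tau> in auto)
  qed
  \<comment> \<open>One statement for the solutions and for the forcing terms. The order \<open>k0\<close> is the growth of the
    function \<open>v\<close> in the Borel plane, and \<open>\<gamma>'\<close> is the direction of integration in the outer transform.\<close>
  have flat: "\<exists>K>0. \<exists>M. \<forall>t\<in>\<T>. \<forall>z\<in>strip \<beta>'. \<forall>\<epsilon>\<in>X.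
     norm (g p1 t z \<epsilon> - g p0 t z \<epsilon>) \<le> K * gauss q k1 (ln (norm \<epsilon>)) * norm \<epsilon> powr M"
    if k0: "0 \<le> k0" "k0 \<le> \<kappa>"
      and v: "\<And>p \<epsilon>. p < N \<Longrightarrow> \<epsilon> \<in> ball 0 \<epsilon>0 \<Longrightarrow> (\<lambda>\<tau> m. v p \<tau> m \<epsilon>) \<in> ExpU_space q k0 \<beta> \<mu> \<alpha> \<rho> \<delta> (U p) \<and>
         ExpU_norm q k0 \<beta> \<mu> \<alpha> \<rho> \<delta> (U p) (\<lambda>\<tau> m. v p \<tau> m \<epsilon>) \<le> W p"
      and w: "\<And>p \<epsilon>. p < N \<Longrightarrow> \<epsilon> \<in> ball 0 \<epsilon>0 \<Longrightarrow> (\<lambda>\<tau> m. w p \<tau> m \<epsilon>) \<in> ExpS_space q k2 \<beta> \<mu> \<nu> (S p) (Rb p) \<and>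
         ExpS_norm q k2 \<beta> \<mu> \<nu> (S p) (Rb p) (\<lambda>\<tau> m. w p \<tau> m \<epsilon>) \<le> W p"
      and lap: "\<And>p \<tau> m \<epsilon>. p < N \<Longrightarrow> \<epsilon> \<in> ball 0 \<epsilon>0 \<Longrightarrow> \<tau> \<in> Rb p \<Longrightarrow>
         w p \<tau> m \<epsilon> = q_laplace q \<kappa> (dir p) (\<lambda>h. v p h m \<epsilon>) \<tau>"
      and agree: "\<And>\<tau> m \<epsilon>. \<epsilon> \<in> ball 0 \<epsilon>0 \<Longrightarrow> \<tau> \<in> ball 0 \<rho> \<Longrightarrow> v p0 \<tau> m \<epsilon> = v p1 \<tau> m \<epsilon>"
      and dirn: "\<And>p t z \<epsilon>. p < N \<Longrightarrow> t \<in> \<T> \<Longrightarrow> z \<in> strip \<beta>' \<Longrightarrow> \<epsilon> \<in> E p \<Longrightarrow>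
         admissible_direction (dir p) (S p) (\<epsilon> * t) (\<gamma>' p (\<epsilon> * t)) \<and>
         g p t z \<epsilon> = c0 * (LINT m|lborel. halfline_integral (\<gamma>' p (\<epsilon> * t)) (laplace_kernel q k2 (\<epsilon> * t) (\<lambda>\<tau>. w p \<tau> m \<epsilon>)) * exp (\<i> * z * of_real m))"
    for k0 W v w g \<gamma>' c0
  proof -
    have "\<exists>B>0. \<forall>\<epsilon>\<in>ball 0 \<epsilon>0. \<forall>m. laplace_pair q \<kappa> k2 \<alpha> \<nu> \<rho> R0 \<delta>' (B * W p / weight_E \<beta> \<mu> m) (dir p) (\<lambda>\<tau>. v p \<tau> m \<epsilon>) (\<lambda>\<tau>. w p \<tau> m \<epsilon>)"
      if p: "p < N" for p
    proof -
      obtain B where B: "B > 0" and LP: "\<And>v w W. v \<in> ExpU_space q k0 \<beta> \<mu> \<alpha> \<rho> \<delta> (U p) \<Longrightarrow>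
          ExpU_norm q k0 \<beta> \<mu> \<alpha> \<rho> \<delta> (U p) v \<le> W \<Longrightarrow>
          w \<in> ExpS_space q k2 \<beta> \<mu> \<nu> (S p) (Rb p) \<Longrightarrow> ExpS_norm q k2 \<beta> \<mu> \<nu> (S p) (Rb p) w \<le> W \<Longrightarrow>
          \<forall>\<tau>\<in>Rb p. \<forall>m. w \<tau> m = q_laplace q \<kappa> (dir p) (\<lambda>h. v h m) \<tau> \<Longrightarrow>
          \<forall>m. laplace_pair q \<kappa> k2 \<alpha> \<nu> \<rho> R0 \<delta>' (B * W / weight_E \<beta> \<mu> m) (dir p) (\<lambda>\<tau>. v \<tau> m) (\<lambda>\<tau>. w \<tau> m)"
        using laplace_pair_of_Exp[OF q k0 \<rho> \<delta>(1) R0(1) \<delta>(2)[OF p] US(1)[OF p] US(2)[OF p] Rb'[OF p], of \<beta> \<mu> \<alpha> "real k2" \<nu>]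
        by metis
      have "\<forall>m. laplace_pair q \<kappa> k2 \<alpha> \<nu> \<rho> R0 \<delta>' (B * W p / weight_E \<beta> \<mu> m) (dir p) (\<lambda>\<tau>. v p \<tau> m \<epsilon>) (\<lambda>\<tau>. w p \<tau> m \<epsilon>)"
        if \<epsilon>: "\<epsilon> \<in> ball 0 \<epsilon>0" for \<epsilon>
        by (rule LP[OF v[OF p \<epsilon>, THEN conjunct1] v[OF p \<epsilon>, THEN conjunct2]
              w[OF p \<epsilon>, THEN conjunct1] w[OF p \<epsilon>, THEN conjunct2]]) (use lap[OF p \<epsilon>] in blast)
      with B show ?thesis by blast
    qed
    then obtain B where B: "\<And>p. p < N \<Longrightarrow> B p > 0" and pair: "\<And>p \<epsilon> m. p < N \<Longrightarrow> \<epsilon> \<in> ball 0 \<epsilon>0 \<Longrightarrow>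
      laplace_pair q \<kappa> k2 \<alpha> \<nu> \<rho> R0 \<delta>' (B p * W p / weight_E \<beta> \<mu> m) (dir p) (\<lambda>\<tau>. v p \<tau> m \<epsilon>) (\<lambda>\<tau>. w p \<tau> m \<epsilon>)"
      by metis
    define A where "A = Max {0, B p0 * W p0, B p1 * W p1, W p0, W p1}"
    have A: "A \<ge> 0" "B p0 * W p0 \<le> A" "B p1 * W p1 \<le> A" "W p0 \<le> A" "W p1 \<le> A" by (simp_all add: A_def)
    have pairA: "laplace_pair q \<kappa> k2 \<alpha> \<nu> \<rho> R0 \<delta>' (A / weight_E \<beta> \<mu> m) (dir p) (\<lambda>\<tau>. v p \<tau> m \<epsilon>) (\<lambda>\<tau>. w p \<tau> m \<epsilon>)"
      if "p = p0 \<or> p = p1" "\<epsilon> \<in> ball 0 \<epsilon>0" for p \<epsilon> m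
    proof (rule laplace_pair_mono[OF pair])
      show "p < N" "\<epsilon> \<in> ball 0 \<epsilon>0" using that p0(1) p1 by auto
      show "B p * W p / weight_E \<beta> \<mu> m \<le> A / weight_E \<beta> \<mu> m"
        using that(1) A by (intro divide_right_mono) (auto simp: less_imp_le)
    qed
    \<comment> \<open>The estimates need the ray in the bisecting direction, where \<open>calR\<close> controls the kernel uniformly.\<close>
    have g_dir: "g p t z \<epsilon> = c0 * (LINT m|lborel. halfline_integral (dir p) (laplace_kernel q k2 (\<epsilon> * t) (\<lambda>\<tau>. w p \<tau> m \<epsilon>)) * exp (\<i> * z * of_real m))"
      if p: "p = p0 \<or> p = p1" and t: "t \<in> \<T>" and z: "z \<in> strip \<beta>'" and \<epsilon>: "\<epsilon> \<in> X" for p t z \<epsilon>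
    proof -
      have pN: "p < N" and \<epsilon>p: "\<epsilon> \<in> E p" and \<epsilon>b: "\<epsilon> \<in> ball 0 \<epsilon>0" using p p0(1) p1 \<epsilon> X_ball(1) by (auto simp: X_def)
      note dr = dirn[OF pN t z \<epsilon>p]
      have T: "\<epsilon> * t \<noteq> 0" "norm (\<epsilon> * t) < R0" using XT[OF t \<epsilon>] by (auto simp: calR_def)
      have "halfline_integral (\<gamma>' p (\<epsilon> * t)) (laplace_kernel q k2 (\<epsilon> * t) (\<lambda>\<tau>. w p \<tau> m \<epsilon>)) =
          halfline_integral (dir p) (laplace_kernel q k2 (\<epsilon> * t) (\<lambda>\<tau>. w p \<tau> m \<epsilon>))" for m
      proof (rule outer_direction_independent[OF q \<kappa> kk(2) k1_eq \<delta>' \<rho> R0 \<alpha>R \<nu>R _ pairA[OF p \<epsilon>b] T _ Rb(3)[OF pN]])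
        show "0 \<le> A / weight_E \<beta> \<mu> m" using A by (simp add: less_imp_le)
        show "(\<lambda>\<tau>. w p \<tau> m \<epsilon>) holomorphic_on S p"
          using w[OF pN \<epsilon>b] by (auto simp: ExpS_space_def intro: holomorphic_on_subset)
        show "halfline \<theta> \<subseteq> S p \<and> - (\<epsilon> * t) \<notin> halfline \<theta>" if "\<theta> \<in> closed_segment (dir p) (\<gamma>' p (\<epsilon> * t))" for \<theta>
          using dr that by (simp add: admissible_direction_def)
        fix u assume u: "u \<in> S p"
        have "norm (w p u m \<epsilon>) \<le> W p / weight_E \<beta> \<mu> m * q_growth q (real k2) \<nu> (norm u)"
          using ExpS_bound(2)[of "\<lambda>\<tau> m. w p \<tau> m \<epsilon>"] w[OF pN \<epsilon>b] u by (auto simp: ExpS_dom_def)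
        moreover have "W p / weight_E \<beta> \<mu> m \<le> A / weight_E \<beta> \<mu> m"
          using p A by (intro divide_right_mono) (auto simp: less_imp_le)
        ultimately show "norm (w p u m \<epsilon>) \<le> A / weight_E \<beta> \<mu> m * q_growth q (real k2) \<nu> (norm u)"
          by (meson q_growth_nonneg mult_right_mono order_trans)
      qed
      then show ?thesis using dr by simp
    qed
    show ?thesis
    proof (rule flat_difference[OF q \<kappa> kk(2) k1_eq \<delta>' \<rho> R0 \<alpha>R \<nu>R \<beta>(2) \<mu>0 A(1), where ?v1.0 = "v p0" and ?v2.0 = "v p1" and ?w1.0 = "w p0" and ?w2.0 = "w p1"
          and ?d1.0 = "dir p0" and ?d2.0 = "dir p1"])
      show "continuous_on (halfline (dir p0) \<times> UNIV) (\<lambda>(\<tau>, m). w p0 \<tau> m \<epsilon>)" if "\<epsilon> \<in> X" for \<epsilon>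
        using contS[OF p0(1)] w[OF p0(1) X_ball(1)[OF that]] by blast
      show "continuous_on (halfline (dir p1) \<times> UNIV) (\<lambda>(\<tau>, m). w p1 \<tau> m \<epsilon>)" if "\<epsilon> \<in> X" for \<epsilon>
        using contS[OF p1] w[OF p1 X_ball(1)[OF that]] by blast
    qed (use pairA X_ball agree XT \<T>1 g_dir in auto)
  qed
  have u_flat: "\<exists>K>0. \<exists>M. \<forall>t\<in>\<T>. \<forall>z\<in>strip \<beta>'. \<forall>\<epsilon>\<in>X.
     norm (u p1 t z \<epsilon> - u p0 t z \<epsilon>) \<le> K * gauss q k1 (ln (norm \<epsilon>)) * norm \<epsilon> powr M"
  proof (rule flat[where v = w1 and w = w2 and ?k0.0 = \<kappa> and W = "\<lambda>_. \<omega>" and \<gamma>' = \<gamma> and ?c0.0 = "1 / of_real (sqrt (2 * pi)) * (1 / of_real (pi_q q k2))"])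
    fix p t z \<epsilon> assume "p < N" "t \<in> \<T>" "z \<in> strip \<beta>'" "\<epsilon> \<in> E p"
    then show "admissible_direction (dir p) (S p) (\<epsilon> * t) (\<gamma> p (\<epsilon> * t)) \<and>
       u p t z \<epsilon> = 1 / of_real (sqrt (2 * pi)) * (1 / of_real (pi_q q k2)) * (LINT m|lborel. halfline_integral (\<gamma> p (\<epsilon> * t)) (laplace_kernel q k2 (\<epsilon> * t) (\<lambda>\<tau>. w2 p \<tau> m \<epsilon>)) * exp (\<i> * z * of_real m))"
      using \<gamma> u unfolding laplace_kernel_def[abs_def] by blast
  qed (use \<kappa> w1E w2E w2(2) cont w_agree in auto)
  have "\<forall>p. \<exists>Z. p < N \<longrightarrow> (\<forall>\<epsilon>\<in>ball 0 \<epsilon>0.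
         (\<lambda>\<tau> m. \<psi>2 p \<tau> m \<epsilon>) \<in> ExpS_space q k2 \<beta> \<mu> \<nu> (S p) (Rb p) \<and>
         ExpS_norm q k2 \<beta> \<mu> \<nu> (S p) (Rb p) (\<lambda>\<tau> m. \<psi>2 p \<tau> m \<epsilon>) \<le> Z)"
    using \<psi>2(2) by blast
  from choice[OF this] obtain Z where Z: "\<And>p \<epsilon>. p < N \<Longrightarrow> \<epsilon> \<in> ball 0 \<epsilon>0 \<Longrightarrow>
         (\<lambda>\<tau> m. \<psi>2 p \<tau> m \<epsilon>) \<in> ExpS_space q k2 \<beta> \<mu> \<nu> (S p) (Rb p) \<and>
         ExpS_norm q k2 \<beta> \<mu> \<nu> (S p) (Rb p) (\<lambda>\<tau> m. \<psi>2 p \<tau> m \<epsilon>) \<le> Z p" by blast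
  have f_flat: "\<exists>K>0. \<exists>M. \<forall>t\<in>\<T>. \<forall>z\<in>strip \<beta>'. \<forall>\<epsilon>\<in>X.
     norm (f p1 t z \<epsilon> - f p0 t z \<epsilon>) \<le> K * gauss q k1 (ln (norm \<epsilon>)) * norm \<epsilon> powr M"
  proof (rule flat[where v = \<psi>1 and w = \<psi>2 and ?k0.0 = "real k1" and W = "\<lambda>p. max \<zeta> (Z p)" and \<gamma>' = "\<lambda>p _. dir p" and ?c0.0 = "1 / of_real (sqrt (2 * pi)) * (1 / of_real (pi_q q k2))"])
    fix p t z \<epsilon> assume a: "p < N" "t \<in> \<T>" "z \<in> strip \<beta>'" "\<epsilon> \<in> E p"
    have cl: "clear \<delta>' (\<epsilon> * t) (dir p)" using assoc(2)[OF a(1,2,4)] Rb(1)[OF a(1)] by (auto simp: calR_iff_clear)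
    have "halfline (dir p) \<subseteq> S p" using halfline_in_sector[OF US(2)[OF a(1)]] by (auto simp: halfline_def)
    moreover have "- (\<epsilon> * t) \<notin> halfline (dir p)"
    proof
      assume "- (\<epsilon> * t) \<in> halfline (dir p)"
      then obtain r where r: "r > 0" "- (\<epsilon> * t) = of_real r * cis (dir p)" by (auto simp: halfline_def)
      then have "\<epsilon> * t = - (of_real r * cis (dir p))" by (metis minus_minus)
      then have "1 + of_real r * (cis (dir p) / (\<epsilon> * t)) = 0" using r by simp
      then show False using cl r \<delta>' unfolding clear_def by (metis less_imp_le norm_zero not_less)
    qed
    ultimately have ad: "admissible_direction (dir p) (S p) (\<epsilon> * t) (dir p)" by (simp add: admissible_direction_def)
    have "f p t z \<epsilon> = 1 / of_real (sqrt (2 * pi)) * (LINT m|lborel. (1 / of_real (pi_q q k2)) * (halfline_integral (dir p) (laplace_kernel q k2 (\<epsilon> * t) (\<lambda>\<tau>. \<psi>2 p \<tau> m \<epsilon>)) * exp (\<i> * z * of_real m)))"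
      unfolding f[OF a] inv_fourier_def q_laplace_kernel by (simp only: mult.assoc)
    also have "\<dots> = 1 / of_real (sqrt (2 * pi)) * (1 / of_real (pi_q q k2)) * (LINT m|lborel. halfline_integral (dir p) (laplace_kernel q k2 (\<epsilon> * t) (\<lambda>\<tau>. \<psi>2 p \<tau> m \<epsilon>)) * exp (\<i> * z * of_real m))"
      by (simp only: integral_mult_right_zero mult.assoc)
    finally show "admissible_direction (dir p) (S p) (\<epsilon> * t) (dir p) \<and>
       f p t z \<epsilon> = 1 / of_real (sqrt (2 * pi)) * (1 / of_real (pi_q q k2)) * (LINT m|lborel. halfline_integral (dir p) (laplace_kernel q k2 (\<epsilon> * t) (\<lambda>\<tau>. \<psi>2 p \<tau> m \<epsilon>)) * exp (\<i> * z * of_real m))"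
      using ad by blast
  next
    show "\<psi>2 p \<tau> m \<epsilon> = q_laplace q \<kappa> (dir p) (\<lambda>h. \<psi>1 p h m \<epsilon>) \<tau>" if "p < N" "\<epsilon> \<in> ball 0 \<epsilon>0" "\<tau> \<in> Rb p" for p \<tau> m \<epsilon>
      using \<psi>2(1)[OF that(1,2)] Rb_dom[OF that(1)] that(3) by blast
  next
    show "(\<lambda>\<tau> m. \<psi>1 p \<tau> m \<epsilon>) \<in> ExpU_space q (real k1) \<beta> \<mu> \<alpha> \<rho> \<delta> (U p) \<and>
         ExpU_norm q (real k1) \<beta> \<mu> \<alpha> \<rho> \<delta> (U p) (\<lambda>\<tau> m. \<psi>1 p \<tau> m \<epsilon>) \<le> max \<zeta> (Z p)" if "p < N" "\<epsilon> \<in> ball 0 \<epsilon>0" for p \<epsilon>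
      using \<psi>1(2)[OF that] by (auto simp: le_max_iff_disj)
  next
    show "(\<lambda>\<tau> m. \<psi>2 p \<tau> m \<epsilon>) \<in> ExpS_space q (real k2) \<beta> \<mu> \<nu> (S p) (Rb p) \<and>
         ExpS_norm q (real k2) \<beta> \<mu> \<nu> (S p) (Rb p) (\<lambda>\<tau> m. \<psi>2 p \<tau> m \<epsilon>) \<le> max \<zeta> (Z p)" if "p < N" "\<epsilon> \<in> ball 0 \<epsilon>0" for p \<epsilon>
      using Z[OF that] by (auto simp: le_max_iff_disj)
  qed (use k1\<kappa> \<psi>_agree in auto)
  from u_flat obtain Ku Mu where Ku: "Ku > 0" "\<And>t z \<epsilon>. t \<in> \<T> \<Longrightarrow> z \<in> strip \<beta>' \<Longrightarrow> \<epsilon> \<in> X \<Longrightarrow>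
     norm (u p1 t z \<epsilon> - u p0 t z \<epsilon>) \<le> Ku * gauss q k1 (ln (norm \<epsilon>)) * norm \<epsilon> powr Mu" by blast
  from f_flat obtain Kf Mf where Kf: "Kf > 0" "\<And>t z \<epsilon>. t \<in> \<T> \<Longrightarrow> z \<in> strip \<beta>' \<Longrightarrow> \<epsilon> \<in> X \<Longrightarrow>
     norm (f p1 t z \<epsilon> - f p0 t z \<epsilon>) \<le> Kf * gauss q k1 (ln (norm \<epsilon>)) * norm \<epsilon> powr Mf" by blast
  have up: "a * gauss q k1 (ln (norm \<epsilon>)) * norm \<epsilon> powr M \<le>
      (Ku + Kf) * exp (- (real k1 / (2 * ln q)) * (ln (norm \<epsilon>))\<^sup>2) * norm \<epsilon> powr (min Mu Mf)"
    if "\<epsilon> \<in> X" "0 \<le> a" "a \<le> Ku + Kf" "min Mu Mf \<le> M" for \<epsilon> a M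
  proof -
    have "norm \<epsilon> powr M \<le> norm \<epsilon> powr (min Mu Mf)" using X_ball(2)[OF that(1)] that(4) by (intro powr_mono') auto
    moreover have "gauss q k1 (ln (norm \<epsilon>)) = exp (- (real k1 / (2 * ln q)) * (ln (norm \<epsilon>))\<^sup>2)" by (simp add: gauss_def)
    ultimately show ?thesis using that Ku(1) Kf(1) by (intro mult_mono) auto
  qed
  have "\<forall>t\<in>\<T>. \<forall>z\<in>strip \<beta>'. \<forall>\<epsilon>\<in>X.
      norm (u p1 t z \<epsilon> - u p0 t z \<epsilon>) \<le> (Ku + Kf) * exp (- (real k1 / (2 * ln q)) * (ln (norm \<epsilon>))\<^sup>2) * norm \<epsilon> powr (min Mu Mf) \<and>
      norm (f p1 t z \<epsilon> - f p0 t z \<epsilon>) \<le> (Ku + Kf) * exp (- (real k1 / (2 * ln q)) * (ln (norm \<epsilon>))\<^sup>2) * norm \<epsilon> powr (min Mu Mf)"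
  proof (intro conjI ballI)
    fix t z \<epsilon> assume a: "t \<in> \<T>" "z \<in> strip \<beta>'" "\<epsilon> \<in> X"
    show "norm (u p1 t z \<epsilon> - u p0 t z \<epsilon>) \<le> (Ku + Kf) * exp (- (real k1 / (2 * ln q)) * (ln (norm \<epsilon>))\<^sup>2) * norm \<epsilon> powr (min Mu Mf)"
      by (rule order_trans[OF Ku(2)[OF a] up[OF a(3)]]) (use Ku(1) Kf(1) in auto)
    show "norm (f p1 t z \<epsilon> - f p0 t z \<epsilon>) \<le> (Ku + Kf) * exp (- (real k1 / (2 * ln q)) * (ln (norm \<epsilon>))\<^sup>2) * norm \<epsilon> powr (min Mu Mf)"
      by (rule order_trans[OF Kf(2)[OF a] up[OF a(3)]]) (use Ku(1) Kf(1) in auto)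
  qed
  moreover have "Ku + Kf > 0" using Ku(1) Kf(1) by simp
  ultimately show ?thesis
    unfolding p1_def[symmetric] X_def[symmetric] by blast
qed

end
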